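(* Let $d^\star_k = \frac{\ln k}{(k-1)(-\ln(1-1/k))} + 1$. If $k > 2$ and $d < d^\star_k$, then $F_{n,d,k}$ is satisfiable with high probability, i.e. $\Pr[F_{n,d,k} \text{ is satisfiable}] \to 1$ as $n\to\infty$ (over $n$ with $k \mid dn$).
   Context: Fix positive integers $d$ and $k$. For $n$ such that $k$ divides $dn$, set $m = dn/k$. The random formula $F_{n,d,k}$ is generated by the configuration model: there are $n$ variables and $m$ clauses; make $d$ copies of each variable and $k$ copies of each clause, and choose a uniformly random perfect matching between the $dn$ variable-copies and the $km$ clause-copies. A satisfying assignment is a subset $T$ of the variables such that every clause is matched to exactly one copy of a variable in $T$. $F_{n,d,k}$ is satisfiable if such a $T$ exists.
   Formalization: The limit is taken over n with k | n instead of k | dn, because a satisfying assignment has exactly n/k variables, so when k divides dn but not n (e.g. d = 2, k = 4, n ≡ 2 mod 4) the probability of satisfiability is 0. *)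

theory Defs
  imports "HOL-Probability.Probability"
begin

definition num_clauses :: "nat \<Rightarrow> nat \<Rightarrow> nat \<Rightarrow> nat" where
  "num_clauses n d k = d * n div k"

definition var_copies :: "nat \<Rightarrow> nat \<Rightarrow> (nat \<times> nat) set" where
  "var_copies n d = {..<n} \<times> {..<d}"

definition clause_copies :: "nat \<Rightarrow> nat \<Rightarrow> nat \<Rightarrow> (nat \<times> nat) set" where
  "clause_copies n d k = {..<num_clauses n d k} \<times> {..<k}"

text \<open>
  A perfect matching between the variable copies and the clause copies is a bijection between
  them; taking it extensional makes the function determined by the matching.
\<close>

definition matchings :: "nat \<Rightarrow> nat \<Rightarrow> nat \<Rightarrow> (nat \<times> nat \<Rightarrow> nat \<times> nat) set" where
  "matchings n d k =
     {f \<in> var_copies n d \<rightarrow>\<^sub>E clause_copies n d k. bij_betw f (var_copies n d) (clause_copies n d k)}"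

text \<open>For \<open>k > 0\<close> and \<open>k dvd d * n\<close> the set of matchings is finite and nonempty, as
  required by \<^const>\<open>pmf_of_set\<close>; see \<open>matchings_finite_nonempty\<close>.\<close>

definition random_formula :: "nat \<Rightarrow> nat \<Rightarrow> nat \<Rightarrow> (nat \<times> nat \<Rightarrow> nat \<times> nat) pmf" where
  "random_formula n d k = pmf_of_set (matchings n d k)"

definition satisfying_assignment ::
  "nat \<Rightarrow> nat \<Rightarrow> nat \<Rightarrow> (nat \<times> nat \<Rightarrow> nat \<times> nat) \<Rightarrow> nat set \<Rightarrow> bool" where
  "satisfying_assignment n d k f T \<longleftrightarrow>
     T \<subseteq> {..<n} \<and>
     (\<forall>c<num_clauses n d k. \<exists>!p. p \<in> T \<times> {..<d} \<and> fst (f p) = c)"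

definition satisfiable :: "nat \<Rightarrow> nat \<Rightarrow> nat \<Rightarrow> (nat \<times> nat \<Rightarrow> nat \<times> nat) \<Rightarrow> bool" where
  "satisfiable n d k f \<longleftrightarrow> (\<exists>T. satisfying_assignment n d k f T)"

definition d_star :: "nat \<Rightarrow> real" where
  "d_star k = ln (real k) / ((real k - 1) * (- ln (1 - 1 / real k))) + 1"

lemma matchings_finite_nonempty:
  assumes "k dvd d * n"
  shows "finite (matchings n d k)" "matchings n d k \<noteq> {}"
proof -
  have fin: "finite (var_copies n d)" "finite (clause_copies n d k)"
    by (auto simp: var_copies_def clause_copies_def)
  show "finite (matchings n d k)"
    unfolding matchings_def using fin by (auto intro!: finite_PiE)
  have "card (var_copies n d) = card (clause_copies n d k)"
    using assms by (simp add: var_copies_def clause_copies_def num_clauses_def mult.commute)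
  then obtain h where h: "bij_betw h (var_copies n d) (clause_copies n d k)"
    using finite_same_card_bij fin by blast
  have "restrict h (var_copies n d) \<in> matchings n d k"
    using h by (auto simp: matchings_def bij_betw_restrict_eq dest: bij_betwE)
  then show "matchings n d k \<noteq> {}" by blast
qed

text \<open>
  Counting clauses, a satisfying assignment has exactly \<open>n / k\<close> elements.  So if
  \<open>k dvd d * n\<close> but not \<open>k dvd n\<close> (e.g. \<open>d = 2\<close>, \<open>k = 4\<close>, \<open>n = 4 * j + 2\<close>),
  no formula is satisfiable.  Limits of the probability of satisfiability are therefore
  taken over the multiples \<open>n\<close> of \<open>k\<close>.
\<close>

lemma satisfying_assignment_card:
  assumes "d > 0" "k dvd d * n" "f \<in> matchings n d k" "satisfying_assignment n d k f T"
  shows "n = k * card T"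
proof -
  have T: "T \<subseteq> {..<n}"
    and ex: "\<And>c. c < num_clauses n d k \<Longrightarrow> \<exists>!p. p \<in> T \<times> {..<d} \<and> fst (f p) = c"
    using assms(4) by (auto simp: satisfying_assignment_def)
  have range: "fst (f p) < num_clauses n d k" if "p \<in> T \<times> {..<d}" for p
  proof -
    have "p \<in> var_copies n d" using that T by (auto simp: var_copies_def)
    then have "f p \<in> clause_copies n d k" using assms(3) by (auto simp: matchings_def)
    then show ?thesis by (auto simp: clause_copies_def)
  qed
  have "bij_betw (\<lambda>p. fst (f p)) (T \<times> {..<d}) {..<num_clauses n d k}"
    unfolding bij_betw_def
  proof
    show "inj_on (\<lambda>p. fst (f p)) (T \<times> {..<d})"
      by (rule inj_onI) (metis ex range)
    show "(\<lambda>p. fst (f p)) ` (T \<times> {..<d}) = {..<num_clauses n d k}"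
      using range ex by (auto simp: image_iff) (metis mem_Sigma_iff lessThan_iff prod.collapse)
  qed
  then have "card T * d = num_clauses n d k"
    by (auto dest: bij_betw_same_card simp: card_cartesian_product)
  then have "d * (k * card T) = d * n"
    using assms(2) by (metis dvd_mult_div_cancel mult.assoc mult.commute num_clauses_def)
  then show ?thesis using assms(1) by simp
qed

lemma prob_satisfiable_eq_0:
  assumes "d > 0" "k dvd d * n" "\<not> k dvd n"
  shows "measure_pmf.prob (random_formula n d k) {f. satisfiable n d k f} = 0"
proof -
  have "\<not> satisfiable n d k f" if "f \<in> matchings n d k" for f
    using satisfying_assignment_card[OF assms(1,2) that] assms(3)
    unfolding satisfiable_def by (metis dvd_triv_left)
  then show ?thesis
    using matchings_finite_nonempty[OF assms(2)]
    by (auto simp: measure_pmf_zero_iff random_formula_def)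
qed

end

theory Submission
  imports Defs "HOL-Real_Asymp.Real_Asymp"
begin

text \<open>
  Small subgraph conditioning in its second-moment form. Write \<open>n = k r\<close> and let \<open>X\<close> be the number of
  satisfying assignments. Laplace's method shows that \<open>E[X\<^sup>2] / E[X]\<^sup>2\<close> is asymptotically at most
  \<open>sqrt ((k - 1) / (k - d))\<close> whenever \<open>d < d_star k\<close>. This constant equals \<open>exp (\<Sum>l. \<lambda>\<^sub>l \<delta>\<^sub>l\<^sup>2)\<close>, where
  \<open>\<lambda>\<^sub>l = ((d-1)(k-1))\<^sup>l / (2l)\<close> is the limiting mean number of cycles of length \<open>l\<close> in the bipartite
  multigraph of the formula and \<open>1 + \<delta>\<^sub>l\<close>, with \<open>\<delta>\<^sub>l = (-1/(k-1))\<^sup>l\<close>, is the factor by which planting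
  a satisfying assignment changes this mean. Hence the short cycles explain all of the variance of \<open>X\<close>:
  the distance of \<open>X / E[X]\<close> in mean square from a polynomial \<open>g\<close> in the indicators of the cycles of
  length at most \<open>L\<close>, which equals \<open>\<Prod>(1 + \<delta>\<^sub>l) exp (- \<Sum>\<lambda>\<^sub>l \<delta>\<^sub>l)\<close> unless there are
  too many short cycles, is asymptotically at most \<open>exp (\<Sum>l. \<lambda>\<^sub>l \<delta>\<^sub>l\<^sup>2) - exp (\<Sum>l\<le>L. \<lambda>\<^sub>l \<delta>\<^sub>l\<^sup>2)\<close>, up
  to an error that vanishes as the degree of \<open>g\<close> grows. By Chebyshev's inequality for \<open>ln g\<close>, with high
  probability \<open>g\<close> is bounded away from \<open>0\<close> uniformly in \<open>L\<close>, and so \<open>X = 0\<close> is unlikely.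
\<close>

section \<open>Stirling's formula\<close>

text \<open>For d > 1 the constant \<open>sqrt ((k - 1) / (k - d))\<close> exceeds 1, so the second
  moment alone keeps Pr[X > 0] away from 0 but cannot push it to 1. The threshold is a first-moment
  quantity: pairs of equal assignments contribute 1 / E[X] to the normalised second moment, and
  \<open>d < d_star k\<close> says exactly that this contribution is exponentially small
  (\<open>rate_1_pos\<close>); the shape of the rate function then keeps every other overlap away
  from 1/k from dominating. An upper bound on E[X^2] suffices, because it enters the mean square
  distance with a positive sign. No convergence in distribution of the cycle counts is proved:
  everything is reduced to means of elementary symmetric polynomials of the cycle indicators, with
  and without the weight X, and this is why the product over the cycles is cut off at a fixed
  degree. The delicate point is tuples of cycles that meet. Their unions have more edges than
  vertices, which makes them negligible in the uniform model, and the bounded second moment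
  transfers this to the planted model.\<close>

lemma ln_stirling_convergent:
  "convergent (\<lambda>n::nat. ln (fact n) - (real n + 1/2) * ln (real n) + real n)"
proof -
  let ?u = "\<lambda>n::nat. ln (fact n :: real) - (real n + 1/2) * ln (real n) + real n"
  have eq: "\<forall>\<^sub>F n in sequentially. ?u (Suc n) - ?u n = (real n + 1/2) * ln (real n) + ln (real n + 1) - (real n + 3/2) * ln (real n + 1) + 1"
    using eventually_gt_at_top[of 0]
  proof eventually_elim
    case (elim n)
    have "ln (fact (Suc n) :: real) = ln (real n + 1) + ln (fact n)"
      by (simp add: ln_mult add.commute del: of_nat_Suc)
    then show ?case by (simp add: algebra_simps)
  qed
  \<comment> \<open>The increment is the error of the trapezoidal rule for ln on [n, n + 1], hence
    of order 1 / n^2 and summable; telescoping gives convergence.\<close>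
  have "(\<lambda>n::nat. (real n + 1/2) * ln (real n) + ln (real n + 1) - (real n + 3/2) * ln (real n + 1) + 1) \<in> O(\<lambda>n. 1 / real n ^ 2)"
    by real_asymp
  then have "(\<lambda>n. ?u (Suc n) - ?u n) \<in> O(\<lambda>n. 1 / real n ^ 2)"
    using eq landau_o.big.in_cong by fastforce
  then have "summable (\<lambda>n. ?u (Suc n) - ?u n)"
    by (rule summable_comparison_test_bigo[rotated])
       (use inverse_power_summable[of 2, where ?'a=real] in \<open>simp add: field_simps\<close>)
  then have "(\<lambda>n. \<Sum>i<n. ?u (Suc i) - ?u i) \<longlonglongrightarrow> suminf (\<lambda>n. ?u (Suc n) - ?u n)"
    by (rule summable_LIMSEQ)
  then have "convergent (\<lambda>n. ?u n - ?u 0)"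
    by (subst (asm) sum_lessThan_telescope) (auto simp: convergent_def)
  then show ?thesis
    using convergent_diff_const_right_iff by blast
qed

text \<open>The subexponential part of the factorial. At \<open>n = 0\<close> the denominator is
  \<open>0 ^ 0 = 1\<close>, so the value is 1 and the index 0 needs no exception in exact
  identities.\<close>

definition stirling_ratio :: "nat \<Rightarrow> real" where
  "stirling_ratio n = fact n / (real n / exp 1) ^ n"

text \<open>\<open>n ^ n / fact n\<close> is a single term of the exponential series of n.\<close>

lemma stirling_ratio_ge_1: "1 \<le> stirling_ratio n"
proof -
  have "real n ^ n / fact n \<le> exp (real n)"
  proof -
    have "(\<Sum>i\<in>{n}. real n ^ i /\<^sub>R fact i) \<le> suminf (\<lambda>i. real n ^ i /\<^sub>R fact i)"
      by (rule sum_le_suminf) (use summable_exp_generic[of "real n"] in auto)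
    then show ?thesis by (simp add: exp_def field_simps)
  qed
  then show ?thesis
    by (cases "n = 0") (auto simp: stirling_ratio_def power_divide field_simps exp_of_nat_mult[symmetric])
qed

text \<open>In this form Stirling's constant can be compared with the limit \<open>pi / 2\<close> of
  the Wallis product.\<close>

lemma wallis_prod_eq:
  "(\<Prod>i=1..n. (4*real i^2) / (4*real i^2 - 1)) = (2 ^ (4*n) * fact n ^ 4) / (fact (2*n) ^ 2 * (2 * real n + 1))"
proof (induction n)
  case (Suc n)
  have f: "fact (2 * Suc n) = (2 * real n + 2) * (2 * real n + 1) * (fact (2*n) :: real)"
    by (simp add: algebra_simps)
  have p: "(2::real) ^ (4 * Suc n) = 16 * 2 ^ (4*n)"
    by (simp add: power_add)
  have g: "fact (Suc n) ^ 4 = (real n + 1)^4 * (fact n :: real)^4"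
    by (simp add: power_mult_distrib add.commute)
  have nz: "fact (2*n) > (0::real)" "2 * real n + 1 > 0" "2 * real n + 2 > 0" "2*real n + 3 > 0" by auto
  have q: "4 * (real n + 1)^2 - 1 = (2*real n + 1) * (2*real n + 3)"
    by (simp add: power2_eq_square algebra_simps)
  have "(\<Prod>i=1..Suc n. (4*real i^2) / (4*real i^2 - 1)) =
     (2 ^ (4*n) * fact n ^ 4) / (fact (2*n) ^ 2 * (2 * real n + 1)) * ((4*(real n + 1)^2) / ((2*real n + 1) * (2*real n + 3)))"
    using Suc.IH q by (simp add: add.commute[of 1])
  also have "\<dots> = (16 * 2 ^ (4*n) * ((real n + 1)^4 * fact n ^ 4)) / (((2 * real n + 2) * (2 * real n + 1) * fact (2*n)) ^ 2 * (2 * real n + 3))"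
    using nz by (simp add: divide_simps) (simp add: power2_eq_square power4_eq_xxxx algebra_simps)
  finally show ?case unfolding f p g by (simp add: algebra_simps)
qed simp

text \<open>\<open>s n = stirling_ratio n / sqrt n\<close> tends to some \<open>exp c\<close>, so
  \<open>s n ^ 4 / s (2 * n) ^ 2\<close> tends to \<open>exp c ^ 2\<close>. Up to a rational factor
  with limit 1/4 this quotient is the Wallis product, which forces
  \<open>exp c ^ 2 = 2 * pi\<close>.\<close>

theorem stirling_ratio_limit:
  "(\<lambda>n. stirling_ratio n / sqrt (2 * pi * real n)) \<longlonglongrightarrow> 1"
proof -
  let ?u = "\<lambda>n::nat. ln (fact n :: real) - (real n + 1/2) * ln (real n) + real n"
  obtain c where c: "?u \<longlonglongrightarrow> c"
    using ln_stirling_convergent convergent_def by blast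
  define s where "s n = stirling_ratio n / sqrt (real n)" for n
  have ev: "\<forall>\<^sub>F n in sequentially. exp (?u n) = s n"
    using eventually_gt_at_top[of 0]
  proof eventually_elim
    case (elim n)
    have "exp ((real n + 1/2) * ln (real n)) = real n ^ n * sqrt (real n)"
      using elim by (simp add: ring_distribs exp_add powr_half_sqrt[symmetric] powr_def exp_of_nat_mult)
    moreover have "exp (real n) = exp 1 ^ n"
      by (simp add: exp_of_nat_mult[symmetric])
    ultimately show ?case using elim
      unfolding s_def stirling_ratio_def exp_add exp_diff power_divide by simp
  qed
  have s: "s \<longlonglongrightarrow> exp c"
    using tendsto_exp[OF c] by (rule Lim_transform_eventually) (use ev in auto)
  have s2: "(\<lambda>n. s (2*n)) \<longlonglongrightarrow> exp c"
    by (rule filterlim_compose[OF s]) (auto intro!: filterlim_subseq simp: strict_mono_def)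
  have "(\<lambda>n. s n ^ 4 / s (2*n) ^ 2 * (real n / (2 * (2 * real n + 1)))) \<longlonglongrightarrow> exp c ^ 4 / exp c ^ 2 * (1/4)"
  proof -
    have "(\<lambda>n::nat. real n / (2 * (2 * real n + 1))) \<longlonglongrightarrow> 1/4" by real_asymp
    then show ?thesis by (intro tendsto_mult[OF tendsto_divide[OF tendsto_power[OF s] tendsto_power[OF s2]]]) simp_all
  qed
  moreover have "\<forall>\<^sub>F n in sequentially. s n ^ 4 / s (2*n) ^ 2 * (real n / (2 * (2 * real n + 1))) = (\<Prod>i=1..n. (4*real i^2) / (4*real i^2 - 1))"
    using eventually_gt_at_top[of 0]
  proof eventually_elim
    case (elim n)
    have sq: "sqrt (real n)^4 = real n ^ 2" "sqrt (2*real n)^2 = 2*real n"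
      by (simp_all add: power4_eq_xxxx power2_eq_square)
    have e1: "s n ^ 4 = fact n ^ 4 * exp 1 ^ (4*n) / (real n ^ (4*n) * real n ^ 2)"
      by (simp add: s_def stirling_ratio_def power_divide sq power_mult_distrib mult.commute flip: power_mult)
    have e2: "s (2*n) ^ 2 = fact (2*n) ^ 2 * exp 1 ^ (4*n) / (2 ^ (4*n) * real n ^ (4*n) * (2 * real n))"
      by (simp add: s_def stirling_ratio_def power_divide sq power_mult_distrib mult.commute flip: power_mult)
    have nz: "fact (2*n) \<noteq> (0::real)" "exp 1 ^ (4*n) \<noteq> (0::real)" "real n \<noteq> 0" "real n^(4*n) \<noteq> 0" using elim by auto
    show ?case unfolding e1 e2 wallis_prod_eq using nz
      by (simp add: divide_simps) (simp add: power2_eq_square algebra_simps)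
  qed
  ultimately have "(\<lambda>n. \<Prod>i=1..n. (4*real i^2) / (4*real i^2 - 1)) \<longlonglongrightarrow> exp c ^ 4 / exp c ^ 2 * (1/4)"
    by (rule Lim_transform_eventually)
  then have "exp c ^ 4 / exp c ^ 2 * (1/4) = pi / 2"
    using LIMSEQ_unique wallis by blast
  then have "exp c ^ 2 = 2 * pi"
    by (simp add: power4_eq_xxxx power2_eq_square)
  then have "exp c = sqrt (2 * pi)"
    by (metis exp_ge_zero real_sqrt_unique)
  then have "(\<lambda>n. s n / sqrt (2*pi)) \<longlonglongrightarrow> 1"
    using tendsto_divide[OF s tendsto_const[of "sqrt (2*pi)"]] by simp
  then show ?thesis
    by (simp add: s_def real_sqrt_mult mult_ac)
qed

section \<open>The exponential rate of the second moment\<close>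

definition xlnx :: "real \<Rightarrow> real" where
  "xlnx x = x * ln x"

lemma xlnx_0 [simp]: "xlnx 0 = 0" and xlnx_1 [simp]: "xlnx 1 = 0"
  by (simp_all add: xlnx_def)

lemma xlnx_mult: "x \<ge> 0 \<Longrightarrow> y > 0 \<Longrightarrow> xlnx (x * y) = y * xlnx x + x * xlnx y"
  by (cases "x = 0") (auto simp: xlnx_def ln_mult algebra_simps)

text \<open>The boundary point 0 matters: the overlaps 0 and 1 belong to the range of the rate, and
  compactness of [0, 1] is used for its lower bound.\<close>

lemma continuous_on_xlnx: "continuous_on {0..} xlnx"
proof -
  have "(xlnx \<longlongrightarrow> xlnx x) (at x within {0..})" if "x \<ge> 0" for x
  proof (cases "x = 0")
    case True
    have "((\<lambda>x::real. x * ln x) \<longlongrightarrow> 0) (at_right 0)" by real_asymp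
    then have "(xlnx \<longlongrightarrow> 0) (at 0 within {0<..})" by (simp add: xlnx_def[abs_def])
    moreover have "at (0::real) within {0..} = at 0 within {0<..}"
      unfolding at_within_def by (rule arg_cong2[where f=inf]) (auto intro!: arg_cong[where f=principal])
    ultimately show ?thesis using True by simp
  next
    case False
    then have "(xlnx \<longlongrightarrow> xlnx x) (at x)" unfolding xlnx_def[abs_def]
      by (intro tendsto_intros) auto
    then show ?thesis using tendsto_within_subset by blast
  qed
  then show ?thesis by (auto simp: continuous_on_def)
qed

lemma DERIV_xlnx: "x > 0 \<Longrightarrow> (xlnx has_real_derivative ln x + 1) (at x)"
  unfolding xlnx_def[abs_def] by (auto intro!: derivative_eq_intros)

text \<open>Exponential rate of the overlap distribution: the pairs of assignments with overlap
  \<open>z r\<close> contribute \<open>exp (- r * rate d k z)\<close>, up to polynomial factors, to the normalised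
  second moment.\<close>

definition rate :: "nat \<Rightarrow> nat \<Rightarrow> real \<Rightarrow> real" where
  "rate d k z = xlnx z + 2 * xlnx (1 - z) + xlnx (real k - 2 + z) + xlnx (real k) - 2 * xlnx (real k - 1)
     - real d * (xlnx (1 - z) + xlnx (real k - 2 + z) + xlnx (real k) - 2 * xlnx (real k - 1))
     - real d * (1 - z) * ln (real k - 1) + real d * ln (real k)"

definition rate' :: "nat \<Rightarrow> nat \<Rightarrow> real \<Rightarrow> real" where
  "rate' d k z = ln z - ln (1 - z) + ln (real k - 1) + (real d - 1) * (ln (1 - z) + ln (real k - 1) - ln (real k - 2 + z))"

definition rate'' :: "nat \<Rightarrow> nat \<Rightarrow> real \<Rightarrow> real" where
  "rate'' d k z = (real k - 2 + z - (real d - 1) * (real k - 1) * z) / (z * (1 - z) * (real k - 2 + z))"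

text \<open>By \<open>- ln (1 - x) \<ge> x\<close> at \<open>x = 1 / k\<close> it is enough that
  \<open>ln k < (k - 1)^2 / k\<close>, which holds at 3 and propagates by monotonicity. The
  inequality makes the curvature of the rate at \<open>1 / k\<close> positive and the constant
  \<open>(k - 1) / (k - d)\<close> finite.\<close>

lemma d_star_less:
  assumes "k > 2" shows "d_star k < real k"
proof -
  have k: "real k \<ge> 3" using assms by simp
  define x where "x = 1 / real k"
  have x: "0 < x" "x < 1" using k by (auto simp: x_def)
  have l: "- ln (1 - x) \<ge> x" using ln_one_minus_pos_upper_bound[of x] x by simp
  have inc: "(\<lambda>y::real. (y-1)^2/y - ln y) 3 \<le> (\<lambda>y. (y-1)^2/y - ln y) (real k)"
  proof (rule DERIV_nonneg_imp_nondecreasing[where f="\<lambda>y::real. (y-1)^2/y - ln y" and a=3 and b="real k"])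
    show "3 \<le> real k" by fact
    fix y :: real assume y: "3 \<le> y" "y \<le> real k"
    have "((\<lambda>y. (y-1)^2/y - ln y) has_real_derivative (2*(y-1)*y - (y-1)^2)/(y*y) - 1/y) (at y)"
      using y by (auto intro!: derivative_eq_intros simp: field_simps)
    moreover have "(2*(y-1)*y - (y-1)^2)/(y*y) - 1/y \<ge> 0"
    proof -
      have "(2*(y-1)*y - (y-1)^2)/(y*y) - 1/y = (y*(y-1) - 1)/(y*y)"
        using y by (simp add: field_simps power2_eq_square)
      moreover have "y*(y-1) \<ge> 3 * 2" using y by (intro mult_mono) auto
      ultimately show ?thesis using y by simp
    qed
    ultimately show "\<exists>z. ((\<lambda>y. (y-1)^2/y - ln y) has_real_derivative z) (at y) \<and> 0 \<le> z" by blast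
  qed
  \<comment> \<open>The case k = 3, where \<open>(k - 1)^2 / k\<close> is 4/3.\<close>
  have "ln (3::real) < 4/3"
  proof -
    have "(3::real) < exp (4/3)"
    proof -
      have "1 + (4/3) + (4/3)^2/2 \<le> exp (4/3::real)" by (rule exp_lower_Taylor_quadratic) simp
      then show ?thesis by (simp add: power2_eq_square)
    qed
    then show ?thesis by (metis exp_less_cancel_iff exp_ln zero_less_numeral)
  qed
  with inc have "ln (real k) < (real k - 1)^2 / real k" by (simp add: power2_eq_square)
  then have "ln (real k) < (real k - 1) * ((real k - 1) * x)"
    by (simp add: x_def power2_eq_square)
  also have "\<dots> \<le> (real k - 1) * ((real k - 1) * (- ln (1 - x)))"
    using k l by (intro mult_left_mono) auto
  finally have lt: "ln (real k) < (real k - 1) * ((real k - 1) * (- ln (1 - x)))" .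
  have "ln (real k) / ((real k - 1) * (- ln (1 - x))) < real k - 1"
  proof -
    have "(real k - 1) * (- ln (1 - x)) > 0" using k l x by (intro mult_pos_pos) auto
    with lt show ?thesis by (simp only: pos_divide_less_eq)
  qed
  then show ?thesis by (simp add: d_star_def x_def)
qed

context
  fixes d k :: nat
  assumes d: "d > 0" and k: "k > 2" and dstar: "real d < d_star k"
begin

lemma d_less_k: "d < k"
  using dstar d_star_less[OF k] by simp

lemma kreal: "real k \<ge> 3" using k by simp

lemma DERIV_rate:
  assumes "0 < z" "z < 1"
  shows "(rate d k has_real_derivative rate' d k z) (at z)"
  unfolding rate_def[abs_def] rate'_def
  using assms kreal
  by (auto intro!: derivative_eq_intros DERIV_chain2[OF DERIV_xlnx] simp: algebra_simps)

lemma DERIV_rate':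
  assumes "0 < z" "z < 1"
  shows "(rate' d k has_real_derivative rate'' d k z) (at z)"
proof -
  have "(rate' d k has_real_derivative 1/z + 1/(1-z) + (real d - 1) * (-1/(1-z) - 1/(real k - 2 + z))) (at z)"
    unfolding rate'_def[abs_def] using assms kreal
    by (auto intro!: derivative_eq_intros simp: divide_inverse algebra_simps)
  moreover have "1/z + 1/(1-z) + (real d - 1) * (-1/(1-z) - 1/(real k - 2 + z)) = rate'' d k z"
  proof -
    define A B where "A = 1 - z" and "B = real k - 2 + z"
    have nz: "z \<noteq> 0" "A \<noteq> 0" "B \<noteq> 0" using assms kreal by (auto simp: A_def B_def)
    have "1/z + 1/A = (A + z) / (z * A)" "-1/A - 1/B = -((A + B) / (A * B))"
      using nz by (simp_all add: field_simps)
    moreover have "A + z = 1" "A + B = real k - 1" by (auto simp: A_def B_def)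
    ultimately have eq: "1/z + 1/A = 1 / (z*A)" "-1/A - 1/B = -((real k - 1) / (A * B))" by simp_all
    have "1/z + 1/A + (real d - 1) * (-1/A - 1/B) = 1/(z*A) - (real d - 1) * (real k - 1) / (A*B)"
      unfolding eq by (simp add: algebra_simps)
    also have "\<dots> = (B - (real d - 1) * (real k - 1) * z) / (z * A * B)"
      using nz by (simp add: field_simps)
    finally show ?thesis by (simp add: rate''_def A_def B_def)
  qed
  ultimately show ?thesis by simp
qed

lemma continuous_on_rate: "continuous_on {0..1} (rate d k)"
  unfolding rate_def[abs_def] using kreal
  by (intro continuous_intros continuous_on_compose2[OF continuous_on_xlnx]) auto

text \<open>\<open>1 / k\<close> is the typical relative overlap of two independent r-subsets of
  \<open>k * r\<close> variables. Such pairs reproduce the square of the first moment, so they cost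
  nothing on the exponential scale.\<close>

lemma rate_inverse_k: "rate d k (1 / real k) = 0"
proof -
  have k0: "real k > 1" using kreal by simp
  have e: "1 - 1/real k = (real k - 1)/real k" "real k - 2 + 1 / real k = (real k - 1)^2/real k"
    using k0 by (auto simp: field_simps power2_eq_square)
  have l: "ln (1/real k) = - ln (real k)" "ln ((real k - 1)/real k) = ln (real k - 1) - ln (real k)"
      "ln ((real k - 1)^2/real k) = 2 * ln (real k - 1) - ln (real k)"
    using k0 by (auto simp: ln_div ln_realpow)
  show ?thesis unfolding rate_def e xlnx_def l using k0
    by (simp add: divide_simps) (simp add: power2_eq_square algebra_simps)
qed

lemma rate'_inverse_k: "rate' d k (1 / real k) = 0"
proof -
  have k0: "real k > 1" using kreal by simp
  have e: "1 - 1/real k = (real k - 1)/real k" "real k - 2 + 1 / real k = (real k - 1)^2/real k"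
    using k0 by (auto simp: field_simps power2_eq_square)
  have l: "ln (1/real k) = - ln (real k)" "ln ((real k - 1)/real k) = ln (real k - 1) - ln (real k)"
      "ln ((real k - 1)^2/real k) = 2 * ln (real k - 1) - ln (real k)"
    using k0 by (auto simp: ln_div ln_realpow)
  show ?thesis unfolding rate'_def e l by (simp add: algebra_simps)
qed

text \<open>This curvature is the origin of the constant of the second moment: with
  \<open>p = 1 / k\<close>, the quantity \<open>1 / (p * (1 - p) * rate'' d k p)\<close> equals
  \<open>(k - 1) / (k - d)\<close>.\<close>

lemma rate''_inverse_k: "rate'' d k (1 / real k) = real k ^ 2 * (real k - real d) / (real k - 1)^2"
proof -
  have k0: "real k > 1" using kreal by simp
  have e: "1 - 1/real k = (real k - 1)/real k" "real k - 2 + 1 / real k = (real k - 1)^2/real k"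
    using k0 by (auto simp: field_simps power2_eq_square)
  have e2: "(real k - 1)^2/real k - (real d - 1) * (real k - 1) * (1/real k) = (real k - 1) * (real k - real d) / real k"
    using k0 by (simp add: field_simps power2_eq_square)
  show ?thesis unfolding rate''_def e e2 using k0
    by (simp add: divide_simps power2_eq_square)
qed

text \<open>Here the threshold has its origin. Overlap 1 means two equal assignments, so the rate at
  1 is the exponential growth rate of E[X] in r; solving
  \<open>ln k > (d - 1) * (k - 1) * (ln k - ln (k - 1))\<close> for d gives
  \<open>d_star\<close>.\<close>

lemma rate_1_pos: "rate d k 1 > 0"
proof -
  have k0: "real k > 1" using kreal by simp
  have "real d - 1 < ln (real k) / ((real k - 1) * (- ln (1 - 1 / real k)))"
    using dstar by (simp add: d_star_def)
  moreover have "1 - 1/real k = (real k - 1)/real k" using k0 by (simp add: field_simps)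
  ultimately have "real d - 1 < ln (real k) / ((real k - 1) * (ln (real k) - ln (real k - 1)))"
    using k0 by (simp add: ln_div)
  moreover have "(real k - 1) * (ln (real k) - ln (real k - 1)) > 0" using k0 by simp
  ultimately have "(real d - 1) * ((real k - 1) * (ln (real k) - ln (real k - 1))) < ln (real k)"
    by (simp add: pos_less_divide_eq)
  moreover have "rate d k 1 = ln (real k) - (real d - 1) * ((real k - 1) * (ln (real k) - ln (real k - 1)))"
    by (simp add: rate_def xlnx_def algebra_simps)
  ultimately show ?thesis by simp
qed

text \<open>The numerator of \<^const>\<open>rate''\<close> is linear in \<open>z\<close>, so the rate is convex and then
  concave; it is positive to the right of its double zero \<open>1 / k\<close> because it is positive at \<open>1\<close>.\<close>

lemma rate_pos:
  assumes "0 \<le> z" "z \<le> 1" "z \<noteq> 1 / real k"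
  shows "rate d k z > 0"
proof -
  define p where "p = 1 / real k"
  have p: "0 < p" "p < 1" using kreal by (auto simp: p_def)
  define q where "q z = real k - 2 + z - (real d - 1) * (real k - 1) * z" for z
  have sgn: "rate'' d k z > 0 \<longleftrightarrow> q z > 0" "rate'' d k z \<le> 0 \<longleftrightarrow> q z \<le> 0" if "0 < z" "z < 1" for z
  proof -
    have "z * (1 - z) * (real k - 2 + z) > 0" using that kreal by (intro mult_pos_pos) auto
    then show "rate'' d k z > 0 \<longleftrightarrow> q z > 0" "rate'' d k z \<le> 0 \<longleftrightarrow> q z \<le> 0"
      by (auto simp: rate''_def q_def zero_less_divide_iff divide_le_0_iff)
  qed
  have qlin: "q y = real k - 2 - y * ((real d - 1) * (real k - 1) - 1)" for y
    by (simp add: q_def algebra_simps)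
  have qp: "q p > 0"
  proof -
    have "rate'' d k p > 0" using d_less_k kreal unfolding p_def rate''_inverse_k by simp
    then show ?thesis using sgn p by blast
  qed
  \<comment> \<open>\<open>q\<close> is linear with \<open>q 0 = k - 2 > 0\<close>, so it is
    positive to the left of every point of [0, 1] where it is nonnegative.\<close>
  have q_below: "q y > 0" if "0 \<le> y" "y < z'" "q z' \<ge> 0" "z' \<le> 1" for y z'
  proof (cases "(real d - 1) * (real k - 1) - 1 > 0")
    case True
    then have "y * ((real d - 1) * (real k - 1) - 1) < z' * ((real d - 1) * (real k - 1) - 1)"
      using that by (intro mult_strict_right_mono) auto
    then show ?thesis using that by (simp add: qlin)
  next
    case False
    then have "y * ((real d - 1) * (real k - 1) - 1) \<le> 0"
      using that by (intro mult_nonneg_nonpos) auto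
    then show ?thesis using kreal by (simp add: qlin)
  qed
  have r'_mono: "rate' d k a < rate' d k b" if "0 < a" "a < b" "b < 1" "q b \<ge> 0" for a b
  proof (rule DERIV_pos_imp_increasing_open[OF that(2)])
    show "\<exists>l. (rate' d k has_real_derivative l) (at x) \<and> 0 < l" if "a < x" "x < b" for x
      using DERIV_rate'[of x] sgn[of x] q_below[of x b] that \<open>0 < a\<close> \<open>b < 1\<close> \<open>q b \<ge> 0\<close> by force
    show "continuous_on {a..b} (rate' d k)"
      using that by (intro continuous_at_imp_continuous_on) (auto intro!: DERIV_isCont[OF DERIV_rate'])
  qed
  have r'_anti: "rate' d k b \<le> rate' d k a" if "0 < a" "a \<le> b" "b < 1" "q a < 0" for a b
  proof (rule DERIV_nonpos_imp_nonincreasing[OF that(2)])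
    fix x assume x: "a \<le> x" "x \<le> b"
    have "q x \<le> 0" using q_below[of a x] x that by force
    then show "\<exists>y. (rate' d k has_real_derivative y) (at x) \<and> y \<le> 0"
      using DERIV_rate'[of x] sgn[of x] that x by force
  qed
  have r0: "rate d k p = 0" "rate' d k p = 0"
    by (auto simp: p_def rate_inverse_k rate'_inverse_k)
  consider "z < p" | "z = 1" | "p < z" "z < 1" using assms p_def by fastforce
  then show ?thesis
  proof cases
    case 1
    have "rate d k p < rate d k z"
    proof (rule DERIV_neg_imp_decreasing_open[OF 1])
      show "\<exists>l. (rate d k has_real_derivative l) (at x) \<and> l < 0" if "z < x" "x < p" for x
        using DERIV_rate[of x] r'_mono[of x p] that assms p qp r0 by force
      show "continuous_on {z..p} (rate d k)"
        using continuous_on_subset[OF continuous_on_rate] p assms by auto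
    qed
    then show ?thesis using r0 by simp
  next
    case 2
    then show ?thesis using rate_1_pos by simp
  next
    case 3
    show ?thesis
    \<comment> \<open>From a point z of the concave region with nonpositive slope, the rate can only
      decrease to its positive value at 1. In the other case the slope is positive on all of (p, z):
      it rises from 0 as long as \<open>q\<close> is nonnegative, and where it falls afterwards it
      stays above its positive value at z.\<close>
    proof (cases "q z < 0 \<and> rate' d k z \<le> 0")
      case True
      have "rate d k 1 \<le> rate d k z"
      proof (rule DERIV_nonpos_imp_decreasing_open[OF less_imp_le[OF 3(2)]])
        show "\<exists>l. (rate d k has_real_derivative l) (at x) \<and> l \<le> 0" if "z < x" "x < 1" for x
          using DERIV_rate[of x] r'_anti[of z x] that True 3 p by force
        show "continuous_on {z..1} (rate d k)"
          using continuous_on_subset[OF continuous_on_rate] p 3 by auto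
      qed
      then show ?thesis using rate_1_pos by simp
    next
      case False
      have "rate d k p < rate d k z"
      proof (rule DERIV_pos_imp_increasing_open[OF 3(1)])
        show "\<exists>l. (rate d k has_real_derivative l) (at x) \<and> 0 < l" if x: "p < x" "x < z" for x
        proof (cases "q x \<ge> 0")
          case True
          then show ?thesis using DERIV_rate[of x] r'_mono[of p x] x 3 p r0 by force
        next
          case q: False
          have "q z < 0" using q_below[of x z] q x 3 p by force
          then have "rate' d k z > 0" using False by auto
          then show ?thesis using DERIV_rate[of x] r'_anti[of x z] x 3 p q by force
        qed
        show "continuous_on {p..z} (rate d k)"
          using continuous_on_subset[OF continuous_on_rate] p 3 by auto
      qed
      then show ?thesis using r0 by simp
    qed
  qed
qed

text \<open>The difference \<open>D\<close> between the rate and the parabola vanishes at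
  \<open>1 / k\<close> together with its derivative, and by continuity of \<open>rate''\<close> its
  second derivative is nonnegative in a neighbourhood.\<close>

lemma rate_quadratic_lower:
  assumes "0 < \<epsilon>" "\<epsilon> < 1"
  obtains \<eta> where "\<eta> > 0" "\<eta> < 1 / real k" "1 / real k + \<eta> < 1"
    "\<And>z. \<bar>z - 1 / real k\<bar> \<le> \<eta> \<Longrightarrow> rate d k z \<ge> (1 - \<epsilon>) * rate'' d k (1 / real k) / 2 * (z - 1 / real k)^2"
proof -
  define p where "p = 1 / real k"
  have p: "0 < p" "p < 1" using kreal by (auto simp: p_def)
  define c where "c = (1 - \<epsilon>) * rate'' d k p"
  have r2: "rate'' d k p > 0"
    using d_less_k kreal unfolding p_def rate''_inverse_k by simp
  then have "c < rate'' d k p" using assms by (simp add: c_def)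
  moreover have "isCont (rate'' d k) p"
    unfolding rate''_def[abs_def] using p kreal by (intro continuous_intros) auto
  ultimately have "\<forall>\<^sub>F z in at p. c < rate'' d k z"
    by (auto simp: isCont_def intro: order_tendstoD)
  then obtain \<eta>0 where \<eta>0: "\<eta>0 > 0" "\<And>z. z \<noteq> p \<Longrightarrow> dist z p < \<eta>0 \<Longrightarrow> c < rate'' d k z"
    unfolding eventually_at by auto
  define \<eta> where "\<eta> = min (\<eta>0/2) (min (p/2) ((1-p)/2))"
  have \<eta>: "\<eta> > 0" "\<eta> < p" "p + \<eta> < 1" "\<eta> < \<eta>0" using \<eta>0 p by (auto simp: \<eta>_def min_def field_simps)
  have c': "c \<le> rate'' d k z" if "\<bar>z - p\<bar> \<le> \<eta>" for z
    using \<eta>0(2)[of z] that \<eta> \<open>c < rate'' d k p\<close> by (cases "z = p") (auto simp: dist_real_def)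
  define D where "D z = rate d k z - c / 2 * (z - p)^2" for z
  define D' where "D' z = rate' d k z - c * (z - p)" for z
  have DD: "(D has_real_derivative D' z) (at z)" "(D' has_real_derivative (rate'' d k z - c)) (at z)" if "0 < z" "z < 1" for z
    unfolding D_def[abs_def] D'_def[abs_def] using that
    by (auto intro!: derivative_eq_intros DERIV_rate DERIV_rate')
  have D'p: "D' p = 0" "D p = 0" by (simp_all add: D'_def D_def p_def rate'_inverse_k rate_inverse_k)
  have D'_mono: "D' a \<le> D' b" if "a \<le> b" "p - \<eta> \<le> a" "b \<le> p + \<eta>" for a b
  proof (rule DERIV_nonneg_imp_nondecreasing[OF that(1)])
    fix x assume "a \<le> x" "x \<le> b"
    then have "0 < x" "x < 1" "\<bar>x - p\<bar> \<le> \<eta>" using that \<eta> by auto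
    then show "\<exists>y. (D' has_real_derivative y) (at x) \<and> 0 \<le> y" using DD c' by force
  qed
  have "D z \<ge> 0" if z: "\<bar>z - p\<bar> \<le> \<eta>" for z
  proof (cases "z \<ge> p")
    case True
    have "D p \<le> D z"
    proof (rule DERIV_nonneg_imp_nondecreasing[OF True])
      fix x assume x: "p \<le> x" "x \<le> z"
      then show "\<exists>y. (D has_real_derivative y) (at x) \<and> 0 \<le> y"
        using DD(1)[of x] D'_mono[of p x] z \<eta> p D'p by force
    qed
    then show ?thesis by (simp add: D'p)
  next
    case False
    have "D p \<le> D z"
    proof (rule DERIV_nonpos_imp_nonincreasing[where f=D and a=z and b=p])
      show "z \<le> p" using False by simp
      fix x assume x: "z \<le> x" "x \<le> p"
      then show "\<exists>y. (D has_real_derivative y) (at x) \<and> y \<le> 0"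
        using DD(1)[of x] D'_mono[of x p] z \<eta> p D'p by force
    qed
    then show ?thesis by (simp add: D'p)
  qed
  then show ?thesis using that[of \<eta>] \<eta> by (auto simp: p_def D_def c_def)
qed

text \<open>A continuous positive function attains its infimum on a compact set.\<close>

lemma rate_bounded_below:
  assumes "\<eta> > 0"
  obtains c where "c > 0" "\<And>z. 0 \<le> z \<Longrightarrow> z \<le> 1 \<Longrightarrow> \<bar>z - 1 / real k\<bar> \<ge> \<eta> \<Longrightarrow> rate d k z \<ge> c"
proof -
  define S where "S = {0..1} \<inter> {z. \<bar>z - 1 / real k\<bar> \<ge> \<eta>}"
  have "closed {z. \<bar>z - 1 / real k\<bar> \<ge> \<eta>}"
    by (intro closed_Collect_le continuous_intros)
  then have comp: "compact S" unfolding S_def by (intro compact_Int_closed) auto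
  show ?thesis
  proof (cases "S = {}")
    case True
    show ?thesis by (rule that[of 1]) (use True in \<open>auto simp: S_def\<close>)
  next
    case False
    obtain x where x: "x \<in> S" "\<forall>y\<in>S. rate d k x \<le> rate d k y"
      using continuous_attains_inf[OF comp False continuous_on_subset[OF continuous_on_rate]]
      by (auto simp: S_def)
    have "rate d k x > 0" using x(1) assms by (intro rate_pos) (auto simp: S_def)
    then show ?thesis using that[of "rate d k x"] x by (auto simp: S_def)
  qed
qed

end

section \<open>Laplace's method\<close>

text \<open>At most two integers lie within distance 1 of \<mu>. For every other t the normal
  density at t is at most its integral over the unit interval that leads from t towards \<mu>; these
  intervals are disjoint, so the densities add up to at most 1.\<close>

lemma sum_gauss_le:
  fixes \<mu> \<sigma> :: real and A :: "nat set"
  assumes \<sigma>: "\<sigma> > 0" and A: "finite A"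
  shows "(\<Sum>t\<in>A. exp (- (real t - \<mu>)\<^sup>2 / (2 * \<sigma>\<^sup>2))) \<le> 2 + sqrt (2 * pi * \<sigma>\<^sup>2)"
proof -
  let ?e = "\<lambda>t. exp (- (real t - \<mu>)\<^sup>2 / (2 * \<sigma>\<^sup>2))"
  define M where "M = density lborel (normal_density \<mu> \<sigma>)"
  interpret prob_space M unfolding M_def using \<sigma> by (rule prob_space_normal_density)
  define A0 where "A0 = {t\<in>A. \<bar>real t - \<mu>\<bar> < 1}"
  define A1 where "A1 = A - A0"
  define I where "I t = (if real t \<ge> \<mu> + 1 then {real t - 1<..<real t} else {real t<..<real t + 1})" for t :: nat
  have fin: "finite A0" "finite A1" using A by (auto simp: A0_def A1_def)
  have "card A0 \<le> 2"
  proof -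
    have "A0 \<subseteq> {nat \<lfloor>\<mu>\<rfloor>, nat \<lfloor>\<mu>\<rfloor> + 1}"
      unfolding A0_def by (auto, linarith+)
    then have "card A0 \<le> card {nat \<lfloor>\<mu>\<rfloor>, nat \<lfloor>\<mu>\<rfloor> + 1}"
      by (intro card_mono) auto
    then show ?thesis by simp
  qed
  moreover have "?e t \<le> 1" for t by simp
  ultimately have s0: "sum ?e A0 \<le> 2"
    using sum_bounded_above[of A0 ?e 1] by simp
  have dens: "normal_density \<mu> \<sigma> (real t) \<le> measure M (I t)" if "t \<in> A1" for t
  proof -
    have le: "normal_density \<mu> \<sigma> (real t) \<le> normal_density \<mu> \<sigma> x" if "x \<in> I t" for x
    proof -
      have "\<bar>x - \<mu>\<bar> \<le> \<bar>real t - \<mu>\<bar>"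
        using that \<open>t \<in> A1\<close> by (auto simp: I_def A1_def A0_def split: if_splits)
      then have "(x - \<mu>)\<^sup>2 \<le> (real t - \<mu>)\<^sup>2" by (simp add: abs_le_square_iff)
      then have "exp (- (real t - \<mu>)\<^sup>2 / (2 * \<sigma>\<^sup>2)) \<le> exp (- (x - \<mu>)\<^sup>2 / (2 * \<sigma>\<^sup>2))"
        using \<sigma> by (simp add: divide_right_mono)
      then show ?thesis unfolding normal_density_def
        by (intro mult_left_mono) auto
    qed
    have S: "I t \<in> sets lborel" "emeasure lborel (I t) = 1" by (auto simp: I_def)
    have "ennreal (normal_density \<mu> \<sigma> (real t)) = (\<integral>\<^sup>+x. ennreal (normal_density \<mu> \<sigma> (real t)) * indicator (I t) x \<partial>lborel)"
      using S by (simp add: nn_integral_cmult_indicator)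
    also have "\<dots> \<le> (\<integral>\<^sup>+x. ennreal (normal_density \<mu> \<sigma> x) * indicator (I t) x \<partial>lborel)"
      by (intro nn_integral_mono) (auto simp: indicator_def intro!: ennreal_leI le)
    also have "\<dots> = emeasure M (I t)"
      unfolding M_def by (subst emeasure_density) (use S in auto)
    finally show ?thesis by (simp add: emeasure_eq_measure)
  qed
  have Imeas: "I t \<in> sets M" for t by (simp add: I_def M_def)
  have "disjoint_family_on I A1"
    unfolding disjoint_family_on_def
  proof (intro ballI impI)
    fix t t' assume t: "t \<in> A1" "t' \<in> A1" "t \<noteq> t'"
    have "real t - real t' \<ge> 1 \<or> real t' - real t \<ge> 1" using t by linarith
    then show "I t \<inter> I t' = {}" using t
      by (auto simp: I_def A1_def A0_def split: if_splits)
  qed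
  then have "(\<Sum>t\<in>A1. measure M (I t)) = measure M (\<Union>t\<in>A1. I t)"
    using fin Imeas by (intro finite_measure_finite_Union[symmetric]) auto
  also have "\<dots> \<le> 1" by simp
  finally have "(\<Sum>t\<in>A1. normal_density \<mu> \<sigma> (real t)) \<le> 1"
    using sum_mono[of A1 "\<lambda>t. normal_density \<mu> \<sigma> (real t)" "\<lambda>t. measure M (I t)"] dens by simp
  moreover have "(\<Sum>t\<in>A1. normal_density \<mu> \<sigma> (real t)) = sum ?e A1 / sqrt (2 * pi * \<sigma>\<^sup>2)"
    by (simp add: normal_density_def sum_divide_distrib)
  ultimately have s1: "sum ?e A1 \<le> sqrt (2 * pi * \<sigma>\<^sup>2)"
    using \<sigma> by (simp add: pos_divide_le_eq)
  have "sum ?e A = sum ?e A0 + sum ?e A1"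
    unfolding A1_def using A by (subst sum.subset_diff[of A0]) (auto simp: A0_def)
  then show ?thesis using s0 s1 by simp
qed

section \<open>Stirling's approximation of the overlap terms\<close>

lemma fact_stirling: "fact n = stirling_ratio n * exp (xlnx (real n) - real n)"
proof (cases "n = 0")
  case False
  have "exp (xlnx (real n) - real n) = (real n / exp 1) ^ n"
    using False by (simp add: xlnx_def exp_diff exp_of_nat_mult power_divide flip: exp_of_nat_mult[of n 1])
  then show ?thesis using False by (simp add: stirling_ratio_def)
qed (simp add: stirling_ratio_def)

text \<open>Much coarser than the true order \<open>sqrt n\<close>, but away from the overlap
  \<open>1 / k\<close> any polynomial factor is beaten by the exponential.\<close>

lemma stirling_ratio_linear_bound:
  obtains C where "C \<ge> 1" "\<And>n. stirling_ratio n \<le> C * (real n + 1)"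
proof -
  have "Bseq (\<lambda>n. stirling_ratio n / sqrt (2 * pi * real n))"
    using stirling_ratio_limit convergentI convergent_imp_Bseq by blast
  then obtain K where K: "K > 0" "\<And>n. norm (stirling_ratio n / sqrt (2 * pi * real n)) \<le> K"
    using BseqE by blast
  have "stirling_ratio n \<le> max 1 (K * sqrt (2*pi)) * (real n + 1)" for n
  proof (cases "n = 0")
    case False
    have "stirling_ratio n \<le> K * sqrt (2 * pi * real n)"
      using K(2)[of n] stirling_ratio_ge_1[of n] False by (simp add: field_simps)
    also have "\<dots> = (K * sqrt (2*pi)) * sqrt (real n)" by (simp add: real_sqrt_mult)
    also have "\<dots> \<le> max 1 (K * sqrt (2*pi)) * (real n + 1)"
    proof (intro mult_mono)
      show "sqrt (real n) \<le> real n + 1" by (rule real_le_lsqrt) (auto simp: power2_eq_square algebra_simps)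
    qed (use K in auto)
    finally show ?thesis .
  qed (simp add: stirling_ratio_def)
  then show ?thesis using that[of "max 1 (K * sqrt (2*pi))"] by simp
qed

text \<open>The contribution to the normalised second moment of the pairs of assignments with \<open>t\<close> common
  elements, where \<open>n = k r\<close>.\<close>

definition overlap_term :: "nat \<Rightarrow> nat \<Rightarrow> nat \<Rightarrow> nat \<Rightarrow> real" where
  "overlap_term d k r t =
     (fact r)\<^sup>2 * (fact ((k-1)*r))\<^sup>2 / (fact t * (fact (r-t))\<^sup>2 * fact ((k-2)*r+t) * fact (k*r))
     * (fact (d*(r-t)) * fact (d*((k-2)*r+t)) * fact (d*(k*r)) / (fact (d*r) * (fact (d*((k-1)*r)))\<^sup>2))
     * (real (k-1) ^ (d*(r-t)) / real k ^ (d*r))"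

text \<open>What is left of \<open>overlap_term\<close> when the exponential parts of all factorials
  are collected in the rate.\<close>

definition overlap_stirling :: "nat \<Rightarrow> nat \<Rightarrow> nat \<Rightarrow> nat \<Rightarrow> real" where
  "overlap_stirling d k r t =
     (let S = stirling_ratio in
     (S r)\<^sup>2 * (S ((k-1)*r))\<^sup>2 / (S t * (S (r-t))\<^sup>2 * S ((k-2)*r+t) * S (k*r))
     * (S (d*(r-t)) * S (d*((k-2)*r+t)) * S (d*(k*r)) / (S (d*r) * (S (d*((k-1)*r)))\<^sup>2)))"

text \<open>Fifteen Stirling approximations, counted with multiplicity, are each off by a factor of
  at most q. The letter s stands for \<open>sqrt d\<close>, which comes out of every argument that
  is a multiple of d; up to \<open>q ^ 15\<close> only the prefactor of \<open>r choose t\<close>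
  survives.\<close>

lemma prefactor_cancel:
  fixes q a b t u v z s :: real
  assumes "q \<noteq> 0" "a \<noteq> 0" "b \<noteq> 0" "t \<noteq> 0" "u \<noteq> 0" "v \<noteq> 0" "z \<noteq> 0" "s \<noteq> 0"
  shows "((q*a)\<^sup>2 * (q*b)\<^sup>2) / ((t/q) * (u/q)\<^sup>2 * (v/q) * (z/q)) *
    (((q*(s*u)) * (q*(s * v)) * (q*(s*z))) / ((s*a/q) * (s*b/q)\<^sup>2)) = q^15 * (a / (t*u))"
proof -
  have "((q*a)\<^sup>2 * (q*b)\<^sup>2) / ((t/q) * (u/q)\<^sup>2 * (v/q) * (z/q)) = q^9 * (a\<^sup>2 * b\<^sup>2 / (t * u\<^sup>2 * v * z))"
    using assms by (simp add: field_simps eval_nat_numeral)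
  moreover have "((q*(s*u)) * (q*(s * v)) * (q*(s*z))) / ((s*a/q) * (s*b/q)\<^sup>2) = q^6 * (u * v * z / (a * b\<^sup>2))"
    using assms by (simp add: field_simps eval_nat_numeral)
  moreover have "(a\<^sup>2 * b\<^sup>2 / (t * u\<^sup>2 * v * z)) * (u * v * z / (a * b\<^sup>2)) = a / (t * u)"
    using assms by (simp add: field_simps eval_nat_numeral)
  moreover have "q^9 * q^6 = q^15" by (simp flip: power_add)
  ultimately show ?thesis by algebra
qed

context
  fixes d k :: nat
  assumes d: "d > 0" and k: "k > 2" and dstar: "real d < d_star k"
begin

text \<open>An exact identity. \<open>xlnx\<close> is homogeneous up to a linear term, and in both
  quotients of factorials the arguments above and below have the same sum; hence all contributions
  of \<open>ln r\<close> and all linear terms cancel.\<close>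

lemma overlap_term_eq:
  assumes "r > 0" "t \<le> r"
  shows "overlap_term d k r t = overlap_stirling d k r t * exp (- real r * rate d k (real t / real r))"
proof -
  define z where "z = real t / real r"
  define R where "R = real r"
  have z: "0 \<le> z" "z \<le> 1" "R > 0" using assms by (auto simp: z_def R_def)
  have k3: "real k \<ge> 3" using k by simp
  define e where "e n = xlnx (real n) - real n" for n
  have F: "fact n = stirling_ratio n * exp (e n)" for n by (simp add: fact_stirling e_def)
  have sc: "xlnx (R * y) = R * xlnx y + y * xlnx R" if "y \<ge> 0" for y
    using xlnx_mult[of y R] that z by (simp add: mult.commute)
  have dR: "real d * R > 0" using d z by simp
  have scd: "xlnx (real d * (R * y)) = real d * R * xlnx y + y * xlnx (real d * R)" if "y \<ge> 0" for y
    using xlnx_mult[of y "real d * R"] that dR by (simp add: mult_ac)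
  have n1: "real r = R * 1" "real ((k-1)*r) = R * (real k - 1)" "real t = R * z" "real (r-t) = R * (1 - z)"
     "real ((k-2)*r+t) = R * (real k - 2 + z)" "real (k*r) = R * real k"
    using assms k by (auto simp: R_def z_def field_simps of_nat_diff)
  have n2: "real (d*n) = real d * real n" for n by simp
  have pw: "real (k-1) ^ (d*(r-t)) / real k ^ (d*r) = exp (real d * (R * (1 - z)) * ln (real k - 1) - real d * R * ln (real k))"
  proof -
    have "real (k-1) ^ (d*(r-t)) = exp (real d * (R * (1 - z)) * ln (real k - 1))"
      using k3 k by (subst n1(4)[symmetric], subst n2[symmetric], subst exp_of_nat_mult) (auto simp: of_nat_diff)
    moreover have "real k ^ (d*r) = exp (real d * R * ln (real k))"
      using k3 unfolding R_def by (subst n2[symmetric], subst exp_of_nat_mult) auto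
    ultimately show ?thesis by (simp add: exp_diff)
  qed
  have ex: "(exp (e r))\<^sup>2 * (exp (e ((k-1)*r)))\<^sup>2 / (exp (e t) * (exp (e (r-t)))\<^sup>2 * exp (e ((k-2)*r+t)) * exp (e (k*r)))
     * (exp (e (d*(r-t))) * exp (e (d*((k-2)*r+t))) * exp (e (d*(k*r))) / (exp (e (d*r)) * (exp (e (d*((k-1)*r))))\<^sup>2))
     * (real (k-1) ^ (d*(r-t)) / real k ^ (d*r)) = exp (- R * rate d k z)"
  proof -
    have ee: "2 * e r + 2 * e ((k-1)*r) - (e t + 2 * e (r-t) + e ((k-2)*r+t) + e (k*r))
       + (e (d*(r-t)) + e (d*((k-2)*r+t)) + e (d*(k*r)) - (e (d*r) + 2 * e (d*((k-1)*r))))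
       + (real d * (R * (1 - z)) * ln (real k - 1) - real d * R * ln (real k)) = - R * rate d k z"
    proof -
      have nn: "0 \<le> (1::real)" "0 \<le> real k - 1" "0 \<le> 1 - z" "0 \<le> real k - 2 + z" "0 \<le> real k" using z k3 by auto
      show ?thesis unfolding e_def n2 n1 sc[OF nn(1)] sc[OF nn(2)] sc[OF z(1)] sc[OF nn(3)] sc[OF nn(4)] sc[OF nn(5)]
         scd[OF nn(1)] scd[OF nn(2)] scd[OF nn(3)] scd[OF nn(4)] scd[OF nn(5)] rate_def xlnx_1
        by (simp add: algebra_simps)
    qed
    show ?thesis unfolding pw ee[symmetric]
      by (simp only: mult_2 mult_2_right power2_eq_square exp_add exp_diff divide_inverse inverse_mult_distrib mult_ac )
  qed
  show ?thesis unfolding overlap_term_def F overlap_stirling_def Let_def power_mult_distrib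
    unfolding z_def[symmetric] unfolding R_def[symmetric] ex[symmetric]
    by (simp only: divide_inverse inverse_mult_distrib power_mult_distrib power_inverse mult_ac)
qed

lemma overlap_stirling_nonneg: "0 \<le> overlap_stirling d k r t"
proof -
  have "0 \<le> stirling_ratio n" for n using stirling_ratio_ge_1[of n] by simp
  then show ?thesis unfolding overlap_stirling_def Let_def by simp
qed

text \<open>The denominators are at least 1 and are dropped. The exponent 7 counts the ratios in the
  numerators, whose arguments are all at most \<open>d * (k * r)\<close>.\<close>

lemma overlap_stirling_poly_bound:
  obtains C where "C > 0" "\<And>r t. t \<le> r \<Longrightarrow> overlap_stirling d k r t \<le> (C * (real r + 1))^7"
proof -
  obtain C where C: "C \<ge> 1" "\<And>n. stirling_ratio n \<le> C * (real n + 1)"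
    using stirling_ratio_linear_bound by blast
  define K where "K = C * (real d * real k + 1)"
  have K: "K > 0" using C by (simp add: K_def add_pos_pos add_nonneg_pos)
  have dk: "real d * real k \<ge> 1 * 1" using d k by (intro mult_mono) auto
  have S: "stirling_ratio n \<le> K * (real r + 1)" if "n \<le> d * (k * r)" for n r
  proof -
    have "real n \<le> real d * real k * real r" using that
      by (metis mult.assoc of_nat_le_iff of_nat_mult)
    moreover have "0 \<le> real d * real k" by simp
    ultimately have "real n + 1 \<le> (real d * real k + 1) * (real r + 1)"
      unfolding distrib_left distrib_right by linarith
    then have "C * (real n + 1) \<le> K * (real r + 1)" unfolding K_def mult.assoc
      using C(1) by (intro mult_left_mono) auto
    then show ?thesis using C(2)[of n] by simp
  qed
  have "overlap_stirling d k r t \<le> (K * (real r + 1))^7" if "t \<le> r" for r t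
  proof -
    define Q where "Q = K * (real r + 1)"
    have le: "x \<le> k * r \<Longrightarrow> x \<le> d * (k * r)" for x using d by (metis One_nat_def Suc_leI dual_order.trans le_refl mult.commute mult_le_mono2 nat_mult_1)
    have kr: "(k-2)*r+t \<le> k*r"
    proof -
      have "(k-2)*r+t \<le> (k-2)*r + 2*r" using that by simp
      also have "\<dots> = (k - 2 + 2) * r" by (simp only: add_mult_distrib)
      also have "k - 2 + 2 = k" using k by simp
      finally show ?thesis .
    qed
    have r: "r \<le> k*r" "r - t \<le> k*r" "(k-1)*r \<le> k*r" using k by (auto intro: order_trans[OF diff_le_self])
    have g1: "stirling_ratio n \<ge> 1" "stirling_ratio n > 0" "stirling_ratio n \<ge> 0" for n
      using stirling_ratio_ge_1[of n] by auto
    have q: "stirling_ratio r \<le> Q" "stirling_ratio ((k-1)*r) \<le> Q" "stirling_ratio (d*(r-t)) \<le> Q"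
       "stirling_ratio (d*((k-2)*r+t)) \<le> Q" "stirling_ratio (d*(k*r)) \<le> Q"
      unfolding Q_def using r kr by (auto intro!: S intro: le)
    have den: "1 \<le> stirling_ratio t * (stirling_ratio (r-t))\<^sup>2 * stirling_ratio ((k-2)*r+t) * stirling_ratio (k*r)"
      "1 \<le> stirling_ratio (d*r) * (stirling_ratio (d*((k-1)*r)))\<^sup>2"
      using g1 by (auto intro!: mult_ge1_I one_le_power)
    have Q0: "Q \<ge> 0" using K by (simp add: Q_def)
    have div: "x / y \<le> x" if "x \<ge> 0" "y \<ge> 1" for x y :: real
      using divide_left_mono[of 1 y x] that by simp
    have "overlap_stirling d k r t \<le> ((stirling_ratio r)\<^sup>2 * (stirling_ratio ((k-1)*r))\<^sup>2) * 
       (stirling_ratio (d*(r-t)) * stirling_ratio (d*((k-2)*r+t)) * stirling_ratio (d*(k*r)))"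
      unfolding overlap_stirling_def Let_def using den g1(3)
      by (intro mult_mono div) auto
    also have "\<dots> \<le> (Q^2 * Q^2) * (Q * Q * Q)"
      using q g1 Q0 by (intro mult_mono power_mono) auto
    also have "\<dots> = Q^7" by (simp add: power2_eq_square eval_nat_numeral)
    finally show ?thesis by (simp add: Q_def)
  qed
  then show ?thesis using that[of K] K by blast
qed

text \<open>If t and \<open>r - t\<close> are both large, every ratio can be replaced by
  \<open>sqrt (2 * pi * n)\<close> at the cost of a factor q.\<close>

lemma overlap_stirling_near_bound:
  assumes q: "q > 1" and n0: "\<And>n. n \<ge> n0 \<Longrightarrow> stirling_ratio n \<le> q * sqrt (2*pi*real n) \<and> sqrt (2*pi*real n) \<le> q * stirling_ratio n"
    and t: "t \<ge> n0" "r - t \<ge> n0" "t \<le> r" "t > 0" "t < r"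
  shows "overlap_stirling d k r t \<le> q^15 * sqrt (real r / (2 * pi * real t * real (r - t)))"
proof -
  define w where "w n = sqrt (2*pi*real n)" for n
  define S where "S = stirling_ratio"
  have wp: "w n > 0" if "n > 0" for n using that by (simp add: w_def)
  have w0: "w n \<ge> 0" for n by (simp add: w_def)
  have S1: "S n > 0" for n using stirling_ratio_ge_1[of n] by (simp add: S_def)
  have up: "S n \<le> q * w n" and lo: "w n / q \<le> S n" if "n \<ge> n0" for n
    using n0[OF that] q by (auto simp: w_def S_def field_simps)
  have wd: "w (d*n) = sqrt (real d) * w n" for n by (simp add: w_def real_sqrt_mult mult_ac)
  have big: "r \<ge> n0" "(k-1)*r \<ge> n0" "(k-2)*r+t \<ge> n0" "k*r \<ge> n0"
    using t k by (auto intro: order_trans[of n0 r] simp: trans_le_add2)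
  have bigd: "d * n \<ge> n0" if "n \<ge> n0" for n using that d by (metis le_trans nat_le_linear mult_le_mono1 nat_mult_1 One_nat_def Suc_leI)
  have num: "(S r)\<^sup>2 * (S ((k-1)*r))\<^sup>2 \<le> (q * w r)\<^sup>2 * (q * w ((k-1)*r))\<^sup>2"
    using S1 up big by (intro mult_mono power_mono) (auto intro: less_imp_le)
  have num2: "S (d*(r-t)) * S (d*((k-2)*r+t)) * S (d*(k*r)) \<le> (q * w (d*(r-t))) * (q * w (d*((k-2)*r+t))) * (q * w (d*(k*r)))"
    using S1 q w0 by (intro mult_mono up bigd big t(2)) (auto intro!: less_imp_le[OF S1] mult_nonneg_nonneg w0)
  have wq: "w n / q \<ge> 0" for n using q by (simp add: w_def)
  have den: "(w t/q) * (w (r-t)/q)\<^sup>2 * (w ((k-2)*r+t)/q) * (w (k*r)/q) \<le> S t * (S (r-t))\<^sup>2 * S ((k-2)*r+t) * S (k*r)"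
    using lo big t wq S1 by (intro mult_mono power_mono) (auto intro!: mult_nonneg_nonneg less_imp_le[OF S1])
  have den2: "(w (d*r)/q) * (w (d*((k-1)*r))/q)\<^sup>2 \<le> S (d*r) * (S (d*((k-1)*r)))\<^sup>2"
    using lo big bigd wq S1 by (intro mult_mono power_mono) (auto intro!: mult_nonneg_nonneg less_imp_le[OF S1])
  have r0: "r > 0" "(k-1)*r > 0" "(k-2)*r+t > 0" "k*r > 0" "r-t > 0" using t k by auto
  have wpos: "w r > 0" "w ((k-1)*r) > 0" "w t > 0" "w (r-t) > 0" "w ((k-2)*r+t) > 0" "w (k*r) > 0"
    using wp r0 t by auto
  have sd: "sqrt (real d) > 0" using d by simp
  have "overlap_stirling d k r t \<le> ((q * w r)\<^sup>2 * (q * w ((k-1)*r))\<^sup>2) / ((w t/q) * (w (r-t)/q)\<^sup>2 * (w ((k-2)*r+t)/q) * (w (k*r)/q))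
    * (((q * w (d*(r-t))) * (q * w (d*((k-2)*r+t))) * (q * w (d*(k*r)))) / ((w (d*r)/q) * (w (d*((k-1)*r))/q)\<^sup>2))"
    unfolding overlap_stirling_def Let_def S_def[symmetric]
  proof (rule mult_mono[OF frac_le[OF _ num _ den] frac_le[OF _ num2 _ den2]])
    have q0: "q > 0" using q by simp
    have dpos: "w (d*r) > 0" "w (d*((k-1)*r)) > 0" using wp r0 d by auto
    show "0 < (w t/q) * (w (r-t)/q)\<^sup>2 * (w ((k-2)*r+t)/q) * (w (k*r)/q)"
      using wpos q0 by (intro mult_pos_pos divide_pos_pos zero_less_power)
    show "0 < (w (d*r)/q) * (w (d*((k-1)*r))/q)\<^sup>2"
      using dpos q0 by (intro mult_pos_pos divide_pos_pos zero_less_power)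
    show "0 \<le> (q * w (d*(r-t))) * (q * w (d*((k-2)*r+t))) * (q * w (d*(k*r)))"
      using q0 by (intro mult_nonneg_nonneg w0) auto
    show "0 \<le> ((q * w r)\<^sup>2 * (q * w ((k-1)*r))\<^sup>2) / ((w t/q) * (w (r-t)/q)\<^sup>2 * (w ((k-2)*r+t)/q) * (w (k*r)/q))"
      using q0 by (intro divide_nonneg_nonneg mult_nonneg_nonneg w0 zero_le_power2) auto
    show "0 \<le> S (d*(r-t)) * S (d*((k-2)*r+t)) * S (d*(k*r)) / (S (d*r) * (S (d*((k-1)*r)))\<^sup>2)"
      by (intro divide_nonneg_nonneg mult_nonneg_nonneg zero_le_power2 less_imp_le[OF S1])
  qed (intro mult_nonneg_nonneg zero_le_power2)
  also have "\<dots> = q^15 * (w r / (w t * w (r-t)))"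
    unfolding wd by (rule prefactor_cancel) (use wpos sd q in auto)
  also have "w r / (w t * w (r-t)) = sqrt (real r / (2 * pi * real t * real (r - t)))"
  proof -
    have "w r / (w t * w (r-t)) = sqrt ((2*pi*real r) / ((2*pi*real t) * (2*pi*real (r-t))))"
      unfolding w_def by (simp only: real_sqrt_mult real_sqrt_divide)
    also have "(2*pi*real r) / ((2*pi*real t) * (2*pi*real (r-t))) = real r / (2 * pi * real t * real (r - t))"
      by simp
    finally show ?thesis .
  qed
  finally show ?thesis .
qed

text \<open>Near \<open>p = 1 / k\<close> the terms are at most about
  \<open>1 / sqrt (2 * pi * p * (1 - p) * r)\<close> times a Gaussian of variance
  \<open>r / rate'' d k p\<close>, whose sum is about the square root of \<open>2 * pi\<close> times
  this variance; r cancels in the product. All other terms are exponentially small.\<close>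

theorem overlap_sum_limsup:
  assumes b: "b > sqrt ((real k - 1) / (real k - real d))"
  shows "\<forall>\<^sub>F r in sequentially. (\<Sum>t\<le>r. overlap_term d k r t) \<le> b"
proof -
  define p where "p = 1 / real k"
  have k3: "real k \<ge> 3" using k by simp
  have p: "0 < p" "p < 1" using k3 by (auto simp: p_def)
  define R2 where "R2 = rate'' d k p"
  have dk: "real d < real k" using d_less_k[OF d k dstar] by simp
  have R2: "R2 = real k ^ 2 * (real k - real d) / (real k - 1)^2"
    by (simp add: R2_def p_def rate''_inverse_k[OF d k dstar])
  have R2pos: "R2 > 0" using dk k3 unfolding R2 by simp
  have L: "1 / (p * (1 - p) * R2) = (real k - 1) / (real k - real d)"
    using dk k3 unfolding R2 p_def by (simp add: divide_simps) (simp add: power2_eq_square algebra_simps)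
  \<comment> \<open>One slack x serves three purposes: the relative error \<open>1 + x\<close> in
    Stirling's formula, overlaps between \<open>p - x\<close> and \<open>p + x\<close>, and a
    curvature reduced by \<open>1 - x\<close>. The resulting constant \<open>h x\<close> is
    continuous with \<open>h 0\<close> the claimed one, so a small x keeps it below b.\<close>
  define h where "h x = (1+x)^15 * sqrt (1 / ((p-x) * (1-p-x) * ((1-x) * R2)))" for x
  have "isCont h 0"
    unfolding h_def using p R2pos by (intro continuous_intros) auto
  moreover have "h 0 < b" using b L by (simp add: h_def)
  ultimately have "\<forall>\<^sub>F x in at_right 0. h x < b"
    unfolding isCont_def using order_tendstoD(2) filterlim_at_split by blast
  moreover have "\<forall>\<^sub>F x in at_right 0. 0 < x \<and> x < min (p/2) ((1-p)/2)"
    using p by (intro eventually_at_right_real[THEN eventually_mono]) (auto simp: min_def)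
  ultimately have "\<forall>\<^sub>F x in at_right 0. h x < b \<and> 0 < x \<and> x < min (p/2) ((1-p)/2)"
    by eventually_elim auto
  then obtain x where x: "h x < b" "0 < x" "x < p/2" "x < (1-p)/2"
    by (metis (mono_tags, lifting) eventually_happens' min_less_iff_conj trivial_limit_at_right_real)
  have x1: "x < 1" using x p by linarith
  obtain \<eta>0 where \<eta>0: "\<eta>0 > 0" "\<And>z. \<bar>z - p\<bar> \<le> \<eta>0 \<Longrightarrow> rate d k z \<ge> (1 - x) * R2 / 2 * (z - p)^2"
    using rate_quadratic_lower[OF d k dstar x(2) x1] unfolding p_def R2_def by metis
  define \<eta> where "\<eta> = min x \<eta>0"
  have \<eta>: "\<eta> > 0" "\<eta> \<le> x" "\<eta> \<le> \<eta>0" using x \<eta>0 by (auto simp: \<eta>_def)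
  obtain c0 where c0: "c0 > 0" "\<And>z. 0 \<le> z \<Longrightarrow> z \<le> 1 \<Longrightarrow> \<bar>z - p\<bar> \<ge> \<eta> \<Longrightarrow> rate d k z \<ge> c0"
    using rate_bounded_below[OF d k dstar \<eta>(1)] unfolding p_def by metis
  obtain C where C: "C > 0" "\<And>r t. t \<le> r \<Longrightarrow> overlap_stirling d k r t \<le> (C * (real r + 1))^7"
    using overlap_stirling_poly_bound by blast
  define q where "q = 1 + x"
  have q: "q > 1" using x by (simp add: q_def)
  have "\<forall>\<^sub>F n in sequentially. stirling_ratio n / sqrt (2*pi*real n) < q"
    using order_tendstoD(2)[OF stirling_ratio_limit q] .
  moreover have "\<forall>\<^sub>F n in sequentially. 1/q < stirling_ratio n / sqrt (2*pi*real n)"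
    by (rule order_tendstoD(1)[OF stirling_ratio_limit]) (use q in simp)
  ultimately have "\<forall>\<^sub>F n in sequentially. n > 0 \<and> stirling_ratio n \<le> q * sqrt (2*pi*real n) \<and> sqrt (2*pi*real n) \<le> q * stirling_ratio n"
    using eventually_gt_at_top[of 0]
  proof eventually_elim
    case (elim n)
    then have "sqrt (2*pi*real n) > 0" by simp
    with elim q show ?case by (simp add: field_simps)
  qed
  then obtain n0 where n0: "\<And>n. n \<ge> n0 \<Longrightarrow> stirling_ratio n \<le> q * sqrt (2*pi*real n) \<and> sqrt (2*pi*real n) \<le> q * stirling_ratio n"
    unfolding eventually_sequentially by blast
  define c where "c = (1 - x) * R2 / 2"
  have c: "c > 0" using x1 R2pos by (simp add: c_def)
  \<comment> \<open>The first summand is for the overlaps near p and contains the bound of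
    \<open>sum_gauss_le\<close>; the second is for the at most \<open>r + 1\<close> other
    overlaps.\<close>
  define B where "B r = q^15 * sqrt (1 / (2 * pi * (p-x) * (1-p-x) * real r)) * (2 + sqrt (pi * real r / c)) + (real r + 1) * ((C * (real r + 1))^7 * exp (- c0 * real r))" for r :: nat
  define a1 where "a1 = (p-x) * (1-p-x)"
  have a1: "a1 > 0" using x by (simp add: a1_def)
  have B_lim: "B \<longlonglongrightarrow> h x"
  proof -
    have "(\<lambda>r::nat. q^15 * sqrt (1 / (2 * pi * a1 * real r)) * (2 + sqrt (pi * real r / c))) \<longlonglongrightarrow> q^15 * sqrt (1 / (2 * a1 * c))"
    proof -
      have "(\<lambda>r::nat. q^15 * (2 * sqrt (1 / (2 * pi * a1 * real r)) + sqrt (1 / (2 * a1 * c)))) \<longlonglongrightarrow> q^15 * (0 + sqrt (1 / (2 * a1 * c)))"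
      proof (intro tendsto_intros)
        show "(\<lambda>r::nat. 2 * sqrt (1 / (2 * pi * a1 * real r))) \<longlonglongrightarrow> 0"
          using a1 by real_asymp
      qed
      moreover have "\<forall>\<^sub>F r in sequentially. q^15 * (2 * sqrt (1 / (2 * pi * a1 * real r)) + sqrt (1 / (2 * a1 * c))) = q^15 * sqrt (1 / (2 * pi * a1 * real r)) * (2 + sqrt (pi * real r / c))"
        using eventually_gt_at_top[of 0]
      proof eventually_elim
        case (elim r)
        have "sqrt (1 / (2 * pi * a1 * real r)) * sqrt (pi * real r / c) = sqrt (1 / (2 * a1 * c))"
          using elim by (simp flip: real_sqrt_mult)
        then show ?case by (simp add: algebra_simps)
      qed
      ultimately have "(\<lambda>r::nat. q^15 * sqrt (1 / (2 * pi * a1 * real r)) * (2 + sqrt (pi * real r / c))) \<longlonglongrightarrow> q^15 * (0 + sqrt (1 / (2 * a1 * c)))"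
        by (rule Lim_transform_eventually)
      then show ?thesis by simp
    qed
    moreover have "(\<lambda>r::nat. (real r + 1) * ((C * (real r + 1))^7 * exp (- c0 * real r))) \<longlonglongrightarrow> 0"
      using C(1) c0(1) by real_asymp
    ultimately have "B \<longlonglongrightarrow> q^15 * sqrt (1 / (2 * a1 * c)) + 0"
      unfolding B_def a1_def mult.assoc[symmetric] by (intro tendsto_add) (simp_all add: mult.assoc)
    moreover have "2 * a1 * c = (p-x) * (1-p-x) * ((1-x) * R2)" by (simp add: a1_def c_def)
    ultimately show ?thesis by (simp add: h_def q_def)
  qed
  have ev1: "\<forall>\<^sub>F r in sequentially. B r < b"
    using order_tendstoD(2)[OF B_lim x(1)] .
  have "filterlim (\<lambda>r::nat. (p-x) * real r) at_top sequentially" "filterlim (\<lambda>r::nat. (1-p-x) * real r) at_top sequentially"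
    using x by (auto intro!: filterlim_tendsto_pos_mult_at_top[OF tendsto_const] filterlim_real_sequentially)
  then have ev2: "\<forall>\<^sub>F r in sequentially. (p-x) * real r \<ge> real n0" "\<forall>\<^sub>F r in sequentially. (1-p-x) * real r \<ge> real n0"
    by (auto simp: filterlim_at_top)
  show ?thesis using ev1 ev2 eventually_gt_at_top[of 0]
  proof eventually_elim
    case (elim r)
    define Nr where "Nr = {t\<in>{..r}. \<bar>real t / real r - p\<bar> \<le> \<eta>}"
    have r0: "real r > 0" using elim by simp
    have near: "overlap_term d k r t \<le> q^15 * sqrt (1 / (2 * pi * (p-x) * (1-p-x) * real r)) * exp (- (real t - p * real r)\<^sup>2 / (2 * (sqrt (real r / (2*c)))\<^sup>2))"
      if "t \<in> Nr" for t
    proof -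
      have tr: "t \<le> r" "\<bar>real t / real r - p\<bar> \<le> \<eta>" using that by (auto simp: Nr_def)
      have ab: "p - x \<le> real t / real r" "real t / real r \<le> p + x" using tr \<eta> by linarith+
      have t1: "(p - x) * real r \<le> real t" using ab(1) r0 by (simp add: field_simps)
      have t2: "(1 - p - x) * real r \<le> real (r - t)" using ab(2) r0 tr by (simp add: of_nat_diff field_simps)
      have tn: "t \<ge> n0" "r - t \<ge> n0" using t1 t2 elim by linarith+
      have pos: "(p - x) * real r > 0" "(1 - p - x) * real r > 0" using x r0 by auto
      have "t > 0" "r - t > 0" using pos t1 t2 by linarith+
      then have "overlap_stirling d k r t \<le> q^15 * sqrt (real r / (2 * pi * real t * real (r - t)))"
        by (intro overlap_stirling_near_bound[OF q n0 tn]) auto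
      also have "\<dots> \<le> q^15 * sqrt (1 / (2 * pi * (p-x) * (1-p-x) * real r))"
      proof (intro mult_left_mono real_sqrt_le_mono)
        have "((p-x) * real r) * ((1-p-x) * real r) \<le> real t * real (r-t)"
          using t1 t2 pos by (intro mult_mono) auto
        then have "real r / (2 * pi * (real t * real (r-t))) \<le> real r / (2 * pi * (((p-x) * real r) * ((1-p-x) * real r)))"
          using pos r0 x \<open>t > 0\<close> \<open>r - t > 0\<close> by (intro divide_left_mono mult_left_mono mult_pos_pos) auto
        also have "\<dots> = 1 / (2 * pi * (p-x) * (1-p-x) * real r)" using r0 by simp
        finally show "real r / (2 * pi * real t * real (r - t)) \<le> 1 / (2 * pi * (p-x) * (1-p-x) * real r)"
          by (simp add: mult.assoc)
      qed (use q in simp)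
      finally have 1: "overlap_stirling d k r t \<le> q^15 * sqrt (1 / (2 * pi * (p-x) * (1-p-x) * real r))" .
      have "c * (real t / real r - p)^2 \<le> rate d k (real t / real r)"
        unfolding c_def using \<eta>0(2)[of "real t / real r"] tr \<eta> by simp
      then have "real r * (c * (real t / real r - p)^2) \<le> real r * rate d k (real t / real r)"
        using r0 by (intro mult_left_mono) auto
      moreover have "real r * (c * (real t / real r - p)^2) = (real t - p * real r)\<^sup>2 / (2 * (sqrt (real r / (2*c)))\<^sup>2)"
        using r0 c by (simp add: field_simps power2_eq_square)
      ultimately have 2: "exp (- real r * rate d k (real t / real r)) \<le> exp (- (real t - p * real r)\<^sup>2 / (2 * (sqrt (real r / (2*c)))\<^sup>2))"
        by simp
      have "overlap_term d k r t = overlap_stirling d k r t * exp (- real r * rate d k (real t / real r))"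
        by (rule overlap_term_eq) (use elim tr in auto)
      also have "\<dots> \<le> q^15 * sqrt (1 / (2 * pi * (p-x) * (1-p-x) * real r)) * exp (- (real t - p * real r)\<^sup>2 / (2 * (sqrt (real r / (2*c)))\<^sup>2))"
        by (rule mult_mono[OF 1 2]) (use overlap_stirling_nonneg[of r t] 1 in auto)
      finally show ?thesis .
    qed
    have far: "overlap_term d k r t \<le> (C * (real r + 1))^7 * exp (- c0 * real r)" if "t \<in> {..r} - Nr" for t
    proof -
      have tr: "t \<le> r" "\<eta> \<le> \<bar>real t / real r - p\<bar>" using that by (auto simp: Nr_def)
      have "c0 \<le> rate d k (real t / real r)" using c0(2)[of "real t / real r"] tr elim by simp
      then have 2: "exp (- real r * rate d k (real t / real r)) \<le> exp (- c0 * real r)"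
        using r0 by (simp add: mult.commute)
      have "overlap_term d k r t = overlap_stirling d k r t * exp (- real r * rate d k (real t / real r))"
        by (rule overlap_term_eq) (use elim tr in auto)
      also have "\<dots> \<le> (C * (real r + 1))^7 * exp (- c0 * real r)"
        using C by (intro mult_mono C(2) tr 2) auto
      finally show ?thesis .
    qed
    have "(\<Sum>t\<le>r. overlap_term d k r t) = sum (overlap_term d k r) Nr + sum (overlap_term d k r) ({..r} - Nr)"
      by (subst sum.subset_diff[of Nr]) (auto simp: Nr_def)
    also have "sum (overlap_term d k r) Nr \<le> q^15 * sqrt (1 / (2 * pi * (p-x) * (1-p-x) * real r)) * (\<Sum>t\<in>Nr. exp (- (real t - p * real r)\<^sup>2 / (2 * (sqrt (real r / (2*c)))\<^sup>2)))"
      unfolding sum_distrib_left by (intro sum_mono near)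
    also have "(\<Sum>t\<in>Nr. exp (- (real t - p * real r)\<^sup>2 / (2 * (sqrt (real r / (2*c)))\<^sup>2))) \<le> 2 + sqrt (2 * pi * (sqrt (real r / (2*c)))\<^sup>2)"
      by (rule sum_gauss_le) (use r0 c in \<open>auto simp: Nr_def\<close>)
    also have "2 * pi * (sqrt (real r / (2*c)))\<^sup>2 = pi * real r / c" using r0 c by simp
    also have "sum (overlap_term d k r) ({..r} - Nr) \<le> (\<Sum>t\<in>{..r}-Nr. (C * (real r + 1))^7 * exp (- c0 * real r))"
      by (intro sum_mono far)
    also have "\<dots> = real (card ({..r} - Nr)) * ((C * (real r + 1))^7 * exp (- c0 * real r))" by simp
    also have "\<dots> \<le> (real r + 1) * ((C * (real r + 1))^7 * exp (- c0 * real r))"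
    proof (intro mult_right_mono)
      have "card ({..r} - Nr) \<le> card {..r}" by (intro card_mono) auto
      then show "real (card ({..r} - Nr)) \<le> real r + 1" by simp
    qed (use C in simp)
    finally have "(\<Sum>t\<le>r. overlap_term d k r t) \<le> B r"
      using x q unfolding B_def by (simp add: mult_left_mono)
    then show ?case using elim by simp
  qed
qed

end

section \<open>Counting bijections\<close>

text \<open>A colour-preserving bijection consists of independent bijections between the colour
  classes. In the induction the image of the new element x ranges over its colour class in B, which
  has one element more than the class that remains in A; this raises one factorial by a
  step.\<close>

lemma card_coloured_bijections:
  fixes \<alpha> :: "'a \<Rightarrow> 'c" and \<beta> :: "'b \<Rightarrow> 'c"
  assumes "finite A" "finite B" "finite C" "\<alpha> ` A \<subseteq> C" "\<beta> ` B \<subseteq> C"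
    and "\<And>c. c \<in> C \<Longrightarrow> card {a\<in>A. \<alpha> a = c} = card {b\<in>B. \<beta> b = c}"
  shows "card {f \<in> A \<rightarrow>\<^sub>E B. bij_betw f A B \<and> (\<forall>a\<in>A. \<beta> (f a) = \<alpha> a)} = (\<Prod>c\<in>C. fact (card {a\<in>A. \<alpha> a = c}))"
  using assms
proof (induction A arbitrary: B rule: finite_induct)
  case empty
  have "B = {}"
  proof (rule ccontr)
    assume "B \<noteq> {}"
    then obtain b where "b \<in> B" by blast
    then have "b \<in> {b'\<in>B. \<beta> b' = \<beta> b}" "\<beta> b \<in> C" using empty by auto
    then show False using empty.prems(5)[of "\<beta> b"] empty.prems(1) by auto
  qed
  then have "{f \<in> {} \<rightarrow>\<^sub>E B. bij_betw f {} B \<and> (\<forall>a\<in>{}. \<beta> (f a) = \<alpha> a)} = {\<lambda>x. undefined}"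
    by (auto simp: bij_betw_def)
  then show ?case by simp
next
  case (insert x A)
  define F where "F A B = {f \<in> A \<rightarrow>\<^sub>E B. bij_betw f A B \<and> (\<forall>a\<in>A. \<beta> (f a) = \<alpha> a)}" for A :: "'a set" and B
  define Bx where "Bx = {b\<in>B. \<beta> b = \<alpha> x}"
  define cnt where "cnt c = card {a\<in>A. \<alpha> a = c}" for c
  have xC: "\<alpha> x \<in> C" using insert.prems by auto
  have ins: "{a\<in>insert x A. \<alpha> a = c} = (if c = \<alpha> x then insert x {a\<in>A. \<alpha> a = c} else {a\<in>A. \<alpha> a = c})" for c
    by auto
  have cx: "card {a\<in>insert x A. \<alpha> a = c} = cnt c + (if c = \<alpha> x then 1 else 0)" for c
    unfolding ins cnt_def using insert.hyps by simp
  have step: "card (F A (B - {b})) = (\<Prod>c\<in>C. fact (cnt c))" if b: "b \<in> Bx" for b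
    unfolding F_def cnt_def
  proof (rule insert.IH)
    show "card {a\<in>A. \<alpha> a = c} = card {b'\<in>B - {b}. \<beta> b' = c}" if c: "c \<in> C" for c
    proof -
      have e: "{b'\<in>B - {b}. \<beta> b' = c} = {b'\<in>B. \<beta> b' = c} - {b}" by auto
      have "card {b'\<in>B - {b}. \<beta> b' = c} = card {b'\<in>B. \<beta> b' = c} - (if c = \<alpha> x then 1 else 0)"
        unfolding e using b insert.prems by (auto simp: Bx_def card_Diff_singleton_if)
      then show ?thesis using insert.prems(5)[OF c] cx[of c] by (simp add: cnt_def)
    qed
  qed (use insert.prems in auto)
  have bij: "bij_betw (\<lambda>(b, g). g(x := b)) (SIGMA b:Bx. F A (B - {b})) (F (insert x A) B)"
  proof (rule bij_betw_byWitness[where f' = "\<lambda>f. (f x, f(x := undefined))"])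
    show "\<forall>a\<in>SIGMA b:Bx. F A (B - {b}). (\<lambda>f. (f x, f(x := undefined))) ((\<lambda>(b, g). g(x := b)) a) = a"
      using insert.hyps by (auto simp: F_def PiE_def extensional_def fun_eq_iff)
    show "\<forall>a'\<in>F (insert x A) B. (\<lambda>(b, g). g(x := b)) ((\<lambda>f. (f x, f(x := undefined))) a') = a'"
      by auto
    show "(\<lambda>(b, g). g(x := b)) ` (SIGMA b:Bx. F A (B - {b})) \<subseteq> F (insert x A) B"
    proof clarsimp
      fix b g assume b: "b \<in> Bx" and g: "g \<in> F A (B - {b})"
      have gA: "bij_betw (g(x := b)) A (B - {b})"
        using g insert.hyps by (subst bij_betw_cong[where g = g]) (auto simp: F_def)
      have "bij_betw (g(x := b)) (insert x A) (insert ((g(x := b)) x) (B - {b}))"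
        using insert.hyps gA by (auto simp: bij_betw_def)
      then have "bij_betw (g(x := b)) (insert x A) B"
        using b by (simp add: Bx_def insert_absorb)
      then show "g(x := b) \<in> F (insert x A) B"
        using b g insert.hyps by (auto simp: F_def Bx_def PiE_def extensional_def Pi_def)
    qed
    show "(\<lambda>f. (f x, f(x := undefined))) ` F (insert x A) B \<subseteq> (SIGMA b:Bx. F A (B - {b}))"
    proof clarsimp
      fix f assume f: "f \<in> F (insert x A) B"
      have fx: "f x \<in> Bx" using f by (auto simp: F_def Bx_def)
      have "bij_betw f A (B - {f x})"
        using f insert.hyps by (auto simp: F_def bij_betw_def inj_on_def)
      then have "bij_betw (f(x := undefined)) A (B - {f x})"
        using insert.hyps by (subst bij_betw_cong[where g = f]) auto
      moreover have "f(x := undefined) \<in> A \<rightarrow>\<^sub>E (B - {f x})"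
        using f insert.hyps by (auto simp: F_def PiE_def extensional_def bij_betw_def inj_on_def)
      ultimately show "f x \<in> Bx \<and> f(x := undefined) \<in> F A (B - {f x})"
        using f fx insert.hyps by (auto simp: F_def)
    qed
  qed
  have finF: "finite (F A (B - {b}))" for b
    unfolding F_def using insert.hyps insert.prems by (auto intro!: finite_subset[OF _ finite_PiE[of A "\<lambda>_. B - {b}"]])
  have finBx: "finite Bx" using insert.prems by (simp add: Bx_def)
  have "card (F (insert x A) B) = card (SIGMA b:Bx. F A (B - {b}))"
    using bij_betw_same_card[OF bij] by simp
  also have "\<dots> = card Bx * (\<Prod>c\<in>C. fact (cnt c))"
    using finF finBx step by (simp add: card_SigmaI)
  also have "card Bx = Suc (cnt (\<alpha> x))"
    using insert.prems(5)[OF xC] cx[of "\<alpha> x"] by (simp add: Bx_def)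
  also have "Suc (cnt (\<alpha> x)) * (\<Prod>c\<in>C. fact (cnt c)) = (\<Prod>c\<in>C. fact (card {a\<in>insert x A. \<alpha> a = c}))"
    unfolding cx using insert.prems xC
    by (simp add: prod.remove[of C "\<alpha> x"] algebra_simps)
  finally show ?case by (simp add: F_def)
qed

lemma bij_betw_image_eq_iff:
  assumes "bij_betw f A B" "P \<subseteq> A" "Q \<subseteq> B"
  shows "f ` P = Q \<longleftrightarrow> (\<forall>a\<in>A. f a \<in> Q \<longleftrightarrow> a \<in> P)"
proof
  assume "f ` P = Q"
  then show "\<forall>a\<in>A. f a \<in> Q \<longleftrightarrow> a \<in> P"
    using assms by (auto simp: bij_betw_def dest: inj_onD)
next
  assume a: "\<forall>a\<in>A. f a \<in> Q \<longleftrightarrow> a \<in> P"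
  have "B = f ` A" using assms by (auto simp: bij_betw_def)
  then show "f ` P = Q" using assms a by auto
qed

text \<open>Each prescribed pair receives a colour of its own, and all other elements are coloured
  by membership in P or Q. Preserving the colours then means to extend S and to map P onto Q; the
  singleton classes contribute 1, and the two classes of free elements the two factorials.\<close>

lemma card_bijections_extending:
  assumes A: "finite A" "finite B" "card A = card B"
    and S: "S \<subseteq> A \<times> B" "inj_on fst S" "inj_on snd S"
    and PQ: "P \<subseteq> A" "Q \<subseteq> B" "card P = card Q" "\<forall>(p,q)\<in>S. p \<in> P \<longleftrightarrow> q \<in> Q"
  shows "card {f \<in> A \<rightarrow>\<^sub>E B. bij_betw f A B \<and> (\<forall>(p,q)\<in>S. f p = q) \<and> f ` P = Q} =
     fact (card P - card {e\<in>S. fst e \<in> P}) * fact (card A - card P - card {e\<in>S. fst e \<notin> P})"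
proof -
  define \<alpha> :: "'a \<Rightarrow> 'a + bool" where "\<alpha> a = (if a \<in> fst ` S then Inl a else Inr (a \<in> P))" for a
  define \<beta> :: "'b \<Rightarrow> 'a + bool" where "\<beta> b = (if b \<in> snd ` S then Inl (THE a. (a,b) \<in> S) else Inr (b \<in> Q))" for b
  define C where "C = Inl ` fst ` S \<union> {Inr True, Inr False}"
  have finS: "finite S" using S(1) A by (meson finite_SigmaI finite_subset)
  have the: "(THE a. (a,b) \<in> S) = a" if "(a,b) \<in> S" for a b
  proof (rule the_equality)
    show "(a, b) \<in> S" by fact
    fix a' assume "(a', b) \<in> S"
    then show "a' = a" using inj_onD[OF S(3), of "(a',b)" "(a,b)"] that by simp
  qed
  have fstS: "q = q'" if "(p,q) \<in> S" "(p,q') \<in> S" for p q q'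
    using inj_onD[OF S(2), of "(p,q)" "(p,q')"] that by simp
  have sub: "fst ` S \<subseteq> A" "snd ` S \<subseteq> B" using S(1) by auto
  have cP: "card (fst ` S \<inter> P) = card {e\<in>S. fst e \<in> P}" "card (snd ` S \<inter> Q) = card {e\<in>S. fst e \<in> P}"
  proof -
    have "fst ` S \<inter> P = fst ` {e\<in>S. fst e \<in> P}" "snd ` S \<inter> Q = snd ` {e\<in>S. fst e \<in> P}"
      using PQ(4) by force+
    then show "card (fst ` S \<inter> P) = card {e\<in>S. fst e \<in> P}" "card (snd ` S \<inter> Q) = card {e\<in>S. fst e \<in> P}"
      using S by (auto intro!: card_image intro: inj_on_subset)
  qed
  have cN: "card (fst ` S - P) = card {e\<in>S. fst e \<notin> P}" "card (snd ` S - Q) = card {e\<in>S. fst e \<notin> P}"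
  proof -
    have "fst ` S - P = fst ` {e\<in>S. fst e \<notin> P}" "snd ` S - Q = snd ` {e\<in>S. fst e \<notin> P}"
      using PQ(4) by force+
    then show "card (fst ` S - P) = card {e\<in>S. fst e \<notin> P}" "card (snd ` S - Q) = card {e\<in>S. fst e \<notin> P}"
      using S by (auto intro!: card_image intro: inj_on_subset)
  qed
  have fP: "finite P" "finite Q" using PQ A by (auto intro: finite_subset)
  have aT: "{a\<in>A. \<alpha> a = Inr True} = P - (fst ` S \<inter> P)" "{b\<in>B. \<beta> b = Inr True} = Q - (snd ` S \<inter> Q)"
    using PQ by (auto simp: \<alpha>_def \<beta>_def)
  have aF: "{a\<in>A. \<alpha> a = Inr False} = (A - P) - (fst ` S - P)" "{b\<in>B. \<beta> b = Inr False} = (B - Q) - (snd ` S - Q)"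
    using PQ by (auto simp: \<alpha>_def \<beta>_def)
  have cT: "card {a\<in>A. \<alpha> a = Inr True} = card P - card {e\<in>S. fst e \<in> P}" "card {b\<in>B. \<beta> b = Inr True} = card P - card {e\<in>S. fst e \<in> P}"
    unfolding aT using fP cP PQ by (auto simp: card_Diff_subset)
  have cF: "card {a\<in>A. \<alpha> a = Inr False} = card A - card P - card {e\<in>S. fst e \<notin> P}" 
     "card {b\<in>B. \<beta> b = Inr False} = card A - card P - card {e\<in>S. fst e \<notin> P}"
  proof -
    have "fst ` S - P \<subseteq> A - P" "snd ` S - Q \<subseteq> B - Q" using sub by auto
    then show "card {a\<in>A. \<alpha> a = Inr False} = card A - card P - card {e\<in>S. fst e \<notin> P}" 
     "card {b\<in>B. \<beta> b = Inr False} = card A - card P - card {e\<in>S. fst e \<notin> P}"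
      unfolding aF using fP cN PQ A finS by (auto simp: card_Diff_subset)
  qed
  have aI: "{a'\<in>A. \<alpha> a' = Inl a} = {a}" "card {b\<in>B. \<beta> b = Inl a} = 1" if aS: "a \<in> fst ` S" for a
  proof -
    show "{a'\<in>A. \<alpha> a' = Inl a} = {a}" using that sub by (auto simp: \<alpha>_def)
    obtain b where b: "(a,b) \<in> S" using aS by auto
    have "{b'\<in>B. \<beta> b' = Inl a} = {b}"
      using b sub by (auto simp: \<beta>_def the split: if_splits dest: fstS) (force+)?
    then show "card {b\<in>B. \<beta> b = Inl a} = 1" by simp
  qed
  have "{f \<in> A \<rightarrow>\<^sub>E B. bij_betw f A B \<and> (\<forall>(p,q)\<in>S. f p = q) \<and> f ` P = Q} =
    {f \<in> A \<rightarrow>\<^sub>E B. bij_betw f A B \<and> (\<forall>a\<in>A. \<beta> (f a) = \<alpha> a)}"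
  proof (rule Collect_cong, rule conj_cong[OF refl], rule conj_cong[OF refl])
    fix f assume f: "bij_betw f A B"
    have inj: "f a = f a' \<Longrightarrow> a \<in> A \<Longrightarrow> a' \<in> A \<Longrightarrow> a = a'" for a a'
      using f by (auto simp: bij_betw_def dest: inj_onD)
    show "((\<forall>(p,q)\<in>S. f p = q) \<and> f ` P = Q) = (\<forall>a\<in>A. \<beta> (f a) = \<alpha> a)"
    proof
      assume L: "(\<forall>(p,q)\<in>S. f p = q) \<and> f ` P = Q"
      show "\<forall>a\<in>A. \<beta> (f a) = \<alpha> a"
      proof
        fix a assume a: "a \<in> A"
        have "f a \<in> snd ` S \<longleftrightarrow> a \<in> fst ` S"
        proof
          assume "f a \<in> snd ` S"
          then obtain p where p: "(p, f a) \<in> S" by auto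
          then have "f p = f a" "p \<in> A" using L sub by auto
          then have "p = a" using inj a by blast
          then show "a \<in> fst ` S" using p by force
        next
          assume "a \<in> fst ` S"
          then show "f a \<in> snd ` S" using L by force
        qed
        moreover have "(THE p. (p, f a) \<in> S) = a" if "a \<in> fst ` S"
          using that L by (intro the) auto
        moreover have "f a \<in> Q \<longleftrightarrow> a \<in> P"
          using L bij_betw_image_eq_iff[OF f PQ(1,2)] a by blast
        ultimately show "\<beta> (f a) = \<alpha> a" by (auto simp: \<alpha>_def \<beta>_def)
      qed
    next
      assume R: "\<forall>a\<in>A. \<beta> (f a) = \<alpha> a"
      have S': "f p = q" if pq: "(p,q) \<in> S" for p q
      proof -
        have p: "p \<in> A" "p \<in> fst ` S" using pq sub by force+
        then have "\<beta> (f p) = Inl p" using R by (simp add: \<alpha>_def)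
        then have "f p \<in> snd ` S" "(THE a. (a, f p) \<in> S) = p" by (auto simp: \<beta>_def split: if_splits)
        then have "(p, f p) \<in> S" using the by force
        then show ?thesis using pq fstS by blast
      qed
      have "\<forall>a\<in>A. f a \<in> Q \<longleftrightarrow> a \<in> P"
      proof
        fix a assume a: "a \<in> A"
        show "f a \<in> Q \<longleftrightarrow> a \<in> P"
        proof (cases "a \<in> fst ` S")
          case True
          then obtain q where "(a,q) \<in> S" by auto
          then show ?thesis using S' PQ(4) by force
        next
          case False
          then have "\<beta> (f a) = Inr (a \<in> P)" using R a by (simp add: \<alpha>_def)
          then show ?thesis by (auto simp: \<beta>_def split: if_splits)
        qed
      qed
      then have "f ` P = Q" using bij_betw_image_eq_iff[OF f PQ(1,2)] by blast
      then show "(\<forall>(p,q)\<in>S. f p = q) \<and> f ` P = Q" using S' by auto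
    qed
  qed
  also have "card \<dots> = (\<Prod>c\<in>C. fact (card {a\<in>A. \<alpha> a = c}))"
  proof (rule card_coloured_bijections)
    show "finite C" using finS by (simp add: C_def)
    show "\<alpha> ` A \<subseteq> C" by (auto simp: \<alpha>_def C_def)
    show "\<beta> ` B \<subseteq> C" by (auto simp: \<beta>_def C_def the image_iff) (metis fst_conv the)?
    show "card {a\<in>A. \<alpha> a = c} = card {b\<in>B. \<beta> b = c}" if "c \<in> C" for c
    proof -
      consider a where "c = Inl a" "a \<in> fst ` S" | "c = Inr True" | "c = Inr False"
        using \<open>c \<in> C\<close> by (auto simp: C_def)
      then show ?thesis by cases (use cT cF aI in simp_all)
    qed
  qed (use A in auto)
  also have "\<dots> = (\<Prod>c\<in>{Inr True, Inr False}. fact (card {a\<in>A. \<alpha> a = c}))"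
    unfolding C_def
  proof (rule prod.mono_neutral_right)
    show "\<forall>i\<in>Inl ` fst ` S \<union> {Inr True, Inr False} - {Inr True, Inr False}. fact (card {a\<in>A. \<alpha> a = i}) = 1"
    proof
      fix i assume "i \<in> Inl ` fst ` S \<union> {Inr True, Inr False} - {Inr True, Inr False}"
      then obtain a where "i = Inl a" "a \<in> fst ` S" by blast
      then show "fact (card {a\<in>A. \<alpha> a = i}) = 1" using aI(1) by simp
    qed
  qed (use finS in auto)
  also have "\<dots> = fact (card P - card {e\<in>S. fst e \<in> P}) * fact (card A - card P - card {e\<in>S. fst e \<notin> P})"
    using cT cF by simp
  finally show ?thesis .
qed

text \<open>The colour of an element is its pair of memberships. A bijection with both images maps
  \<open>P \<inter> P'\<close> onto \<open>Q \<inter> Q'\<close>, so intersections of different size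
  exclude every bijection.\<close>

lemma card_bijections_two_images:
  assumes A: "finite A" "finite B" "card A = card B"
    and PQ: "P \<subseteq> A" "Q \<subseteq> B" "card P = card Q" "P' \<subseteq> A" "Q' \<subseteq> B" "card P' = card Q'"
  shows "card {f \<in> A \<rightarrow>\<^sub>E B. bij_betw f A B \<and> f ` P = Q \<and> f ` P' = Q'} =
     (if card (P \<inter> P') = card (Q \<inter> Q')
      then fact (card (P \<inter> P')) * fact (card P - card (P \<inter> P')) * fact (card P' - card (P \<inter> P')) * fact (card A - card (P \<union> P'))
      else 0)"
proof (cases "card (P \<inter> P') = card (Q \<inter> Q')")
  case False
  have "\<not> (f ` P = Q \<and> f ` P' = Q')" if f: "bij_betw f A B" for f
  proof
    assume a: "f ` P = Q \<and> f ` P' = Q'"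
    have inj: "inj_on f A" using f by (simp add: bij_betw_def)
    then have "f ` (P \<inter> P') = Q \<inter> Q'" using a PQ by (metis inj_on_image_Int)
    moreover have "inj_on f (P \<inter> P')" using inj PQ by (meson inf.coboundedI1 inj_on_subset)
    ultimately show False using False card_image by metis
  qed
  then have e: "{f \<in> A \<rightarrow>\<^sub>E B. bij_betw f A B \<and> f ` P = Q \<and> f ` P' = Q'} = {}" by auto
  show ?thesis unfolding e using False by simp
next
  case True
  define \<alpha> where "\<alpha> a = (a \<in> P, a \<in> P')" for a
  define \<beta> where "\<beta> b = (b \<in> Q, b \<in> Q')" for b
  have fin: "finite P" "finite P'" "finite Q" "finite Q'" using PQ A by (auto intro: finite_subset)
  have e: "{a\<in>A. \<alpha> a = (True,True)} = P \<inter> P'" "{a\<in>A. \<alpha> a = (True,False)} = P - P \<inter> P'"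
     "{a\<in>A. \<alpha> a = (False,True)} = P' - P \<inter> P'" "{a\<in>A. \<alpha> a = (False,False)} = A - (P \<union> P')"
     "{b\<in>B. \<beta> b = (True,True)} = Q \<inter> Q'" "{b\<in>B. \<beta> b = (True,False)} = Q - Q \<inter> Q'"
     "{b\<in>B. \<beta> b = (False,True)} = Q' - Q \<inter> Q'" "{b\<in>B. \<beta> b = (False,False)} = B - (Q \<union> Q')"
    using PQ by (auto simp: \<alpha>_def \<beta>_def)
  have un: "card (P \<union> P') = card (Q \<union> Q')"
    using card_Un_Int[OF fin(1,2)] card_Un_Int[OF fin(3,4)] True PQ by simp
  have eqs: "card {a\<in>A. \<alpha> a = c} = card {b\<in>B. \<beta> b = c}" for c
  proof -
    have "c \<in> {(True,True),(True,False),(False,True),(False,False)}" by (cases c) auto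
    then show ?thesis using e True PQ A fin un
      by (elim insertE) (simp_all add: card_Diff_subset)
  qed
  have U: "(UNIV :: (bool \<times> bool) set) = {(True,True),(True,False),(False,True),(False,False)}" by auto
  have "{f \<in> A \<rightarrow>\<^sub>E B. bij_betw f A B \<and> f ` P = Q \<and> f ` P' = Q'} = {f \<in> A \<rightarrow>\<^sub>E B. bij_betw f A B \<and> (\<forall>a\<in>A. \<beta> (f a) = \<alpha> a)}"
  proof (rule Collect_cong, rule conj_cong[OF refl], rule conj_cong[OF refl])
    fix f assume "bij_betw f A B"
    then show "(f ` P = Q \<and> f ` P' = Q') = (\<forall>a\<in>A. \<beta> (f a) = \<alpha> a)"
      unfolding bij_betw_image_eq_iff[OF \<open>bij_betw f A B\<close> PQ(1,2)] bij_betw_image_eq_iff[OF \<open>bij_betw f A B\<close> PQ(4,5)]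
      by (auto simp: \<alpha>_def \<beta>_def)
  qed
  also have "card \<dots> = (\<Prod>c\<in>UNIV. fact (card {a\<in>A. \<alpha> a = c}))"
    by (rule card_coloured_bijections) (use A eqs in auto)
  also have "\<dots> = fact (card (P \<inter> P')) * fact (card P - card (P \<inter> P')) * fact (card P' - card (P \<inter> P')) * fact (card A - card (P \<union> P'))"
    unfolding U using e fin PQ A by (simp add: card_Diff_subset mult.assoc)
  finally show ?thesis using True by simp
qed

text \<open>A set with trace \<tau> on J is \<tau> together with \<open>r - card \<tau>\<close>
  elements outside J. It is applied with J the variables of some cycles, and with J a second
  assignment.\<close>

lemma sum_subsets_by_trace:
  fixes G :: "'a set \<Rightarrow> real"
  assumes U: "finite U" "J \<subseteq> U" "card J \<le> r"
  shows "(\<Sum>T | T \<subseteq> U \<and> card T = r. G (T \<inter> J)) = (\<Sum>\<tau>\<in>Pow J. real ((card U - card J) choose (r - card \<tau>)) * G \<tau>)"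
proof -
  have fJ: "finite J" using U finite_subset by auto
  have fin: "finite {T. T \<subseteq> U \<and> card T = r}" using U by simp
  have cnt: "card {T. T \<subseteq> U \<and> card T = r \<and> T \<inter> J = \<tau>} = (card U - card J) choose (r - card \<tau>)" if \<tau>: "\<tau> \<subseteq> J" for \<tau>
  proof -
    have f\<tau>: "finite \<tau>" using \<tau> fJ finite_subset by auto
    have c\<tau>: "card \<tau> \<le> r" using \<tau> fJ U card_mono le_trans by metis
    have "bij_betw (\<lambda>R. R \<union> \<tau>) {R. R \<subseteq> U - J \<and> card R = r - card \<tau>} {T. T \<subseteq> U \<and> card T = r \<and> T \<inter> J = \<tau>}"
    proof (rule bij_betw_byWitness[where f' = "\<lambda>T. T - J"])
      show "\<forall>a\<in>{R. R \<subseteq> U - J \<and> card R = r - card \<tau>}. a \<union> \<tau> - J = a" using \<tau> by auto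
      show "\<forall>a'\<in>{T. T \<subseteq> U \<and> card T = r \<and> T \<inter> J = \<tau>}. a' - J \<union> \<tau> = a'" by auto
      show "(\<lambda>R. R \<union> \<tau>) ` {R. R \<subseteq> U - J \<and> card R = r - card \<tau>} \<subseteq> {T. T \<subseteq> U \<and> card T = r \<and> T \<inter> J = \<tau>}"
      proof clarify
        fix R assume R: "R \<subseteq> U - J" "card R = r - card \<tau>"
        have fR: "finite R" using R U finite_subset by blast
        have "R \<inter> \<tau> = {}" using R \<tau> by auto
        then have "card (R \<union> \<tau>) = r" using R c\<tau> fR f\<tau> by (simp add: card_Un_disjoint)
        then show "R \<union> \<tau> \<subseteq> U \<and> card (R \<union> \<tau>) = r \<and> (R \<union> \<tau>) \<inter> J = \<tau>" using R \<tau> U by auto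
      qed
      show "(\<lambda>T. T - J) ` {T. T \<subseteq> U \<and> card T = r \<and> T \<inter> J = \<tau>} \<subseteq> {R. R \<subseteq> U - J \<and> card R = r - card \<tau>}"
      proof clarify
        fix T assume T: "T \<subseteq> U" "r = card T" "\<tau> = T \<inter> J"
        have "finite T" using T U finite_subset by blast
        then show "T - J \<subseteq> U - J \<and> card (T - J) = card T - card (T \<inter> J)" using T by (auto simp: card_Diff_subset_Int fJ)
      qed
    qed
    then have "card {T. T \<subseteq> U \<and> card T = r \<and> T \<inter> J = \<tau>} = card {R. R \<subseteq> U - J \<and> card R = r - card \<tau>}"
      using bij_betw_same_card by fastforce
    also have "\<dots> = (card U - card J) choose (r - card \<tau>)"
      using U fJ by (subst n_subsets) (auto simp: card_Diff_subset)
    finally show ?thesis .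
  qed
  have "(\<Sum>T | T \<subseteq> U \<and> card T = r. G (T \<inter> J)) = (\<Sum>\<tau>\<in>Pow J. \<Sum>T\<in>{T\<in>{T. T \<subseteq> U \<and> card T = r}. T \<inter> J = \<tau>}. G (T \<inter> J))"
    using fJ fin by (intro sum.group[symmetric]) auto
  also have "\<dots> = (\<Sum>\<tau>\<in>Pow J. real (card {T. T \<subseteq> U \<and> card T = r \<and> T \<inter> J = \<tau>}) * G \<tau>)"
    by (intro sum.cong) (auto simp: conj_ac)
  finally show ?thesis using cnt by simp
qed

lemma sum_Pow_by_card:
  fixes g :: "nat \<Rightarrow> real"
  assumes "finite J"
  shows "(\<Sum>\<tau>\<in>Pow J. g (card \<tau>)) = (\<Sum>t\<le>card J. real (card J choose t) * g t)"
proof -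
  have "(\<Sum>\<tau>\<in>Pow J. g (card \<tau>)) = (\<Sum>t\<in>{..card J}. \<Sum>\<tau>\<in>{\<tau>\<in>Pow J. card \<tau> = t}. g (card \<tau>))"
    using assms by (intro sum.group[symmetric]) (auto intro: card_mono)
  also have "\<dots> = (\<Sum>t\<le>card J. real (card {\<tau>. \<tau> \<subseteq> J \<and> card \<tau> = t}) * g t)"
    by (intro sum.cong) auto
  also have "\<dots> = (\<Sum>t\<le>card J. real (card J choose t) * g t)"
    using assms by (simp add: n_subsets)
  finally show ?thesis .
qed

text \<open>Once the set of agreement is chosen, \<open>k - 1\<close> values remain at every other
  place. This is the source of the power of \<open>k - 1\<close> in
  \<open>overlap_term\<close>.\<close>

lemma card_agreement:
  assumes h: "h \<in> {..<m} \<rightarrow>\<^sub>E {..<k::nat}"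
  shows "card {h' \<in> {..<m} \<rightarrow>\<^sub>E {..<k}. card {c. c < m \<and> h c = h' c} = j} = (m choose j) * (k - 1) ^ (m - j)"
proof -
  let ?E = "{..<m} \<rightarrow>\<^sub>E {..<k}"
  let ?J = "{J. J \<subseteq> {..<m} \<and> card J = j}"
  define ag where "ag h' = {c. c < m \<and> h c = h' c}" for h'
  have ag: "ag h' \<subseteq> {..<m}" for h' by (auto simp: ag_def)
  have fE: "finite ?E" by (intro finite_PiE) auto
  have hk: "h c < k" if "c < m" for c using PiE_mem[OF h, of c] that by simp
  have "{h' \<in> ?E. card (ag h') = j} = (\<Union>J\<in>?J. {h' \<in> ?E. ag h' = J})"
    using ag by blast
  also have "card \<dots> = (\<Sum>J\<in>?J. card {h' \<in> ?E. ag h' = J})"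
    using fE by (intro card_UN_disjoint) auto
  also have "\<dots> = (\<Sum>J\<in>?J. (k - 1) ^ (m - j))"
  proof (rule sum.cong[OF refl])
    fix J assume J: "J \<in> ?J"
    define D where "D c = (if c \<in> J then {h c} else {..<k} - {h c})" for c
    have "{h' \<in> ?E. ag h' = J} = PiE {..<m} D"
    proof (rule set_eqI, rule iffI)
      fix h' assume a: "h' \<in> PiE {..<m} D"
      have D: "h' c \<in> D c" if "c < m" for c using PiE_mem[OF a, of c] that by simp
      have "h' \<in> ?E"
      proof (rule PiE_I)
        show "h' c \<in> {..<k}" if "c \<in> {..<m}" for c
          using D[of c] hk[of c] that by (cases "c \<in> J") (auto simp: D_def)
        show "h' c = undefined" if "c \<notin> {..<m}" for c using PiE_arb[OF a that] .
      qed
      moreover have "c \<in> ag h' \<longleftrightarrow> c \<in> J" for c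
        using D[of c] J by (cases "c \<in> J") (auto simp: D_def ag_def)
      ultimately show "h' \<in> {h' \<in> ?E. ag h' = J}" by blast
    next
      fix h' assume "h' \<in> {h' \<in> ?E. ag h' = J}"
      then have a: "h' \<in> ?E" and agJ: "ag h' = J" by auto
      show "h' \<in> PiE {..<m} D"
      proof (rule PiE_I)
        show "h' c \<in> D c" if "c \<in> {..<m}" for c
          using PiE_mem[OF a that] that unfolding D_def agJ[symmetric] ag_def by auto
        show "h' c = undefined" if "c \<notin> {..<m}" for c using PiE_arb[OF a that] .
      qed
    qed
    then have "card {h' \<in> ?E. ag h' = J} = (\<Prod>c<m. card (D c))"
      by (simp add: card_PiE)
    also have "\<dots> = (\<Prod>c<m. if c \<in> J then 1 else k - 1)"
      using hk by (intro prod.cong) (auto simp: D_def)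
    also have "\<dots> = (\<Prod>c\<in>{..<m} - J. k - 1)"
      by (intro prod.mono_neutral_cong_right) auto
    also have "\<dots> = (k - 1) ^ (m - j)"
      using J by (auto simp: card_Diff_subset finite_subset)
    finally show "card {h' \<in> ?E. ag h' = J} = (k - 1) ^ (m - j)" .
  qed
  also have "\<dots> = (m choose j) * (k - 1) ^ (m - j)" by (simp add: n_subsets)
  finally show ?thesis by (simp only: ag_def)
qed

section \<open>Moments of the number of satisfying assignments\<close>

text \<open>F, R, A, T, U, Y stand for the factorials of \<open>k * r\<close>, r,
  \<open>(k - 1) * r\<close>, t, \<open>r - t\<close> and \<open>(k - 2) * r + t\<close>; NN, M, DA,
  DT, DU, DY for those of d times these numbers, in the order F, R, A, T, U, Y; p and q for the
  powers of k and \<open>k - 1\<close>. The square on the right is that of the first moment.\<close>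

lemma moment_quotient_cancel:
  fixes F R A T U Y M DT DU DY NN DA p q :: real
  assumes "F \<noteq> 0" "R \<noteq> 0" "A \<noteq> 0" "T \<noteq> 0" "U \<noteq> 0" "Y \<noteq> 0" "M \<noteq> 0" "DT \<noteq> 0" "DU \<noteq> 0" "DY \<noteq> 0" "NN \<noteq> 0" "DA \<noteq> 0" "p \<noteq> 0"
  shows "F / (R * A) * (R / (T * U) * (A / (U * Y) * (p * (M / (DT * DU) * q) * (DT * DU * DU * DY)))) / NN
    = (F / (R * A) * M * DA * p / NN)\<^sup>2 * (R\<^sup>2 * A\<^sup>2 / (T * U\<^sup>2 * Y * F) * (DU * DY * NN / (M * DA\<^sup>2)) * (q / p))"
proof -
  have "F / (R * A) * (R / (T * U) * (A / (U * Y) * (p * (M / (DT * DU) * q) * (DT * DU * DU * DY)))) / NN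
     = F * p * M * q * DU * DY / (T * U\<^sup>2 * Y * NN)"
    using assms by (simp add: power2_eq_square mult_ac)
  also have "\<dots> = (F / (R * A) * M * DA * p / NN)\<^sup>2 * (R\<^sup>2 * A\<^sup>2 / (T * U\<^sup>2 * Y * F) * (DU * DY * NN / (M * DA\<^sup>2)) * (q / p))"
    using assms by (simp add: power2_eq_square mult_ac)
  finally show ?thesis .
qed

section \<open>The model with k r variables and d r clauses\<close>

locale exact_cover =
  fixes d k :: nat
  assumes d_pos: "0 < d" and k_gt_2: "2 < k"
begin

definition VC :: "nat \<Rightarrow> (nat \<times> nat) set" where "VC r = {..<k*r} \<times> {..<d}"
definition CC :: "nat \<Rightarrow> (nat \<times> nat) set" where "CC r = {..<d*r} \<times> {..<k}"
definition Om :: "nat \<Rightarrow> (nat \<times> nat \<Rightarrow> nat \<times> nat) set" where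
  "Om r = {f \<in> VC r \<rightarrow>\<^sub>E CC r. bij_betw f (VC r) (CC r)}"
definition N :: "nat \<Rightarrow> nat" where "N r = d * (k * r)"
definition lift :: "nat set \<Rightarrow> (nat \<times> nat) set" where "lift T = T \<times> {..<d}"
text \<open>A satisfying assignment meets every clause in exactly one of its k copies. Such an h
  records which copy of each clause this is, and \<open>transversal\<close> collects these copies;
  fixing h besides T turns satisfaction into a condition on the image of one set under the
  matching.\<close>

definition choices :: "nat \<Rightarrow> (nat \<Rightarrow> nat) set" where "choices r = {..<d*r} \<rightarrow>\<^sub>E {..<k}"
definition transversal :: "nat \<Rightarrow> (nat \<Rightarrow> nat) \<Rightarrow> (nat \<times> nat) set" where
  "transversal r h = (\<lambda>c. (c, h c)) ` {..<d*r}"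
definition X :: "nat \<Rightarrow> (nat \<times> nat \<Rightarrow> nat \<times> nat) \<Rightarrow> real" where
  "X r f = real (card {T. satisfying_assignment (k*r) d k f T})"
text \<open>The mean over a uniform matching as a finite sum; \<open>fact (N r)\<close> is the
  number of matchings, see \<open>card_Om\<close>.\<close>

definition E :: "nat \<Rightarrow> ((nat \<times> nat \<Rightarrow> nat \<times> nat) \<Rightarrow> real) \<Rightarrow> real" where
  "E r g = (\<Sum>f\<in>Om r. g f) / fact (N r)"
definition extends :: "((nat \<times> nat) \<times> (nat \<times> nat)) set \<Rightarrow> (nat \<times> nat \<Rightarrow> nat \<times> nat) \<Rightarrow> bool" where
  "extends S f \<longleftrightarrow> (\<forall>(p,q)\<in>S. f p = q)"

lemma num_clauses_eq: "num_clauses (k*r) d k = d*r"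
proof -
  have "d * (k * r) = k * (d * r)" by (simp add: mult_ac)
  then show ?thesis using k_gt_2 by (simp add: num_clauses_def)
qed

lemma matchings_eq: "matchings (k*r) d k = Om r"
  by (simp add: matchings_def Om_def VC_def CC_def var_copies_def clause_copies_def num_clauses_eq)

lemma finite_VC [simp]: "finite (VC r)" and finite_CC [simp]: "finite (CC r)"
  by (simp_all add: VC_def CC_def)

lemma card_VC: "card (VC r) = N r" and card_CC: "card (CC r) = N r"
  by (simp_all add: VC_def CC_def N_def)

lemma card_VC_CC: "card (VC r) = card (CC r)"
  by (simp add: card_VC card_CC)

lemma finite_Om [simp]: "finite (Om r)"
  unfolding Om_def by (rule finite_subset[OF _ finite_PiE[of "VC r" "\<lambda>_. CC r"]]) auto

lemma finite_choices [simp]: "finite (choices r)"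
  unfolding choices_def by (rule finite_PiE) auto

lemma transversal_subset: "h \<in> choices r \<Longrightarrow> transversal r h \<subseteq> CC r"
  by (auto simp: choices_def transversal_def CC_def)

lemma card_transversal: "card (transversal r h) = d * r"
  unfolding transversal_def by (subst card_image) (auto simp: inj_on_def)

lemma mem_transversal: "c < d * r \<Longrightarrow> (c, b) \<in> transversal r h \<longleftrightarrow> b = h c"
  by (auto simp: transversal_def)

lemma transversal_inj:
  assumes "h \<in> choices r" "h' \<in> choices r" "transversal r h = transversal r h'"
  shows "h = h'"
proof (rule PiE_ext[OF assms(1,2)[unfolded choices_def]])
  fix c assume "c \<in> {..<d*r}"
  then have c: "c < d*r" by simp
  have "(c, h c) \<in> transversal r h'" using mem_transversal[OF c, of "h c" h] assms(3) by simp
  then show "h c = h' c" using mem_transversal[OF c] by simp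
qed

text \<open>\<open>h c\<close> is read off from the unique copy of a true variable that is matched
  into the clause c. The right-hand side is of the kind that the counts of bijections can
  handle.\<close>

lemma satisfying_iff:
  assumes f: "f \<in> Om r"
  shows "satisfying_assignment (k*r) d k f T \<longleftrightarrow> T \<subseteq> {..<k*r} \<and> (\<exists>h\<in>choices r. f ` lift T = transversal r h)"
proof (intro iffI conjI)
  assume "satisfying_assignment (k*r) d k f T"
  then have T: "T \<subseteq> {..<k*r}" and ex: "\<And>c. c < d*r \<Longrightarrow> \<exists>!p. p \<in> lift T \<and> fst (f p) = c"
    by (auto simp: satisfying_assignment_def num_clauses_eq lift_def)
  show "T \<subseteq> {..<k*r}" by (fact T)
  have fCC: "f p \<in> CC r" if "p \<in> lift T" for p
    using f that T by (auto simp: Om_def VC_def lift_def)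
  define h where "h = (\<lambda>c\<in>{..<d*r}. snd (f (THE p. p \<in> lift T \<and> fst (f p) = c)))"
  have h: "f p = (fst (f p), h (fst (f p)))" "fst (f p) < d * r" if p: "p \<in> lift T" for p
  proof -
    show c: "fst (f p) < d * r" using fCC[OF p] by (auto simp: CC_def)
    have "(THE p'. p' \<in> lift T \<and> fst (f p') = fst (f p)) = p"
      using ex[OF c] p by (intro the1_equality) auto
    then show "f p = (fst (f p), h (fst (f p)))" using c by (simp add: h_def)
  qed
  have "f ` lift T = transversal r h"
  proof
    show "f ` lift T \<subseteq> transversal r h"
    proof
      fix q assume "q \<in> f ` lift T"
      then obtain p where p: "p \<in> lift T" "q = f p" by blast
      show "q \<in> transversal r h"
        unfolding transversal_def p(2) by (rule image_eqI[of _ _ "fst (f p)"]) (use h(1)[OF p(1)] h(2)[OF p(1)] in auto)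
    qed
    show "transversal r h \<subseteq> f ` lift T"
    proof
      fix q assume "q \<in> transversal r h"
      then obtain c where c: "c < d*r" "q = (c, h c)" by (auto simp: transversal_def)
      obtain p where "p \<in> lift T" "fst (f p) = c" using ex[OF c(1)] by blast
      then show "q \<in> f ` lift T" using h(1)[of p] c by force
    qed
  qed
  moreover have "h \<in> choices r"
    unfolding choices_def
  proof (rule PiE_I)
    fix c assume c: "c \<in> {..<d*r}"
    obtain p where p: "p \<in> lift T" "fst (f p) = c" using ex c by blast
    have "(c, h c) = f p" using h(1)[OF p(1)] p by simp
    then show "h c \<in> {..<k}" using fCC[OF p(1)] by (metis CC_def mem_Sigma_iff)
  qed (simp add: h_def)
  ultimately show "\<exists>h\<in>choices r. f ` lift T = transversal r h" by blast
next
  assume a: "T \<subseteq> {..<k*r} \<and> (\<exists>h\<in>choices r. f ` lift T = transversal r h)"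
  then obtain h where h: "h \<in> choices r" "f ` lift T = transversal r h" by blast
  have inj: "inj_on f (VC r)" using f by (simp add: Om_def bij_betw_def)
  have sub: "lift T \<subseteq> VC r" using a by (auto simp: lift_def VC_def)
  have "\<exists>!p. p \<in> lift T \<and> fst (f p) = c" if c: "c < d * r" for c
  proof -
    have "(c, h c) \<in> f ` lift T" using h c by (simp add: mem_transversal)
    then obtain p where p: "p \<in> lift T" "f p = (c, h c)" by force
    show ?thesis
    proof (rule ex1I[of _ p])
      show "p \<in> lift T \<and> fst (f p) = c" using p by simp
      fix p' assume p': "p' \<in> lift T \<and> fst (f p') = c"
      then have "f p' \<in> transversal r h" using h by blast
      then have "f p' = f p" using p p' by (auto simp: transversal_def)
      then show "p' = p" using inj p p' sub by (metis inj_onD subsetD)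
    qed
  qed
  then show "satisfying_assignment (k*r) d k f T"
    using a by (simp add: satisfying_assignment_def num_clauses_eq lift_def)
qed

lemma card_lift: "card (lift T) = card T * d"
  by (simp add: lift_def card_cartesian_product)

lemma card_image_lift:
  assumes "f \<in> Om r" "T \<subseteq> {..<k*r}" shows "card (f ` lift T) = card T * d"
proof -
  have "inj_on f (VC r)" using assms by (simp add: Om_def bij_betw_def)
  moreover have "lift T \<subseteq> VC r" using assms by (auto simp: lift_def VC_def)
  ultimately show ?thesis using card_lift card_image inj_on_subset by metis
qed

abbreviation rsets :: "nat \<Rightarrow> nat set set" where
  "rsets r \<equiv> {T. T \<subseteq> {..<k*r} \<and> card T = r}"

text \<open>Comparing cardinalities, \<open>d * card T = d * r\<close> forces
  \<open>card T = r\<close>. Distinct h have distinct transversals, so for given f and T at most one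
  h contributes and no assignment is counted twice.\<close>

lemma X_eq_sum:
  assumes f: "f \<in> Om r"
  shows "X r f = (\<Sum>T\<in>rsets r. \<Sum>h\<in>choices r. of_bool (f ` lift T = transversal r h))"
proof -
  have fin: "finite (rsets r)" by simp
  have "{T. satisfying_assignment (k*r) d k f T} = {T\<in>rsets r. \<exists>h\<in>choices r. f ` lift T = transversal r h}"
    using satisfying_iff[OF f] card_image_lift[OF f] card_transversal d_pos
    by (auto simp: mult.commute) (metis mult.commute mult_left_cancel not_gr_zero)
  then have "X r f = (\<Sum>T\<in>rsets r. of_bool (\<exists>h\<in>choices r. f ` lift T = transversal r h))"
    unfolding X_def using fin by (simp add: sum.inter_filter[symmetric] of_bool_def sum.If_cases Int_def)
  also have "\<dots> = (\<Sum>T\<in>rsets r. \<Sum>h\<in>choices r. of_bool (f ` lift T = transversal r h))"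
  proof (intro sum.cong refl)
    fix T
    show "(of_bool (\<exists>h\<in>choices r. f ` lift T = transversal r h) :: real) = (\<Sum>h\<in>choices r. of_bool (f ` lift T = transversal r h))"
    proof (cases "\<exists>h\<in>choices r. f ` lift T = transversal r h")
      case True
      then obtain h where h: "h \<in> choices r" "f ` lift T = transversal r h" by blast
      have "(\<Sum>h\<in>choices r. of_bool (f ` lift T = transversal r h) :: real) = (\<Sum>h'\<in>choices r. if h' = h then 1 else 0)"
        using h transversal_inj by (intro sum.cong) auto
      then show ?thesis using True h by simp
    next
      case False
      then have "(\<Sum>h\<in>choices r. of_bool (f ` lift T = transversal r h) :: real) = 0"
        by (intro sum.neutral) auto
      then show ?thesis using False by simp
    qed
  qed
  finally show ?thesis .
qed

lemma sum_of_bool_card: "finite A \<Longrightarrow> (\<Sum>x\<in>A. of_bool (P x) :: real) = real (card {x\<in>A. P x})"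
  by (simp add: of_bool_def sum.If_cases Int_def)

text \<open>The number of choices for the true copy of the clause \<open>c\<close> that agree with the prescribed
  edges \<open>S\<close> when \<open>\<tau>\<close> is the set of true variables among those that \<open>S\<close> touches.\<close>

definition allowed :: "((nat \<times> nat) \<times> (nat \<times> nat)) set \<Rightarrow> nat set \<Rightarrow> nat \<Rightarrow> nat" where
  "allowed S \<tau> c = card {b. b < k \<and> (\<forall>p b'. (p, (c, b')) \<in> S \<longrightarrow> (fst p \<in> \<tau> \<longleftrightarrow> b = b'))}"

definition partial_matching :: "nat \<Rightarrow> ((nat \<times> nat) \<times> (nat \<times> nat)) set \<Rightarrow> bool" where
  "partial_matching r S \<longleftrightarrow> S \<subseteq> VC r \<times> CC r \<and> inj_on fst S \<and> inj_on snd S"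

lemma Om_card_extending:
  assumes S: "partial_matching r S"
  shows "card {f \<in> Om r. extends S f} = fact (N r - card S)"
proof -
  have "{f \<in> Om r. extends S f} = {f \<in> VC r \<rightarrow>\<^sub>E CC r. bij_betw f (VC r) (CC r) \<and> (\<forall>(p,q)\<in>S. f p = q) \<and> f ` {} = {}}"
    by (auto simp: Om_def extends_def)
  also have "card \<dots> = fact (N r - card S)"
    using S by (subst card_bijections_extending) (auto simp: partial_matching_def card_VC card_CC)
  finally show ?thesis .
qed

lemma card_Om: "card (Om r) = fact (N r)"
  using Om_card_extending[of r "{}"] by (simp add: partial_matching_def extends_def)

lemma E_extends: "partial_matching r S \<Longrightarrow> E r (\<lambda>f. of_bool (extends S f)) = fact (N r - card S) / fact (N r)"
  unfolding E_def sum_of_bool_card[OF finite_Om] by (simp add: Om_card_extending)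

text \<open>Cycles that meet may ask for two partners of the same copy; such a set of edges occurs
  in no matching.\<close>

lemma not_extends:
  assumes "\<not> partial_matching r S" "f \<in> Om r" "S \<subseteq> VC r \<times> UNIV"
  shows "\<not> extends S f"
proof
  assume a: "extends S f"
  have e: "snd x = f (fst x)" if "x \<in> S" for x using a that by (auto simp: extends_def)
  have inj: "inj_on f (VC r)" and im: "f ` VC r = CC r" using assms by (auto simp: Om_def bij_betw_def)
  have "inj_on fst S" using e by (intro inj_onI) (metis prod.collapse)
  moreover have "inj_on snd S"
  proof (rule inj_onI)
    fix x y assume xy: "x \<in> S" "y \<in> S" "snd x = snd y"
    then have "fst x \<in> VC r" "fst y \<in> VC r" "f (fst x) = f (fst y)" using assms(3) e by auto
    then have "fst x = fst y" using inj by (auto dest: inj_onD)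
    then show "x = y" using xy by (simp add: prod_eq_iff)
  qed
  moreover have "S \<subseteq> VC r \<times> CC r" using assms(3) e im by fastforce
  ultimately show False using assms(1) by (simp add: partial_matching_def)
qed

text \<open>Fix T and its trace \<tau> on J. An h compatible with S has
  \<open>allowed S \<tau> c\<close> choices at a clause c of K and k choices elsewhere. Each
  compatible h admits the same number of matchings, a product of two factorials, because the edges
  of S use \<open>2 * card \<tau>\<close> copies of true variables and the rest are copies of false
  ones. The count depends on T through \<tau> only.\<close>

theorem planted_sum:
  assumes S: "partial_matching r S" and J: "J = (fst \<circ> fst) ` S" "card J \<le> r" and K: "K = (fst \<circ> snd) ` S"
    and two: "\<And>v. v \<in> J \<Longrightarrow> card {e\<in>S. fst (fst e) = v} = 2"
  shows "(\<Sum>f\<in>Om r. X r f * of_bool (extends S f)) =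
    (\<Sum>\<tau>\<in>Pow J. real ((k*r - card J) choose (r - card \<tau>)) *
       (fact (d*r - 2 * card \<tau>) * fact (N r - d*r - (card S - 2 * card \<tau>)) * real k ^ (d*r - card K) * (\<Prod>c\<in>K. real (allowed S \<tau> c))))"
proof -
  have S': "S \<subseteq> VC r \<times> CC r" "inj_on fst S" "inj_on snd S" using S by (auto simp: partial_matching_def)
  have finS: "finite S" by (rule finite_subset[OF S'(1)]) auto
  have finJK: "finite J" "finite K" using finS J K by auto
  have JU: "J \<subseteq> {..<k*r}" using S'(1) J by (auto simp: VC_def)
  have KU: "K \<subseteq> {..<d*r}" using S'(1) K by (auto simp: CC_def)
  define G where "G \<tau> = fact (d*r - 2 * card \<tau>) * fact (N r - d*r - (card S - 2 * card \<tau>)) * real k ^ (d*r - card K) * (\<Prod>c\<in>K. real (allowed S \<tau> c))" for \<tau>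
  have main: "(\<Sum>h\<in>choices r. real (card {f\<in>Om r. extends S f \<and> f ` lift T = transversal r h})) = G (T \<inter> J)" if T: "T \<in> rsets r" for T
  proof -
    define \<tau> where "\<tau> = T \<inter> J"
    have Tr: "T \<subseteq> {..<k*r}" "card T = r" using T by auto
    have f\<tau>: "finite \<tau>" using finJK by (simp add: \<tau>_def)
    have liftT: "lift T \<subseteq> VC r" using T by (auto simp: lift_def VC_def)
    define Hc where "Hc c = {b. b < k \<and> (\<forall>p b'. (p, (c, b')) \<in> S \<longrightarrow> (fst p \<in> T \<longleftrightarrow> b = b'))}" for c
    have Hc: "card (Hc c) = (if c \<in> K then allowed S \<tau> c else k)" for c
    proof (cases "c \<in> K")
      case True
      have "fst p \<in> T \<longleftrightarrow> fst p \<in> \<tau>" if "(p, q) \<in> S" for p q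
        using that J by (force simp: \<tau>_def)
      then have "Hc c = {b. b < k \<and> (\<forall>p b'. (p, (c, b')) \<in> S \<longrightarrow> (fst p \<in> \<tau> \<longleftrightarrow> b = b'))}"
        unfolding Hc_def by blast
      then show ?thesis using True by (simp add: allowed_def)
    next
      case False
      then have "Hc c = {..<k}" using K by (force simp: Hc_def)
      then show ?thesis using False by simp
    qed
    define compat where "compat h \<longleftrightarrow> (\<forall>(p,q)\<in>S. p \<in> lift T \<longleftrightarrow> q \<in> transversal r h)" for h
    have memS: "p \<in> lift T \<longleftrightarrow> fst p \<in> T" "fst q < d*r" "snd q < k" if "(p,q) \<in> S" for p q
      using that S'(1) by (auto simp: lift_def VC_def CC_def)
    have cH: "{h\<in>choices r. compat h} = PiE {..<d*r} Hc"
    proof (rule set_eqI, rule iffI)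
      fix h assume "h \<in> {h\<in>choices r. compat h}"
      then have h: "h \<in> choices r" "compat h" by auto
      show "h \<in> PiE {..<d*r} Hc"
      proof (rule PiE_I)
        fix c assume c: "c \<in> {..<d*r}"
        have "h c < k" using PiE_mem[OF h(1)[unfolded choices_def] c] by simp
        moreover have "fst p \<in> T \<longleftrightarrow> h c = b'" if "(p, (c,b')) \<in> S" for p b'
          using h(2) that memS(1)[OF that] c mem_transversal[of c r b' h] by (auto simp: compat_def)
        ultimately show "h c \<in> Hc c" by (auto simp: Hc_def)
      qed (use PiE_arb[OF h(1)[unfolded choices_def]] in blast)
    next
      fix h assume h: "h \<in> PiE {..<d*r} Hc"
      have "h \<in> choices r" unfolding choices_def
      proof (rule PiE_I)
        show "h c \<in> {..<k}" if "c \<in> {..<d*r}" for c using PiE_mem[OF h that] by (simp add: Hc_def)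
      qed (use PiE_arb[OF h] in blast)
      moreover have "compat h" unfolding compat_def
      proof clarify
        fix v a c b assume e: "((v,a),(c,b)) \<in> S"
        have c: "c < d*r" using memS(2)[OF e] by simp
        then have "h c \<in> Hc c" using PiE_mem[OF h] by simp
        then have "v \<in> T \<longleftrightarrow> h c = b" using e by (auto simp: Hc_def)
        then show "((v,a) \<in> lift T) = ((c,b) \<in> transversal r h)" using memS(1)[OF e] mem_transversal[OF c] by auto
      qed
      ultimately show "h \<in> {h\<in>choices r. compat h}" by simp
    qed
    have cardc: "real (card {h\<in>choices r. compat h}) = real k ^ (d*r - card K) * (\<Prod>c\<in>K. real (allowed S \<tau> c))"
    proof -
      have "card {h\<in>choices r. compat h} = (\<Prod>c<d*r. if c \<in> K then allowed S \<tau> c else k)"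
        unfolding cH by (simp add: card_PiE Hc)
      also have "\<dots> = (\<Prod>c\<in>K. allowed S \<tau> c) * (\<Prod>c\<in>{..<d*r} - K. k)"
        using KU by (subst prod.subset_diff[OF KU]) (auto intro!: arg_cong2[where f="(*)"] prod.cong)
      also have "(\<Prod>c\<in>{..<d*r} - K. k) = k ^ (d*r - card K)"
        using KU finJK by (simp add: card_Diff_subset)
      finally show ?thesis by simp
    qed
    \<comment> \<open>Each variable of J carries exactly two edges of S.\<close>
    have e1: "card {e\<in>S. fst e \<in> lift T} = 2 * card \<tau>"
    proof -
      have "{e\<in>S. fst e \<in> lift T} = (\<Union>v\<in>\<tau>. {e\<in>S. fst (fst e) = v})"
      proof -
        have "fst e \<in> lift T \<longleftrightarrow> fst (fst e) \<in> \<tau>" if "e \<in> S" for e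
        proof -
          have "fst (fst e) \<in> J" using that J by (metis comp_apply imageI)
          then show ?thesis using memS(1)[of "fst e" "snd e"] that by (simp add: \<tau>_def)
        qed
        then show ?thesis by blast
      qed
      also have "card \<dots> = (\<Sum>v\<in>\<tau>. card {e\<in>S. fst (fst e) = v})"
        using f\<tau> finS by (intro card_UN_disjoint) auto
      also have "\<dots> = (\<Sum>v\<in>\<tau>. 2)" using two by (intro sum.cong) (auto simp: \<tau>_def)
      finally show ?thesis by simp
    qed
    have e0: "card {e\<in>S. fst e \<notin> lift T} = card S - 2 * card \<tau>"
    proof -
      have "{e\<in>S. fst e \<notin> lift T} = S - {e\<in>S. fst e \<in> lift T}" by auto
      then show ?thesis using e1 finS by (simp add: card_Diff_subset)
    qed
    have card1: "card {f\<in>Om r. extends S f \<and> f ` lift T = transversal r h} =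
       (if compat h then fact (d*r - 2 * card \<tau>) * fact (N r - d*r - (card S - 2 * card \<tau>)) else 0)" if h: "h \<in> choices r" for h
    proof (cases "compat h")
      case True
      have cl: "card (lift T) = d * r" using Tr by (simp add: card_lift mult.commute)
      have "{f\<in>Om r. extends S f \<and> f ` lift T = transversal r h} =
        {f \<in> VC r \<rightarrow>\<^sub>E CC r. bij_betw f (VC r) (CC r) \<and> (\<forall>(p,q)\<in>S. f p = q) \<and> f ` lift T = transversal r h}"
        by (auto simp: Om_def extends_def)
      also have "card \<dots> = fact (card (lift T) - card {e\<in>S. fst e \<in> lift T}) * fact (card (VC r) - card (lift T) - card {e\<in>S. fst e \<notin> lift T})"
        by (rule card_bijections_extending)
           (use S' liftT transversal_subset[OF h] cl card_transversal card_VC_CC True in \<open>auto simp: compat_def\<close>)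
      finally show ?thesis using True by (simp add: e1 e0 cl card_VC)
    next
      case False
      then obtain p q where pq: "(p,q) \<in> S" "(p \<in> lift T) \<noteq> (q \<in> transversal r h)" by (auto simp: compat_def)
      have pV: "p \<in> VC r" using pq S' by auto
      have "\<not> (extends S f \<and> f ` lift T = transversal r h)" if f: "f \<in> Om r" for f
      proof
        assume a: "extends S f \<and> f ` lift T = transversal r h"
        have "bij_betw f (VC r) (CC r)" using f by (simp add: Om_def)
        then have "f p \<in> transversal r h \<longleftrightarrow> p \<in> lift T"
          using bij_betw_image_eq_iff[OF _ liftT transversal_subset[OF h]] a pV by blast
        moreover have "f p = q" using a pq by (auto simp: extends_def)
        ultimately show False using pq by auto
      qed
      then have "{f\<in>Om r. extends S f \<and> f ` lift T = transversal r h} = {}" by blast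
      then show ?thesis using False by (metis card.empty)
    qed
    have "(\<Sum>h\<in>choices r. real (card {f\<in>Om r. extends S f \<and> f ` lift T = transversal r h})) =
      (\<Sum>h\<in>choices r. of_bool (compat h) * (fact (d*r - 2 * card \<tau>) * fact (N r - d*r - (card S - 2 * card \<tau>))))"
      by (intro sum.cong refl) (auto simp: card1)
    also have "\<dots> = G \<tau>"
      unfolding sum_distrib_right[symmetric] sum_of_bool_card[OF finite_choices] cardc by (simp add: G_def)
    finally show ?thesis by (simp add: \<tau>_def)
  qed
  have "(\<Sum>f\<in>Om r. X r f * of_bool (extends S f)) =
     (\<Sum>f\<in>Om r. \<Sum>T\<in>rsets r. \<Sum>h\<in>choices r. of_bool (f ` lift T = transversal r h \<and> extends S f))"
    by (intro sum.cong refl) (simp only: X_eq_sum sum_distrib_right of_bool_conj)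
  also have "\<dots> = (\<Sum>f\<in>Om r. \<Sum>T\<in>rsets r. \<Sum>h\<in>choices r. of_bool (extends S f \<and> f ` lift T = transversal r h))"
    by (simp only: conj_commute)
  also have "\<dots> = (\<Sum>T\<in>rsets r. \<Sum>h\<in>choices r. \<Sum>f\<in>Om r. of_bool (extends S f \<and> f ` lift T = transversal r h))"
    by (subst sum.swap, rule sum.cong[OF refl], rule sum.swap)
  also have "\<dots> = (\<Sum>T\<in>rsets r. \<Sum>h\<in>choices r. real (card {f\<in>Om r. extends S f \<and> f ` lift T = transversal r h}))"
    by (simp only: sum_of_bool_card[OF finite_Om])
  also have "\<dots> = (\<Sum>T\<in>rsets r. G (T \<inter> J))" by (intro sum.cong refl main)
  also have "\<dots> = (\<Sum>\<tau>\<in>Pow J. real ((card {..<k*r} - card J) choose (r - card \<tau>)) * G \<tau>)"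
    by (rule sum_subsets_by_trace) (use JU J in auto)
  finally show ?thesis by (simp add: G_def)
qed

theorem first_moment:
  "E r (X r) = real ((k*r) choose r) * fact (d*r) * fact (N r - d*r) * real k ^ (d*r) / fact (N r)"
proof -
  have pm: "partial_matching r {}" by (simp add: partial_matching_def)
  have ext: "extends {} f" for f by (simp add: extends_def)
  have "(\<Sum>f\<in>Om r. X r f) = (\<Sum>f\<in>Om r. X r f * of_bool (extends {} f))"
    by (intro sum.cong refl) (simp only: ext of_bool_eq mult_1_right)
  also have "\<dots> = (\<Sum>\<tau>\<in>Pow {}. real ((k*r - card ({}::nat set)) choose (r - card \<tau>)) *
       (fact (d*r - 2 * card \<tau>) * fact (N r - d*r - (card ({}::((nat\<times>nat)\<times>nat\<times>nat) set) - 2 * card \<tau>)) * real k ^ (d*r - card ({}::nat set)) * (\<Prod>c\<in>{}. real (allowed {} \<tau> c))))"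
    by (rule planted_sum[OF pm]) simp_all
  also have "\<dots> = real ((k*r) choose r) * (fact (d*r) * fact (N r - d*r) * real k ^ (d*r))"
    by simp
  finally show ?thesis unfolding E_def by (simp only: mult.assoc)
qed

text \<open>Two pairs (T, h) and (T', h') occur in a common matching only if the copies shared by
  the assignments are as many as the clauses in which h and h' agree. The sum over h' is therefore a
  count of agreements, and what remains depends only on the size t of the intersection of T and
  T'.\<close>

theorem second_moment:
  assumes r: "r > 0"
  shows "E r (\<lambda>f. (X r f)\<^sup>2) = (E r (X r))\<^sup>2 * (\<Sum>t\<le>r. overlap_term d k r t)"
proof -
  \<comment> \<open>\<open>W t\<close> counts the matchings for a compatible quadruple T, h, T', h'
    with overlap t; \<open>A t\<close> counts the h' that agree with a given h in exactly
    \<open>d * t\<close> clauses.\<close>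
  define W :: "nat \<Rightarrow> real" where "W t = fact (d*t) * fact (d*r - d*t) * fact (d*r - d*t) * fact (N r - (2*d*r - d*t))" for t
  define A where "A t = real ((d*r) choose (d*t)) * real (k-1) ^ (d*r - d*t)" for t
  have fin: "finite (rsets r)" by simp
  have cT: "card (lift T \<inter> lift T') = d * card (T \<inter> T')" for T T'
    by (simp add: lift_def card_cartesian_product flip: Sigma_Int_distrib1)
       (simp add: Int_commute Times_Int_distrib1[symmetric] card_cartesian_product mult.commute)?
  have agree: "card (transversal r h \<inter> transversal r h') = card {c. c < d*r \<and> h c = h' c}" for h h'
  proof -
    have "transversal r h \<inter> transversal r h' = (\<lambda>c. (c, h c)) ` {c. c < d*r \<and> h c = h' c}"
      by (auto simp: transversal_def)
    then show ?thesis by (simp add: card_image inj_on_def)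
  qed
  have inner: "(\<Sum>h\<in>choices r. \<Sum>h'\<in>choices r. real (card {f\<in>Om r. f ` lift T = transversal r h \<and> f ` lift T' = transversal r h'}))
      = real k ^ (d*r) * A (card (T \<inter> T')) * W (card (T \<inter> T'))" if T: "T \<in> rsets r" "T' \<in> rsets r" for T T'
  proof -
    define t where "t = card (T \<inter> T')"
    have Tr: "T \<subseteq> {..<k*r}" "card T = r" "T' \<subseteq> {..<k*r}" "card T' = r" using T by auto
    have l: "lift T \<subseteq> VC r" "lift T' \<subseteq> VC r" using T by (auto simp: lift_def VC_def)
    have cl: "card (lift T) = d*r" "card (lift T') = d*r" using Tr by (auto simp: card_lift mult.commute)
    have cU: "card (lift T \<union> lift T') = 2*d*r - d*t"
      using card_Un_Int[of "lift T" "lift T'"] cl cT[of T T'] l finite_subset[OF _ finite_VC] by (simp add: t_def)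
    have c2: "real (card {f\<in>Om r. f ` lift T = transversal r h \<and> f ` lift T' = transversal r h'}) =
       of_bool (card {c. c < d*r \<and> h c = h' c} = d*t) * W t" if h: "h \<in> choices r" "h' \<in> choices r" for h h'
    proof -
      have "{f\<in>Om r. f ` lift T = transversal r h \<and> f ` lift T' = transversal r h'} =
         {f \<in> VC r \<rightarrow>\<^sub>E CC r. bij_betw f (VC r) (CC r) \<and> f ` lift T = transversal r h \<and> f ` lift T' = transversal r h'}"
        by (auto simp: Om_def)
      then show ?thesis
        using card_bijections_two_images[OF finite_VC finite_CC card_VC_CC l(1) transversal_subset[OF h(1)] _ l(2) transversal_subset[OF h(2)]]
        by (auto simp: cl card_transversal cT agree cU t_def[symmetric] W_def card_VC)
    qed
    have "(\<Sum>h\<in>choices r. \<Sum>h'\<in>choices r. real (card {f\<in>Om r. f ` lift T = transversal r h \<and> f ` lift T' = transversal r h'}))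
      = (\<Sum>h\<in>choices r. (\<Sum>h'\<in>choices r. of_bool (card {c. c < d*r \<and> h c = h' c} = d*t)) * W t)"
      unfolding sum_distrib_right by (intro sum.cong refl c2)
    also have "\<dots> = (\<Sum>h\<in>choices r. A t * W t)"
      by (intro sum.cong refl, subst sum_of_bool_card) (auto simp: choices_def card_agreement A_def intro: finite_PiE)
    also have "\<dots> = real k ^ (d*r) * A t * W t"
      by (simp add: choices_def card_PiE mult.assoc)
    finally show ?thesis by (simp add: t_def)
  qed
  have "(\<Sum>f\<in>Om r. (X r f)\<^sup>2) = (\<Sum>f\<in>Om r. \<Sum>T\<in>rsets r. \<Sum>T'\<in>rsets r. \<Sum>h\<in>choices r. \<Sum>h'\<in>choices r.
       of_bool (f ` lift T = transversal r h \<and> f ` lift T' = transversal r h'))"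
    unfolding power2_eq_square
    by (intro sum.cong refl) (simp only: X_eq_sum sum_product of_bool_conj)
  also have "\<dots> = (\<Sum>T\<in>rsets r. \<Sum>T'\<in>rsets r. \<Sum>h\<in>choices r. \<Sum>h'\<in>choices r. \<Sum>f\<in>Om r.
       of_bool (f ` lift T = transversal r h \<and> f ` lift T' = transversal r h'))"
    by (subst sum.swap, rule sum.cong[OF refl], subst sum.swap, rule sum.cong[OF refl], subst sum.swap, rule sum.cong[OF refl], rule sum.swap)
  also have "\<dots> = (\<Sum>T\<in>rsets r. \<Sum>T'\<in>rsets r. real k ^ (d*r) * A (card (T \<inter> T')) * W (card (T \<inter> T')))"
    by (simp only: sum_of_bool_card[OF finite_Om]) (intro sum.cong refl inner)
  also have "\<dots> = (\<Sum>T\<in>rsets r. \<Sum>t\<le>r. real (r choose t) * (real ((k*r - r) choose (r - t)) * (real k ^ (d*r) * A t * W t)))"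
  proof (intro sum.cong refl)
    fix T assume T: "T \<in> rsets r"
    have fT: "finite T" using T finite_subset by auto
    have "(\<Sum>T'\<in>rsets r. real k ^ (d*r) * A (card (T \<inter> T')) * W (card (T \<inter> T'))) = 
      (\<Sum>T' | T' \<subseteq> {..<k*r} \<and> card T' = r. (\<lambda>\<tau>. real k ^ (d*r) * A (card \<tau>) * W (card \<tau>)) (T' \<inter> T))"
      by (simp add: Int_commute)
    also have "\<dots> = (\<Sum>\<tau>\<in>Pow T. real ((card {..<k*r} - card T) choose (r - card \<tau>)) * (real k ^ (d*r) * A (card \<tau>) * W (card \<tau>)))"
      by (rule sum_subsets_by_trace) (use T in auto)
    also have "\<dots> = (\<Sum>t\<le>card T. real (card T choose t) * (real ((k*r - card T) choose (r - t)) * (real k ^ (d*r) * A t * W t)))"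
      using sum_Pow_by_card[OF fT, of "\<lambda>t. real ((card {..<k*r} - card T) choose (r - t)) * (real k ^ (d*r) * A t * W t)"] by simp
    finally show "(\<Sum>T'\<in>rsets r. real k ^ (d*r) * A (card (T \<inter> T')) * W (card (T \<inter> T'))) = (\<Sum>t\<le>r. real (r choose t) * (real ((k*r - r) choose (r - t)) * (real k ^ (d*r) * A t * W t)))"
      using T by simp
  qed
  also have "\<dots> = real ((k*r) choose r) * (\<Sum>t\<le>r. real (r choose t) * (real ((k*r - r) choose (r - t)) * (real k ^ (d*r) * A t * W t)))"
    using n_subsets[of "{..<k*r}" r] by simp
  finally have sq: "(\<Sum>f\<in>Om r. (X r f)\<^sup>2) = real ((k*r) choose r) * (\<Sum>t\<le>r. real (r choose t) * (real ((k*r - r) choose (r - t)) * (real k ^ (d*r) * A t * W t)))" .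
  define a1 where "a1 = (k-1)*r"
  have kr: "k*r = a1 + r" "k*r - r = a1" using k_gt_2 by (auto simp: a1_def algebra_simps nat_diff_split) 
  have Ndr: "N r - d*r = d*a1" "N r = d*(k*r)" by (auto simp: N_def kr algebra_simps)
  have term_eq: "real ((k*r) choose r) * (real (r choose t) * (real ((k*r - r) choose (r - t)) * (real k ^ (d*r) * A t * W t))) / fact (N r)
     = (E r (X r))\<^sup>2 * overlap_term d k r t" if t: "t \<le> r" for t
  proof -
    define y where "y = (k-2)*r + t"
    have a1y: "a1 = y + (r - t)"
    proof -
      have "k - 1 = (k - 2) + 1" using k_gt_2 by simp
      then have "a1 = (k-2)*r + r" by (simp only: a1_def add_mult_distrib nat_mult_1)
      then show ?thesis using t by (simp add: y_def)
    qed
    have c1: "real ((k*r) choose r) = fact (k*r) / (fact r * fact a1)"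
      using binomial_fact[of r "k*r", where ?'a=real] by (simp add: kr)
    have c2: "real (r choose t) = fact r / (fact t * fact (r-t))" using binomial_fact[OF t, where ?'a=real] .
    have c3: "real ((k*r - r) choose (r - t)) = fact a1 / (fact (r-t) * fact y)"
      using binomial_fact[of "r-t" a1, where ?'a=real] by (simp add: kr a1y)
    have dd: "d*r - d*t = d*(r-t)" by (simp add: right_diff_distrib')
    have c4: "real ((d*r) choose (d*t)) = fact (d*r) / (fact (d*t) * fact (d*(r-t)))"
      using binomial_fact[of "d*t" "d*r", where ?'a=real] t dd by simp
    have Nt: "N r - (2*d*r - d*t) = d*y"
    proof -
      have "N r = d*y + (2*d*r - d*t)"
      proof -
        have "d * (r - t) + d * r = 2*d*r - d*t" using t by (simp add: right_diff_distrib' mult.assoc[symmetric] mult_2[symmetric] )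
        then show ?thesis by (simp add: N_def kr a1y distrib_left add.assoc)
      qed
      then show ?thesis by simp
    qed
    have nz: "fact n \<noteq> (0::real)" for n by simp
    have kn: "real k \<noteq> 0" using k_gt_2 by simp
    show ?thesis
      unfolding first_moment overlap_term_def A_def W_def Nt dd c1 c2 c3 c4 Ndr(1) y_def[symmetric] a1_def[symmetric] unfolding Ndr(2)
      by (rule moment_quotient_cancel) (use kn in simp_all)
  qed
  have "E r (\<lambda>f. (X r f)\<^sup>2) = (\<Sum>t\<le>r. real ((k*r) choose r) * (real (r choose t) * (real ((k*r - r) choose (r - t)) * (real k ^ (d*r) * A t * W t))) / fact (N r))"
    unfolding E_def sq by (simp add: sum_distrib_left sum_divide_distrib)
  also have "\<dots> = (\<Sum>t\<le>r. (E r (X r))\<^sup>2 * overlap_term d k r t)"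
    by (intro sum.cong refl term_eq) auto
  finally show ?thesis by (simp add: sum_distrib_left)
qed

end

section \<open>Short cycles\<close>

text \<open>A step \<open>((v, a, a'), (c, b, b'))\<close> of a cycle enters the variable \<open>v\<close> at its copy \<open>a'\<close>, leaves it
  from its copy \<open>a\<close> to the copy \<open>b\<close> of the clause \<open>c\<close>, and leaves \<open>c\<close> from its copy \<open>b'\<close>.\<close>

type_synonym step = "(nat \<times> nat \<times> nat) \<times> (nat \<times> nat \<times> nat)"
type_synonym edge = "(nat \<times> nat) \<times> (nat \<times> nat)"

definition vr :: "step \<Rightarrow> nat" where "vr s = fst (fst s)"
definition aout :: "step \<Rightarrow> nat" where "aout s = fst (snd (fst s))"
definition ain :: "step \<Rightarrow> nat" where "ain s = snd (snd (fst s))"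
definition cl :: "step \<Rightarrow> nat" where "cl s = fst (snd s)"
definition bin :: "step \<Rightarrow> nat" where "bin s = fst (snd (snd s))"
definition bout :: "step \<Rightarrow> nat" where "bout s = snd (snd (snd s))"

lemma step_eqI: "vr s = vr t \<Longrightarrow> aout s = aout t \<Longrightarrow> ain s = ain t \<Longrightarrow> cl s = cl t \<Longrightarrow> bin s = bin t \<Longrightarrow> bout s = bout t \<Longrightarrow> s = t"
  by (auto simp: vr_def aout_def ain_def cl_def bin_def bout_def prod_eq_iff)

definition cyc_next :: "step list \<Rightarrow> nat \<Rightarrow> nat" where "cyc_next xs j = Suc j mod length xs"

text \<open>Edges are written with the variable copy before the clause copy, whatever the direction
  of traversal, so that they can be compared with pairs (p, f p). The edge
  \<open>edge_in xs j\<close> leaves the clause of step j towards the variable of the cyclically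
  next step.\<close>

definition edge_out :: "step list \<Rightarrow> nat \<Rightarrow> edge" where
  "edge_out xs j = ((vr (xs ! j), aout (xs ! j)), (cl (xs ! j), bin (xs ! j)))"
definition edge_in :: "step list \<Rightarrow> nat \<Rightarrow> edge" where
  "edge_in xs j = ((vr (xs ! cyc_next xs j), ain (xs ! cyc_next xs j)), (cl (xs ! j), bout (xs ! j)))"
definition edges :: "step list \<Rightarrow> edge set" where
  "edges xs = edge_out xs ` {..<length xs} \<union> edge_in xs ` {..<length xs}"
definition vars :: "step list \<Rightarrow> nat set" where "vars xs = vr ` set xs"
definition cls :: "step list \<Rightarrow> nat set" where "cls xs = cl ` set xs"
definition verts :: "step list \<Rightarrow> (nat + nat) set" where "verts xs = vars xs <+> cls xs"
definition ends :: "edge \<Rightarrow> (nat + nat) set" where "ends e = {Inl (fst (fst e)), Inr (fst (snd e))}"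

text \<open>A list of length l describes a cycle with l variables, l clauses and 2 l edges. Length 1
  is a pair of parallel edges between one variable and one clause, which the multigraph may
  contain.\<close>

definition is_cycle :: "step list \<Rightarrow> bool" where
  "is_cycle xs \<longleftrightarrow> xs \<noteq> [] \<and> distinct (map vr xs) \<and> distinct (map cl xs) \<and>
     (\<forall>s\<in>set xs. aout s \<noteq> ain s \<and> bin s \<noteq> bout s)"

text \<open>The root and the orientation of a cycle are normalised, so that a canonical cycle is
  determined by its set of edges (\<open>canonical_cycle_eqI\<close>).\<close>

definition canonical :: "step list \<Rightarrow> bool" where
  "canonical xs \<longleftrightarrow> is_cycle xs \<and> (\<forall>s\<in>set xs. vr (hd xs) \<le> vr s) \<and> aout (hd xs) < ain (hd xs)"

lemma finite_edges [simp]: "finite (edges xs)" and finite_vars [simp]: "finite (vars xs)"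
  and finite_cls [simp]: "finite (cls xs)" and finite_verts [simp]: "finite (verts xs)"
  by (auto simp: edges_def vars_def cls_def verts_def)

lemma cyc_next_less: "xs \<noteq> [] \<Longrightarrow> cyc_next xs j < length xs"
  by (simp add: cyc_next_def)

lemma cyc_next_inj:
  assumes "i < length xs" "j < length xs" "cyc_next xs i = cyc_next xs j" shows "i = j"
proof -
  have n: "cyc_next xs l = (if Suc l = length xs then 0 else Suc l)" if "l < length xs" for l
    using that by (auto simp: cyc_next_def)
  show ?thesis using assms n[of i] n[of j] by (auto split: if_splits)
qed

lemma cyc_next_surj:
  assumes "j < length xs" obtains i where "i < length xs" "cyc_next xs i = j"
proof (cases j)
  case 0
  then show ?thesis using that[of "length xs - 1"] assms by (auto simp: cyc_next_def)
next
  case (Suc i)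
  then show ?thesis using that[of i] assms by (auto simp: cyc_next_def)
qed

context
  fixes xs :: "step list"
  assumes cyc: "is_cycle xs"
begin

lemma cycle_nonempty: "xs \<noteq> []" and cycle_length_pos: "length xs > 0"
  using cyc by (auto simp: is_cycle_def)

lemma vr_inj: "i < length xs \<Longrightarrow> j < length xs \<Longrightarrow> vr (xs ! i) = vr (xs ! j) \<Longrightarrow> i = j"
  using cyc by (auto simp: is_cycle_def distinct_conv_nth)

lemma cl_inj: "i < length xs \<Longrightarrow> j < length xs \<Longrightarrow> cl (xs ! i) = cl (xs ! j) \<Longrightarrow> i = j"
  using cyc by (auto simp: is_cycle_def distinct_conv_nth)

lemma ports_neq: "i < length xs \<Longrightarrow> aout (xs ! i) \<noteq> ain (xs ! i)" "i < length xs \<Longrightarrow> bin (xs ! i) \<noteq> bout (xs ! i)"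
  using cyc by (auto simp: is_cycle_def)

lemma vars_nth: "vars xs = (\<lambda>j. vr (xs ! j)) ` {..<length xs}"
  and cls_nth: "cls xs = (\<lambda>j. cl (xs ! j)) ` {..<length xs}"
  by (auto simp: vars_def cls_def set_conv_nth)

lemma card_vars: "card (vars xs) = length xs"
  unfolding vars_nth by (subst card_image) (auto intro: inj_onI vr_inj)

lemma card_cls: "card (cls xs) = length xs"
  unfolding cls_nth by (subst card_image) (auto intro: inj_onI cl_inj)

lemma card_verts: "card (verts xs) = 2 * length xs"
  by (simp add: verts_def card_Plus card_vars card_cls)

lemma edge_cases:
  assumes "e \<in> edges xs"
  obtains j where "j < length xs" "e = edge_out xs j" | j where "j < length xs" "e = edge_in xs j"
  using assms by (auto simp: edges_def)

lemma edge_out_in_edges: "j < length xs \<Longrightarrow> edge_out xs j \<in> edges xs"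
  and edge_in_in_edges: "j < length xs \<Longrightarrow> edge_in xs j \<in> edges xs"
  by (auto simp: edges_def)

lemma fst_edge_neq:
  assumes "i < length xs" "j < length xs" shows "fst (edge_out xs i) \<noteq> fst (edge_in xs j)"
proof
  assume a: "fst (edge_out xs i) = fst (edge_in xs j)"
  then have "i = cyc_next xs j" using vr_inj[of i "cyc_next xs j"] assms cyc_next_less[OF cycle_nonempty]
    by (auto simp: edge_out_def edge_in_def)
  then show False using a ports_neq(1)[of i] assms by (auto simp: edge_out_def edge_in_def)
qed

lemma snd_edge_neq:
  assumes "i < length xs" "j < length xs" shows "snd (edge_out xs i) \<noteq> snd (edge_in xs j)"
proof
  assume a: "snd (edge_out xs i) = snd (edge_in xs j)"
  then have "i = j" using cl_inj[of i j] assms by (auto simp: edge_out_def edge_in_def)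
  then show False using a ports_neq(2)[of i] assms by (auto simp: edge_out_def edge_in_def)
qed

lemma edge_out_inj: "i < length xs \<Longrightarrow> j < length xs \<Longrightarrow> fst (edge_out xs i) = fst (edge_out xs j) \<Longrightarrow> i = j"
    "i < length xs \<Longrightarrow> j < length xs \<Longrightarrow> snd (edge_out xs i) = snd (edge_out xs j) \<Longrightarrow> i = j"
  using vr_inj cl_inj by (auto simp: edge_out_def)

lemma edge_in_inj: "i < length xs \<Longrightarrow> j < length xs \<Longrightarrow> fst (edge_in xs i) = fst (edge_in xs j) \<Longrightarrow> i = j"
    "i < length xs \<Longrightarrow> j < length xs \<Longrightarrow> snd (edge_in xs i) = snd (edge_in xs j) \<Longrightarrow> i = j"
  using vr_inj[of "cyc_next xs i" "cyc_next xs j"] cyc_next_less[OF cycle_nonempty] cyc_next_inj cl_inj by (auto simp: edge_in_def)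

lemma inj_fst_edges: "inj_on fst (edges xs)"
proof (rule inj_onI)
  fix e e' assume "e \<in> edges xs" "e' \<in> edges xs" and eq: "fst e = fst e'"
  then show "e = e'"
    by (elim edge_cases; use eq fst_edge_neq edge_out_inj(1) edge_in_inj(1) in metis)
qed

lemma inj_snd_edges: "inj_on snd (edges xs)"
proof (rule inj_onI)
  fix e e' assume "e \<in> edges xs" "e' \<in> edges xs" and eq: "snd e = snd e'"
  then show "e = e'"
    by (elim edge_cases; use eq snd_edge_neq edge_out_inj(2) edge_in_inj(2) in metis)
qed

lemma card_edges_of_indices:
  assumes "A \<subseteq> {..<length xs}" "B \<subseteq> {..<length xs}"
  shows "card (edge_out xs ` A \<union> edge_in xs ` B) = card A + card B"
proof -
  have "finite A" "finite B" using assms finite_subset by blast+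
  moreover have "inj_on (edge_out xs) A" "inj_on (edge_in xs) B"
    using assms by (auto intro!: inj_onI dest: arg_cong[of _ _ fst] intro: edge_out_inj(1) edge_in_inj(1))
  moreover have "edge_out xs ` A \<inter> edge_in xs ` B = {}"
    using assms fst_edge_neq by (auto simp: subset_iff) (metis)
  ultimately show ?thesis by (simp add: card_Un_disjoint card_image)
qed

lemma card_edges: "card (edges xs) = 2 * length xs"
  unfolding edges_def using card_edges_of_indices[of "{..<length xs}" "{..<length xs}"] by simp

lemma ends_edge_out: "ends (edge_out xs j) = {Inl (vr (xs ! j)), Inr (cl (xs ! j))}"
  and ends_edge_in: "ends (edge_in xs j) = {Inl (vr (xs ! cyc_next xs j)), Inr (cl (xs ! j))}"
  by (auto simp: ends_def edge_out_def edge_in_def)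

lemma Inl_verts: "j < length xs \<Longrightarrow> Inl (vr (xs ! j)) \<in> verts xs"
  and Inr_verts: "j < length xs \<Longrightarrow> Inr (cl (xs ! j)) \<in> verts xs"
  by (auto simp: verts_def vars_def cls_def)

lemma verts_cases:
  assumes "x \<in> verts xs"
  obtains j where "j < length xs" "x = Inl (vr (xs ! j))" | j where "j < length xs" "x = Inr (cl (xs ! j))"
  using assms by (auto simp: verts_def vars_nth cls_nth)

lemma ends_subset_verts: "e \<in> edges xs \<Longrightarrow> ends e \<subseteq> verts xs"
  by (elim edge_cases) (auto simp: ends_edge_out ends_edge_in intro: Inl_verts Inr_verts cyc_next_less[OF cycle_nonempty])

text \<open>Charge every vertex of \<open>U\<close> to the edge that leaves it. If \<open>U\<close> is a proper subset of the
  vertices, then the edge with which the cycle enters \<open>U\<close> is not charged.\<close>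

lemma card_incident_edges:
  assumes U: "U \<subseteq> verts xs"
  shows "card U \<le> card {e\<in>edges xs. ends e \<inter> U \<noteq> {}}"
    and "U \<noteq> {} \<Longrightarrow> U \<noteq> verts xs \<Longrightarrow> card U < card {e\<in>edges xs. ends e \<inter> U \<noteq> {}}"
proof -
  define A where "A = {j. j < length xs \<and> Inl (vr (xs ! j)) \<in> U}"
  define B where "B = {j. j < length xs \<and> Inr (cl (xs ! j)) \<in> U}"
  have AB: "A \<subseteq> {..<length xs}" "B \<subseteq> {..<length xs}" "finite A" "finite B" by (auto simp: A_def B_def)
  have "U = (\<lambda>j. Inl (vr (xs ! j))) ` A \<union> (\<lambda>j. Inr (cl (xs ! j))) ` B"
  proof (intro subset_antisym subsetI)
    fix x assume x: "x \<in> U"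
    then have "x \<in> verts xs" using U by blast
    then show "x \<in> (\<lambda>j. Inl (vr (xs ! j))) ` A \<union> (\<lambda>j. Inr (cl (xs ! j))) ` B"
      by (cases rule: verts_cases) (use x in \<open>auto simp: A_def B_def\<close>)
  qed (auto simp: A_def B_def)
  also have "card \<dots> = card ((\<lambda>j. Inl (vr (xs ! j)) :: nat + nat) ` A) + card ((\<lambda>j. Inr (cl (xs ! j)) :: nat + nat) ` B)"
    using AB by (intro card_Un_disjoint) auto
  also have "\<dots> = card A + card B"
    using AB by (subst (1 2) card_image) (auto intro!: inj_onI intro: vr_inj cl_inj)
  finally have cU: "card U = card A + card B" .
  define C where "C = edge_out xs ` A \<union> edge_in xs ` B"
  have cC: "card C = card U" unfolding C_def cU by (rule card_edges_of_indices[OF AB(1,2)])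
  have CI: "C \<subseteq> {e\<in>edges xs. ends e \<inter> U \<noteq> {}}"
    by (auto simp: C_def A_def B_def ends_edge_out ends_edge_in edges_def)
  have finI: "finite {e\<in>edges xs. ends e \<inter> U \<noteq> {}}" by simp
  show "card U \<le> card {e\<in>edges xs. ends e \<inter> U \<noteq> {}}"
    using card_mono[OF finI CI] cC by simp
  assume ne: "U \<noteq> {}" "U \<noteq> verts xs"
  have "\<exists>e. e \<in> edges xs \<and> ends e \<inter> U \<noteq> {} \<and> e \<notin> C"
  proof (rule ccontr)
    assume no: "\<nexists>e. e \<in> edges xs \<and> ends e \<inter> U \<noteq> {} \<and> e \<notin> C"
    \<comment> \<open>If every edge that meets U were charged, then absence from U would pass from a
      variable to the clause after it (\<open>s1\<close>) and from a clause to the variable after it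
      (\<open>s2\<close>). Starting from one vertex outside U it would travel round the cycle and
      make U empty.\<close>
    have s1: "Inr (cl (xs ! j)) \<notin> U" if j: "j < length xs" "Inl (vr (xs ! j)) \<notin> U" for j
    proof
      assume "Inr (cl (xs ! j)) \<in> U"
      then have "ends (edge_out xs j) \<inter> U \<noteq> {}" by (simp add: ends_edge_out)
      then have "edge_out xs j \<in> C" using no edge_out_in_edges[OF j(1)] by blast
      moreover have "edge_out xs j \<notin> edge_in xs ` B" using fst_edge_neq[OF j(1)] AB by fastforce
      ultimately obtain i where i: "i \<in> A" "edge_out xs j = edge_out xs i" by (auto simp: C_def)
      then have "j = i" using edge_out_inj(1)[of j i] j AB by auto
      then show False using i j by (simp add: A_def)
    qed
    have s2: "Inl (vr (xs ! cyc_next xs j)) \<notin> U" if j: "j < length xs" "Inr (cl (xs ! j)) \<notin> U" for j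
    proof
      assume "Inl (vr (xs ! cyc_next xs j)) \<in> U"
      then have "ends (edge_in xs j) \<inter> U \<noteq> {}" by (simp add: ends_edge_in)
      then have "edge_in xs j \<in> C" using no edge_in_in_edges[OF j(1)] by blast
      moreover have "edge_in xs j \<notin> edge_out xs ` A" using fst_edge_neq[OF _ j(1)] AB by fastforce
      ultimately obtain i where i: "i \<in> B" "edge_in xs j = edge_in xs i" by (auto simp: C_def)
      then have "j = i" using edge_in_inj(1)[of j i] j AB by auto
      then show False using i j by (simp add: B_def)
    qed
    have "\<exists>j<length xs. Inl (vr (xs ! j)) \<notin> U"
    proof -
      obtain x where "x \<in> verts xs" "x \<notin> U" using ne U by blast
      then show ?thesis using s2 cyc_next_less[OF cycle_nonempty] by (elim verts_cases) auto
    qed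
    then obtain j where j: "j < length xs" "Inl (vr (xs ! j)) \<notin> U" by blast
    have all: "Inl (vr (xs ! ((j + n) mod length xs))) \<notin> U" for n
    proof (induction n)
      case (Suc n)
      have l: "(j + n) mod length xs < length xs" using cycle_length_pos by simp
      have "cyc_next xs ((j + n) mod length xs) = (j + Suc n) mod length xs" by (simp add: cyc_next_def mod_Suc_eq)
      then show ?case using s2[OF l s1[OF l Suc]] by simp
    qed (use j in simp)
    have all': "Inl (vr (xs ! i)) \<notin> U" if "i < length xs" for i
      using all[of "i + length xs - j"] that j(1) by simp
    have "x \<notin> U" if "x \<in> verts xs" for x
      using that by (cases rule: verts_cases) (use all' s1 in auto)
    then have "U = {}" using U by blast
    then show False using ne by simp
  qed
  then obtain e where e: "e \<in> edges xs" "ends e \<inter> U \<noteq> {}" "e \<notin> C" by blast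
  have "card (insert e C) \<le> card {e\<in>edges xs. ends e \<inter> U \<noteq> {}}"
    by (rule card_mono[OF finI]) (use e CI in auto)
  moreover have "finite C" using CI finI finite_subset by blast
  ultimately show "card U < card {e\<in>edges xs. ends e \<inter> U \<noteq> {}}" using e cC by simp
qed

lemma vr_port_cases:
  assumes "((vr (xs ! j), a), q) \<in> edges xs" "j < length xs"
  shows "a = aout (xs ! j) \<or> a = ain (xs ! j)"
  using assms(1)
proof (cases rule: edge_cases)
  case (1 i)
  then have "j = i" using vr_inj[of j i] assms by (auto simp: edge_out_def)
  then show ?thesis using 1 by (auto simp: edge_out_def)
next
  case (2 i)
  then have "j = cyc_next xs i" using vr_inj[of j "cyc_next xs i"] assms cyc_next_less[OF cycle_nonempty] by (auto simp: edge_in_def)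
  then show ?thesis using 2 by (auto simp: edge_in_def)
qed

lemma cl_port_cases:
  assumes "(p, (cl (xs ! j), b)) \<in> edges xs" "j < length xs"
  shows "b = bin (xs ! j) \<and> p = (vr (xs ! j), aout (xs ! j)) \<or> b = bout (xs ! j) \<and> p = (vr (xs ! cyc_next xs j), ain (xs ! cyc_next xs j))"
  using assms(1)
proof (cases rule: edge_cases)
  case (1 i)
  then have "j = i" using cl_inj[of j i] assms by (auto simp: edge_out_def)
  then show ?thesis using 1 by (auto simp: edge_out_def)
next
  case (2 i)
  then have "j = i" using cl_inj[of j i] assms by (auto simp: edge_in_def)
  then show ?thesis using 2 by (auto simp: edge_in_def)
qed

lemma edge_ain:
  assumes "j < length xs" obtains q where "((vr (xs ! j), ain (xs ! j)), q) \<in> edges xs"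
proof -
  obtain i where i: "i < length xs" "cyc_next xs i = j" using cyc_next_surj[OF assms] .
  then have "((vr (xs ! j), ain (xs ! j)), (cl (xs ! i), bout (xs ! i))) \<in> edges xs"
    using edge_in_in_edges[OF i(1)] by (simp add: edge_in_def)
  then show ?thesis using that by blast
qed

lemma edge_aout: "j < length xs \<Longrightarrow> ((vr (xs ! j), aout (xs ! j)), (cl (xs ! j), bin (xs ! j))) \<in> edges xs"
  using edge_out_in_edges by (simp add: edge_out_def)

lemma vars_eq_edges: "vars xs = (fst \<circ> fst) ` edges xs"
proof
  show "vars xs \<subseteq> (fst \<circ> fst) ` edges xs" using edge_aout by (force simp: vars_nth)
  show "(fst \<circ> fst) ` edges xs \<subseteq> vars xs"
    using cyc_next_less[OF cycle_nonempty] by (auto simp: vars_nth edges_def edge_out_def edge_in_def)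
qed

lemma cls_eq_edges: "cls xs = (fst \<circ> snd) ` edges xs"
proof
  show "cls xs \<subseteq> (fst \<circ> snd) ` edges xs" using edge_aout by (force simp: cls_nth)
  show "(fst \<circ> snd) ` edges xs \<subseteq> cls xs"
    by (auto simp: cls_nth edges_def edge_out_def edge_in_def)
qed

lemma degree_two:
  assumes "v \<in> vars xs" shows "card {e\<in>edges xs. fst (fst e) = v} = 2"
proof -
  obtain j where j: "j < length xs" "v = vr (xs ! j)" using assms by (auto simp: vars_nth)
  obtain i where i: "i < length xs" "cyc_next xs i = j" using cyc_next_surj[OF j(1)] .
  have "{e\<in>edges xs. fst (fst e) = v} = {edge_out xs j, edge_in xs i}"
  proof
    show "{edge_out xs j, edge_in xs i} \<subseteq> {e\<in>edges xs. fst (fst e) = v}"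
      using i j edge_out_in_edges edge_in_in_edges by (auto simp: edge_out_def edge_in_def)
    show "{e\<in>edges xs. fst (fst e) = v} \<subseteq> {edge_out xs j, edge_in xs i}"
    proof
      fix e assume "e \<in> {e\<in>edges xs. fst (fst e) = v}"
      then have e: "e \<in> edges xs" "v = fst (fst e)" by auto
      from e(1) show "e \<in> {edge_out xs j, edge_in xs i}"
      proof (cases rule: edge_cases)
        case (1 l)
        then show ?thesis using e j vr_inj[of j l] by (auto simp: edge_out_def)
      next
        case (2 l)
        then have "cyc_next xs l = j" using e j vr_inj[of j "cyc_next xs l"] cyc_next_less[OF cycle_nonempty] by (auto simp: edge_in_def)
        then show ?thesis using 2 e i cyc_next_inj[of l xs i] by auto
      qed
    qed
  qed
  moreover have "edge_out xs j \<noteq> edge_in xs i" using fst_edge_neq[OF j(1) i(1)] by auto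
  ultimately show ?thesis by simp
qed

end

text \<open>The root is the least variable that occurs in the edges, and the order of its two copies
  fixes the orientation. From there the cycle can be traced: every copy in use lies on exactly one
  edge, and at each vertex the entry copy determines the exit copy.\<close>

lemma canonical_cycle_eqI:
  assumes "canonical xs" "canonical ys" and E: "edges xs = edges ys"
  shows "xs = ys"
proof -
  have cx: "is_cycle xs" and cy: "is_cycle ys" using assms by (auto simp: canonical_def)
  have len: "length xs = length ys" using card_edges[OF cx] card_edges[OF cy] E by simp
  have V: "vars xs = vars ys" using vars_eq_edges[OF cx] vars_eq_edges[OF cy] E by simp
  have nx: "cyc_next xs = cyc_next ys" using len by (simp add: cyc_next_def fun_eq_iff)
  have pos: "0 < length xs" "0 < length ys" using cycle_length_pos cx cy by auto
  have hd: "hd xs = xs ! 0" "hd ys = ys ! 0" using pos by (auto simp: hd_conv_nth)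
  have ports: "{a. \<exists>q. ((vr (zs ! j), a), q) \<in> edges zs} = {aout (zs ! j), ain (zs ! j)}" if "is_cycle zs" "j < length zs" for zs j
    using vr_port_cases[OF that(1) _ that(2)] edge_aout[OF that] edge_ain[OF that] by blast
  have cports: "{b. \<exists>p. (p, (cl (zs ! j), b)) \<in> edges zs} = {bin (zs ! j), bout (zs ! j)}" if "is_cycle zs" "j < length zs" for zs j
  proof -
    have "edge_in zs j \<in> edges zs" by (rule edge_in_in_edges[OF that])
    then show ?thesis
      using cl_port_cases[OF that(1) _ that(2)] edge_aout[OF that] unfolding edge_in_def by blast
  qed
  have v0: "vr (xs ! 0) = vr (ys ! 0)"
  proof -
    have "vr (xs ! 0) \<in> vars ys" "vr (ys ! 0) \<in> vars xs" using V pos by (auto simp: vars_nth[OF cx] vars_nth[OF cy])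
    then show ?thesis using assms(1,2) unfolding canonical_def hd vars_def by (auto intro: antisym)
  qed
  have "{aout (xs ! 0), ain (xs ! 0)} = {aout (ys ! 0), ain (ys ! 0)}"
    using ports[OF cx pos(1)] ports[OF cy pos(2)] v0 E by simp
  moreover have "aout (xs ! 0) < ain (xs ! 0)" "aout (ys ! 0) < ain (ys ! 0)" using assms hd by (auto simp: canonical_def)
  ultimately have a0: "aout (xs ! 0) = aout (ys ! 0)" "ain (xs ! 0) = ain (ys ! 0)" by (auto simp: doubleton_eq_iff)
  have cl_step: "cl (xs ! j) = cl (ys ! j) \<and> bin (xs ! j) = bin (ys ! j) \<and> bout (xs ! j) = bout (ys ! j)"
    if j: "j < length xs" and v: "vr (xs ! j) = vr (ys ! j)" "aout (xs ! j) = aout (ys ! j)" for j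
  proof -
    have jy: "j < length ys" using j len by simp
    have "((vr (ys ! j), aout (ys ! j)), (cl (xs ! j), bin (xs ! j))) \<in> edges ys"
      using edge_aout[OF cx j] v E by simp
    then have 1: "cl (xs ! j) = cl (ys ! j)" "bin (xs ! j) = bin (ys ! j)"
      using inj_onD[OF inj_fst_edges[OF cy], OF _ _ edge_aout[OF cy jy]] by fastforce+
    then have "{bin (xs ! j), bout (xs ! j)} = {bin (ys ! j), bout (ys ! j)}"
      using cports[OF cx j] cports[OF cy jy] E by simp
    then show ?thesis using 1 ports_neq(2)[OF cx j] ports_neq(2)[OF cy jy] by (auto simp: doubleton_eq_iff)
  qed
  have vr_step: "vr (xs ! j) = vr (ys ! j) \<and> aout (xs ! j) = aout (ys ! j) \<and> ain (xs ! j) = ain (ys ! j)" if "j < length xs" for j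
    using that
  proof (induction j)
    case 0
    then show ?case using v0 a0 by simp
  next
    case (Suc j)
    then have j: "j < length xs" "j < length ys" and IH: "vr (xs ! j) = vr (ys ! j)" "aout (xs ! j) = aout (ys ! j)" using len by auto
    have nj: "cyc_next xs j = Suc j" "cyc_next ys j = Suc j" using Suc.prems len by (auto simp: cyc_next_def)
    have c: "cl (xs ! j) = cl (ys ! j)" "bout (xs ! j) = bout (ys ! j)" using cl_step[OF j(1) IH] by auto
    have e1: "((vr (xs ! Suc j), ain (xs ! Suc j)), (cl (ys ! j), bout (ys ! j))) \<in> edges ys"
      using edge_in_in_edges[OF cx j(1)] E c by (simp add: edge_in_def nj)
    have e2: "((vr (ys ! Suc j), ain (ys ! Suc j)), (cl (ys ! j), bout (ys ! j))) \<in> edges ys"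
      using edge_in_in_edges[OF cy j(2)] by (simp add: edge_in_def nj)
    have 1: "vr (xs ! Suc j) = vr (ys ! Suc j)" "ain (xs ! Suc j) = ain (ys ! Suc j)"
      using inj_onD[OF inj_snd_edges[OF cy] _ e1 e2] by auto
    have sy: "Suc j < length ys" using Suc.prems len by simp
    have "{aout (xs ! Suc j), ain (xs ! Suc j)} = {aout (ys ! Suc j), ain (ys ! Suc j)}"
      using ports[OF cx Suc.prems] ports[OF cy sy] 1 E by simp
    then show ?case using 1 ports_neq(1)[OF cx Suc.prems] ports_neq(1)[OF cy sy] by (auto simp: doubleton_eq_iff)
  qed
  show ?thesis
    by (rule nth_equalityI[OF len]) (use vr_step cl_step in \<open>auto intro!: step_eqI\<close>)
qed

text \<open>The edges of the cycle that meet a vertex outside V are not in E, whose edges have both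
  ends in V. By \<open>card_incident_edges\<close> they are at least as many as the new vertices,
  and strictly more if the cycle also has old ones.\<close>

lemma card_edges_Un_ge:
  assumes "is_cycle xs" and E: "finite E" "\<And>e. e \<in> E \<Longrightarrow> ends e \<subseteq> V"
  shows "card (E \<union> edges xs) \<ge> card E + card (verts xs - V)"
    and "verts xs - V \<noteq> {} \<Longrightarrow> verts xs \<inter> V \<noteq> {} \<Longrightarrow> card (E \<union> edges xs) > card E + card (verts xs - V)"
proof -
  define U where "U = verts xs - V"
  define I where "I = {e\<in>edges xs. ends e \<inter> U \<noteq> {}}"
  have "finite I" by (simp add: I_def)
  moreover have "E \<inter> I = {}" using E(2) by (fastforce simp: I_def U_def)
  ultimately have "card E + card I = card (E \<union> I)" using E(1) by (simp add: card_Un_disjoint)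
  also have "\<dots> \<le> card (E \<union> edges xs)" using E(1) by (intro card_mono) (auto simp: I_def)
  finally have le: "card E + card I \<le> card (E \<union> edges xs)" .
  have sub: "U \<subseteq> verts xs" by (auto simp: U_def)
  show "card (E \<union> edges xs) \<ge> card E + card (verts xs - V)"
    using card_incident_edges(1)[OF assms(1) sub] le by (simp add: I_def U_def)
  assume "verts xs - V \<noteq> {}" "verts xs \<inter> V \<noteq> {}"
  then have "U \<noteq> {}" "U \<noteq> verts xs" by (auto simp: U_def)
  then show "card (E \<union> edges xs) > card E + card (verts xs - V)"
    using card_incident_edges(2)[OF assms(1) sub] le by (simp add: I_def U_def)
qed

text \<open>A single cycle has as many edges as vertices. If one of the two cycles leaves the vertex
  set of the other, adding it creates a surplus; if the vertex sets coincide, the edge sets still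
  differ because the cycles are canonical.\<close>

lemma card_edges_Un_intersecting:
  assumes can: "canonical xs" "canonical ys" and ne: "xs \<noteq> ys" and int: "verts xs \<inter> verts ys \<noteq> {}"
  shows "card (verts xs \<union> verts ys) < card (edges xs \<union> edges ys)"
proof -
  have cx: "is_cycle xs" and cy: "is_cycle ys" using can by (auto simp: canonical_def)
  have ce: "card (edges zs) = card (verts zs)" if "is_cycle zs" for zs
    using card_edges[OF that] card_verts[OF that] by simp
  have Un: "card (verts ws \<union> verts zs) = card (verts ws) + card (verts zs - verts ws)" for ws zs
    by (subst card_Un_disjoint[symmetric]) auto
  have excess: "card (verts ws \<union> verts zs) < card (edges ws \<union> edges zs)"
    if "is_cycle ws" "is_cycle zs" "verts zs - verts ws \<noteq> {}" "verts zs \<inter> verts ws \<noteq> {}" for ws zs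
    using card_edges_Un_ge(2)[of zs "edges ws" "verts ws"] that ends_subset_verts[OF that(1)] ce[OF that(1)] Un[of ws zs] by simp
  consider "verts ys - verts xs \<noteq> {}" | "verts xs - verts ys \<noteq> {}" | "verts xs = verts ys" by blast
  then show ?thesis
  proof cases
    case 1
    then show ?thesis using excess[of xs ys] cx cy int by blast
  next
    case 2
    then have "card (verts ys \<union> verts xs) < card (edges ys \<union> edges xs)" using excess[of ys xs] cx cy int by blast
    then show ?thesis by (simp add: Un_commute)
  next
    case 3
    have "edges xs \<noteq> edges ys" using canonical_cycle_eqI can ne by blast
    moreover have "card (edges xs) = card (edges ys)" using ce cx cy 3 by simp
    ultimately have "edges xs \<subset> edges xs \<union> edges ys"
      by (metis card_subset_eq finite_edges inf_sup_ord(3) psubsetI sup.absorb_iff1 sup.cobounded2)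
    then have "card (edges xs) < card (edges xs \<union> edges ys)" by (intro psubset_card_mono) auto
    then show ?thesis using 3 ce[OF cx] by simp
  qed
qed

text \<open>Adding a further cycle never lowers the surplus m of edges over vertices. The strict
  version starts from two distinct cycles that meet, where the surplus is already 1.\<close>

lemma card_Union_edges_ge:
  assumes "finite \<S>" "\<And>xs. xs \<in> \<S> \<Longrightarrow> is_cycle xs"
  shows "card (\<Union>(verts ` \<S>)) \<le> card (\<Union>(edges ` \<S>))"
    and "xs \<in> \<S> \<Longrightarrow> ys \<in> \<S> \<Longrightarrow> canonical xs \<Longrightarrow> canonical ys \<Longrightarrow> xs \<noteq> ys \<Longrightarrow> verts xs \<inter> verts ys \<noteq> {} \<Longrightarrow>
         card (\<Union>(verts ` \<S>)) < card (\<Union>(edges ` \<S>))"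
proof -
  have grow: "card (\<Union>(verts ` \<T>)) + m \<le> card (\<Union>(edges ` \<T>)) \<Longrightarrow>
      card (\<Union>(verts ` (\<R> \<union> \<T>))) + m \<le> card (\<Union>(edges ` (\<R> \<union> \<T>)))"
    if "finite \<R>" "finite \<T>" "\<And>xs. xs \<in> \<R> \<union> \<T> \<Longrightarrow> is_cycle xs" for \<R> \<T> m
    using that
  proof (induction \<R> rule: finite_induct)
    case (insert z \<R>)
    let ?E = "\<Union>(edges ` (\<R> \<union> \<T>))" and ?V = "\<Union>(verts ` (\<R> \<union> \<T>))"
    have IH: "card ?V + m \<le> card ?E" using insert by auto
    have fin: "finite ?E" "finite ?V" using insert by auto
    have "card (?E \<union> edges z) \<ge> card ?E + card (verts z - ?V)"
    proof (rule card_edges_Un_ge(1))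
      show "is_cycle z" using insert.prems by auto
      show "ends e \<subseteq> ?V" if "e \<in> ?E" for e
        using that ends_subset_verts insert.prems(3) by (metis (no_types, lifting) UN_E UN_upper insert_iff Un_iff subset_trans)
    qed (fact fin)
    moreover have "card (?V \<union> verts z) = card ?V + card (verts z - ?V)"
      using fin by (subst card_Un_disjoint[symmetric]) (auto intro!: arg_cong[where f=card])
    moreover have "\<Union>(edges ` (insert z \<R> \<union> \<T>)) = ?E \<union> edges z" "\<Union>(verts ` (insert z \<R> \<union> \<T>)) = ?V \<union> verts z" by auto
    ultimately show ?case using IH by simp
  qed simp
  show "card (\<Union>(verts ` \<S>)) \<le> card (\<Union>(edges ` \<S>))"
    using grow[of \<S> "{}" 0] assms by simp
  assume a: "xs \<in> \<S>" "ys \<in> \<S>" "canonical xs" "canonical ys" "xs \<noteq> ys" "verts xs \<inter> verts ys \<noteq> {}"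
  have "card (verts xs \<union> verts ys) + 1 \<le> card (edges xs \<union> edges ys)"
    using card_edges_Un_intersecting a by (simp add: Suc_leI)
  moreover have "\<S> \<union> {xs, ys} = \<S>" using a by auto
  ultimately show "card (\<Union>(verts ` \<S>)) < card (\<Union>(edges ` \<S>))"
    using grow[of \<S> "{xs,ys}" 1] assms a by auto
qed

section \<open>Cycle weights and cycle counts\<close>

lemma falling_factorial_asymp:
  "(\<lambda>n. fact n / (fact (n - j) * real n ^ j)) \<longlonglongrightarrow> (1::real)"
proof (induction j)
  case 0
  then show ?case by simp
next
  case (Suc j)
  have "(\<lambda>n. fact n / (fact (n - j) * real n ^ j) * ((real n - real j) / real n)) \<longlonglongrightarrow> 1 * 1"
    by (intro tendsto_mult Suc) real_asymp
  moreover have "\<forall>\<^sub>F n in sequentially. fact n / (fact (n - j) * real n ^ j) * ((real n - real j) / real n) = fact n / (fact (n - Suc j) * real n ^ Suc j)"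
    using eventually_gt_at_top[of j]
  proof eventually_elim
    case (elim n)
    have "n - j = Suc (n - Suc j)" using elim by simp
    then have "fact (n - j) = (real n - real j) * (fact (n - Suc j) :: real)"
      using elim by (simp add: of_nat_diff)
    then show ?case using elim by simp
  qed
  ultimately have "(\<lambda>n. fact n / (fact (n - Suc j) * real n ^ Suc j)) \<longlonglongrightarrow> (1::real) * 1"
    by (rule Lim_transform_eventually)
  then show ?case by simp
qed

lemma sum_lists_Suc:
  fixes f :: "'a list \<Rightarrow> 'b :: comm_monoid_add"
  assumes "finite A"
  shows "(\<Sum>xs | set xs \<subseteq> A \<and> length xs = Suc n. f xs) = (\<Sum>x\<in>A. \<Sum>xs | set xs \<subseteq> A \<and> length xs = n. f (x # xs))"
proof -
  have "(\<Sum>x\<in>A. \<Sum>xs | set xs \<subseteq> A \<and> length xs = n. f (x # xs)) = (\<Sum>(x, xs)\<in>A \<times> {xs. set xs \<subseteq> A \<and> length xs = n}. f (x # xs))"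
    by (simp add: sum.cartesian_product)
  also have "\<dots> = (\<Sum>xs | set xs \<subseteq> A \<and> length xs = Suc n. f xs)"
    by (rule sum.reindex_bij_witness[where i = "\<lambda>xs. (hd xs, tl xs)" and j = "\<lambda>(x, xs). x # xs"])
       (auto simp: length_Suc_conv)
  finally show ?thesis by simp
qed

lemma card_distinct_lists:
  assumes "finite A"
  shows "card {xs. length xs = l \<and> distinct xs \<and> set xs \<subseteq> A} = fact l * (card A choose l)"
proof (cases "l \<le> card A")
  case True
  have "\<Prod>{card A - l + 1 .. card A} = fact l * (card A choose l)"
  proof -
    have "fact (card A) = fact (card A - l) * \<Prod>{card A - l + 1 .. card A}"
      using True prod.ub_add_nat[of 1 "card A - l" "\<lambda>x. x" l] by (simp add: fact_prod)
    moreover have "fact (card A) = fact (card A - l) * (fact l * (card A choose l))"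
      using binomial_fact_lemma[OF True] by (simp add: mult_ac)
    ultimately show ?thesis by (metis fact_nonzero mult_cancel_left)
  qed
  then show ?thesis using card_lists_distinct_length_eq[OF assms True] by simp
next
  case False
  have "\<not> (length xs = l \<and> distinct xs \<and> set xs \<subseteq> A)" for xs
    using False assms by (metis card_mono distinct_card)
  then have e: "{xs. length xs = l \<and> distinct xs \<and> set xs \<subseteq> A} = {}" by blast
  show ?thesis unfolding e using False by (simp add: binomial_eq_0)
qed

text \<open>After the first entry x the others are chosen among the larger numbers, and the binomial
  coefficients add up along a diagonal of Pascal's triangle. These lists are the variable sequences
  of canonical cycles.\<close>

lemma card_distinct_lists_min_first:
  "card {xs. length xs = Suc l \<and> distinct xs \<and> set xs \<subseteq> {..<n::nat} \<and> (\<forall>x\<in>set xs. hd xs \<le> x)} = fact l * (n choose Suc l)"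
proof -
  let ?Y = "\<lambda>x. {ys. length ys = l \<and> distinct ys \<and> set ys \<subseteq> {x<..<n}}"
  have bij: "bij_betw (\<lambda>(x, ys). x # ys) (SIGMA x:{..<n}. ?Y x) {xs. length xs = Suc l \<and> distinct xs \<and> set xs \<subseteq> {..<n} \<and> (\<forall>x\<in>set xs. hd xs \<le> x)}"
  proof (rule bij_betw_byWitness[where f' = "\<lambda>xs. (hd xs, tl xs)"])
    show "(\<lambda>xs. (hd xs, tl xs)) ` {xs. length xs = Suc l \<and> distinct xs \<and> set xs \<subseteq> {..<n} \<and> (\<forall>x\<in>set xs. hd xs \<le> x)} \<subseteq> (SIGMA x:{..<n}. ?Y x)"
    proof (rule image_subsetI)
      fix xs :: "nat list" assume "xs \<in> {xs. length xs = Suc l \<and> distinct xs \<and> set xs \<subseteq> {..<n} \<and> (\<forall>x\<in>set xs. hd xs \<le> x)}"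
      then have a: "length xs = Suc l" "distinct xs" "set xs \<subseteq> {..<n}" "\<forall>x\<in>set xs. hd xs \<le> x" by auto
      then obtain x ys where xs: "xs = x # ys" by (cases xs) auto
      have "x < y" if "y \<in> set ys" for y using a xs that by (auto simp: order.order_iff_strict)
      then show "(hd xs, tl xs) \<in> (SIGMA x:{..<n}. ?Y x)" using a xs by auto
    qed
  qed (auto simp: length_Suc_conv)
  have "card {xs. length xs = Suc l \<and> distinct xs \<and> set xs \<subseteq> {..<n} \<and> (\<forall>x\<in>set xs. hd xs \<le> x)} = card (SIGMA x:{..<n}. ?Y x)"
    by (rule bij_betw_same_card[OF bij, symmetric])
  also have "\<dots> = (\<Sum>x<n. card (?Y x))"
  proof (rule card_SigmaI)
    have "finite (?Y x)" for x
      by (rule finite_subset[OF _ finite_lists_length_eq[of "{x<..<n}" l]]) auto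
    then show "\<forall>x\<in>{..<n}. finite (?Y x)" by blast
  qed simp
  also have "\<dots> = (\<Sum>x<n. fact l * ((n - Suc x) choose l))"
    by (intro sum.cong refl, subst card_distinct_lists) simp_all
  also have "\<dots> = fact l * (\<Sum>x<n. x choose l)"
    unfolding sum_distrib_left[symmetric] by (subst sum.nat_diff_reindex) simp
  also have "(\<Sum>x<n. x choose l) = n choose Suc l"
    using sum_choose_upper[of l] by (cases n) (auto simp: lessThan_Suc_atMost)
  finally show ?thesis .
qed

section \<open>Weights of cycles in the planted model\<close>

context exact_cover
begin

definition delta :: real where "delta = - 1 / (real k - 1)"

lemma k_real: "real k \<ge> 3" "real k - 1 > 0" using k_gt_2 by auto

text \<open>The limiting factor by which a set \<open>S\<close> of disjoint cycles, with variables \<open>J\<close> and clauses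
  \<open>K\<close>, is more likely in the planted model than in the uniform model.\<close>

definition Zsum :: "edge set \<Rightarrow> nat set \<Rightarrow> nat set \<Rightarrow> real" where
  "Zsum S J K = (\<Sum>\<tau>\<in>Pow J. (1 / (real k - 1)) ^ (card J - card \<tau>) * (\<Prod>c\<in>K. real (allowed S \<tau> c)))"

lemma allowed_cong:
  assumes "\<And>p b. (p, (c, b)) \<in> S \<longleftrightarrow> (p, (c, b)) \<in> S'" "\<And>p b. (p, (c, b)) \<in> S \<Longrightarrow> fst p \<in> \<tau> \<longleftrightarrow> fst p \<in> \<tau>'"
  shows "allowed S \<tau> c = allowed S' \<tau>' c"
proof -
  have "{b. b < k \<and> (\<forall>p b'. (p, (c, b')) \<in> S \<longrightarrow> (fst p \<in> \<tau> \<longleftrightarrow> b = b'))} = {b. b < k \<and> (\<forall>p b'. (p, (c, b')) \<in> S' \<longrightarrow> (fst p \<in> \<tau>' \<longleftrightarrow> b = b'))}"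
    using assms by blast
  then show ?thesis by (simp add: allowed_def)
qed

text \<open>Without common variables or clauses, \<tau> splits into independent parts on
  \<open>J1\<close> and \<open>J2\<close>, and each factor sees only one of them.\<close>

lemma Zsum_Un:
  assumes fin: "finite J1" "finite J2" "finite K1" "finite K2"
    and dj: "J1 \<inter> J2 = {}" "K1 \<inter> K2 = {}"
    and S1: "\<And>e. e \<in> S1 \<Longrightarrow> fst (fst e) \<in> J1 \<and> fst (snd e) \<in> K1"
    and S2: "\<And>e. e \<in> S2 \<Longrightarrow> fst (fst e) \<in> J2 \<and> fst (snd e) \<in> K2"
  shows "Zsum (S1 \<union> S2) (J1 \<union> J2) (K1 \<union> K2) = Zsum S1 J1 K1 * Zsum S2 J2 K2"
proof -
  let ?w = "1 / (real k - 1)"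
  have t: "?w ^ (card (J1 \<union> J2) - card (\<tau>1 \<union> \<tau>2)) * (\<Prod>c\<in>K1 \<union> K2. real (allowed (S1 \<union> S2) (\<tau>1 \<union> \<tau>2) c))
     = (?w ^ (card J1 - card \<tau>1) * (\<Prod>c\<in>K1. real (allowed S1 \<tau>1 c))) * (?w ^ (card J2 - card \<tau>2) * (\<Prod>c\<in>K2. real (allowed S2 \<tau>2 c)))"
    if \<tau>: "\<tau>1 \<subseteq> J1" "\<tau>2 \<subseteq> J2" for \<tau>1 \<tau>2
  proof -
    have f: "finite \<tau>1" "finite \<tau>2" using \<tau> fin by (auto intro: finite_subset)
    have le: "card \<tau>1 \<le> card J1" "card \<tau>2 \<le> card J2" using \<tau> fin by (auto intro: card_mono)
    have "card (J1 \<union> J2) - card (\<tau>1 \<union> \<tau>2) = (card J1 - card \<tau>1) + (card J2 - card \<tau>2)"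
      using f fin dj \<tau> le by (subst (1 2) card_Un_disjoint) auto
    moreover have "(\<Prod>c\<in>K1. real (allowed (S1 \<union> S2) (\<tau>1 \<union> \<tau>2) c)) = (\<Prod>c\<in>K1. real (allowed S1 \<tau>1 c))"
    proof (intro prod.cong refl arg_cong[where f=real] allowed_cong)
      fix c p b assume c: "c \<in> K1"
      show "((p, (c, b)) \<in> S1 \<union> S2) = ((p, (c, b)) \<in> S1)" using S2[of "(p,(c,b))"] c dj by auto
      assume "(p, (c, b)) \<in> S1 \<union> S2"
      then have "fst p \<in> J1" using S2[of "(p,(c,b))"] S1[of "(p,(c,b))"] c dj by auto
      then show "(fst p \<in> \<tau>1 \<union> \<tau>2) = (fst p \<in> \<tau>1)" using dj \<tau> by auto
    qed
    moreover have "(\<Prod>c\<in>K2. real (allowed (S1 \<union> S2) (\<tau>1 \<union> \<tau>2) c)) = (\<Prod>c\<in>K2. real (allowed S2 \<tau>2 c))"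
    proof (intro prod.cong refl arg_cong[where f=real] allowed_cong)
      fix c p b assume c: "c \<in> K2"
      show "((p, (c, b)) \<in> S1 \<union> S2) = ((p, (c, b)) \<in> S2)" using S1[of "(p,(c,b))"] c dj by auto
      assume "(p, (c, b)) \<in> S1 \<union> S2"
      then have "fst p \<in> J2" using S2[of "(p,(c,b))"] S1[of "(p,(c,b))"] c dj by auto
      then show "(fst p \<in> \<tau>1 \<union> \<tau>2) = (fst p \<in> \<tau>2)" using dj \<tau> by auto
    qed
    ultimately show ?thesis using fin dj by (simp add: prod.union_disjoint power_add mult_ac)
  qed
  have "Zsum S1 J1 K1 * Zsum S2 J2 K2 = (\<Sum>(\<tau>1, \<tau>2)\<in>Pow J1 \<times> Pow J2. 
     (?w ^ (card J1 - card \<tau>1) * (\<Prod>c\<in>K1. real (allowed S1 \<tau>1 c))) * (?w ^ (card J2 - card \<tau>2) * (\<Prod>c\<in>K2. real (allowed S2 \<tau>2 c))))"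
    by (simp only: Zsum_def sum_product sum.cartesian_product)
  also have "\<dots> = Zsum (S1 \<union> S2) (J1 \<union> J2) (K1 \<union> K2)"
    unfolding Zsum_def
  proof (rule sum.reindex_bij_witness[where j = "\<lambda>(\<tau>1, \<tau>2). \<tau>1 \<union> \<tau>2" and i = "\<lambda>\<tau>. (\<tau> \<inter> J1, \<tau> \<inter> J2)"])
    fix a assume a: "a \<in> Pow J1 \<times> Pow J2"
    show "((case a of (\<tau>1, \<tau>2) \<Rightarrow> \<tau>1 \<union> \<tau>2) \<inter> J1, (case a of (\<tau>1, \<tau>2) \<Rightarrow> \<tau>1 \<union> \<tau>2) \<inter> J2) = a"
      using a dj by (cases a) (auto; blast)
    show "(case a of (\<tau>1, \<tau>2) \<Rightarrow> \<tau>1 \<union> \<tau>2) \<in> Pow (J1 \<union> J2)" using a by auto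
    show "?w ^ (card (J1 \<union> J2) - card (case a of (\<tau>1, \<tau>2) \<Rightarrow> \<tau>1 \<union> \<tau>2)) * (\<Prod>c\<in>K1 \<union> K2. real (allowed (S1 \<union> S2) (case a of (\<tau>1, \<tau>2) \<Rightarrow> \<tau>1 \<union> \<tau>2) c))
      = (case a of (\<tau>1, \<tau>2) \<Rightarrow> (?w ^ (card J1 - card \<tau>1) * (\<Prod>c\<in>K1. real (allowed S1 \<tau>1 c))) * (?w ^ (card J2 - card \<tau>2) * (\<Prod>c\<in>K2. real (allowed S2 \<tau>2 c))))"
      using a t by (cases a) auto
  qed auto
  finally show ?thesis by simp
qed

text \<open>The weight of a variable with truth value a and of the clause between it and a next
  variable with truth value b: a false variable weighs \<open>1 / (k - 1)\<close>, and a clause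
  weighs the number of its copies that may be the true one.\<close>

definition transfer :: "bool \<Rightarrow> bool \<Rightarrow> real" where
  "transfer a b = (if a then 1 else 1 / (real k - 1)) * (if a \<and> b then 0 else if a \<or> b then 1 else real k - 2)"

definition statdist :: "bool \<Rightarrow> real" where
  "statdist b = (if b then 1 / real k else (real k - 1) / real k)"

fun path_weight :: "bool \<Rightarrow> bool list \<Rightarrow> bool \<Rightarrow> real" where
  "path_weight a [] z = transfer a z"
| "path_weight a (b # bs) z = transfer a b * path_weight b bs z"

text \<open>The transfer matrix is stochastic with stationary distribution \<^const>\<open>statdist\<close> and second
  eigenvalue \<^const>\<open>delta\<close>.\<close>

lemma sum_path_weight:
  "(\<Sum>bs | set bs \<subseteq> UNIV \<and> length bs = n. path_weight a bs z) = statdist z + delta ^ Suc n * (of_bool (a = z) - statdist z)"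
proof (induction n arbitrary: a)
  case 0
  have "{bs. set bs \<subseteq> (UNIV::bool set) \<and> length bs = 0} = {[]}" by auto
  then show ?case using k_real
    by (cases a; cases z) (auto simp: transfer_def statdist_def delta_def field_simps)
next
  case (Suc n)
  have "(\<Sum>bs | set bs \<subseteq> UNIV \<and> length bs = Suc n. path_weight a bs z)
      = (\<Sum>b\<in>UNIV. transfer a b * (statdist z + delta ^ Suc n * (of_bool (b = z) - statdist z)))"
    by (subst sum_lists_Suc) (simp_all only: path_weight.simps sum_distrib_left[symmetric] Suc.IH finite)
  also have "\<dots> = (transfer a True + transfer a False) * statdist z + delta ^ Suc n * (transfer a z - (transfer a True + transfer a False) * statdist z)"
    by (cases z) (simp_all add: UNIV_bool algebra_simps)
  also have "transfer a True + transfer a False = 1"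
    using k_real by (cases a) (auto simp: transfer_def field_simps)
  also have "transfer a z - 1 * statdist z = delta * (of_bool (a = z) - statdist z)"
    using k_real by (cases a; cases z) (auto simp: transfer_def statdist_def delta_def field_simps)
  finally show ?case by simp
qed

lemma path_weight_eq_prod:
  "path_weight a bs z = (\<Prod>j<Suc (length bs). transfer ((a # bs @ [z]) ! j) ((a # bs @ [z]) ! Suc j))"
  by (induction bs arbitrary: a) (simp_all add: prod.lessThan_Suc_shift del: prod.lessThan_Suc)

text \<open>The trace of the l-th power of the transfer matrix, whose eigenvalues are 1 and
  \<open>delta\<close>.\<close>

lemma sum_cyclic_transfer:
  assumes "l > 0"
  shows "(\<Sum>bs | set bs \<subseteq> UNIV \<and> length bs = l. \<Prod>j<l. transfer (bs ! j) (bs ! (Suc j mod l))) = 1 + delta ^ l"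
proof -
  obtain n where l: "l = Suc n" using assms gr0_implies_Suc by blast
  have cyc: "(\<Prod>j<Suc n. transfer ((a # bs) ! j) ((a # bs) ! (Suc j mod Suc n))) = path_weight a bs a"
    if "length bs = n" for a bs
  proof -
    have nths: "(a # bs) ! j = (a # bs @ [a]) ! j \<and> (a # bs) ! (Suc j mod Suc n) = (a # bs @ [a]) ! Suc j" if "j < Suc n" for j
    proof (cases "Suc j = Suc n")
      case True
      then show ?thesis using \<open>length bs = n\<close> by (simp add: nth_append nth_Cons')
    next
      case False
      then have "j < n" using that by simp
      then show ?thesis using \<open>length bs = n\<close> by (cases j) (simp_all add: nth_append)
    qed
    show ?thesis unfolding path_weight_eq_prod that
      by (intro prod.cong refl arg_cong2[where f=transfer] nths[THEN conjunct1] nths[THEN conjunct2]) simp_all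
  qed
  have "(\<Sum>bs | set bs \<subseteq> UNIV \<and> length bs = l. \<Prod>j<l. transfer (bs ! j) (bs ! (Suc j mod l)))
     = (\<Sum>a\<in>UNIV. \<Sum>bs | set bs \<subseteq> UNIV \<and> length bs = n. path_weight a bs a)"
    unfolding l by (subst sum_lists_Suc, simp, intro sum.cong refl cyc) simp
  also have "\<dots> = (\<Sum>a\<in>UNIV. statdist a + delta ^ Suc n * (1 - statdist a))"
    by (simp only: sum_path_weight refl of_bool_eq)
  also have "\<dots> = 1 + delta ^ l"
  proof -
    have "statdist True + statdist False = 1" using k_real by (simp add: statdist_def field_simps)
    then have sF: "statdist False = 1 - statdist True" by simp
    show ?thesis unfolding UNIV_bool l by (simp add: sF algebra_simps)
  qed
  finally show ?thesis .
qed

text \<open>The cycle uses two distinct copies of the clause. A copy matched to a true variable must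
  be the chosen one and a copy matched to a false variable must not: two true neighbours contradict
  each other, one true neighbour determines the choice, and none leaves \<open>k - 2\<close>
  copies.\<close>

lemma allowed_cycle:
  assumes c: "is_cycle xs" and j: "j < length xs" and ports: "\<forall>s\<in>set xs. bin s < k \<and> bout s < k"
  shows "real (allowed (edges xs) \<tau> (cl (xs ! j))) =
    (let a = vr (xs ! j) \<in> \<tau>; b = vr (xs ! cyc_next xs j) \<in> \<tau> in if a \<and> b then 0 else if a \<or> b then 1 else real k - 2)"
proof -
  let ?a = "vr (xs ! j) \<in> \<tau>" and ?b = "vr (xs ! cyc_next xs j) \<in> \<tau>"
  have e1: "((vr (xs ! j), aout (xs ! j)), (cl (xs ! j), bin (xs ! j))) \<in> edges xs" by (rule edge_aout[OF c j])
  have e2: "((vr (xs ! cyc_next xs j), ain (xs ! cyc_next xs j)), (cl (xs ! j), bout (xs ! j))) \<in> edges xs"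
    using edge_in_in_edges[OF c j] by (simp add: edge_in_def)
  have set: "{b. b < k \<and> (\<forall>p b'. (p, (cl (xs ! j), b')) \<in> edges xs \<longrightarrow> (fst p \<in> \<tau> \<longleftrightarrow> b = b'))} =
     {b. b < k \<and> (?a \<longleftrightarrow> b = bin (xs ! j)) \<and> (?b \<longleftrightarrow> b = bout (xs ! j))}"
  proof (intro Collect_cong conj_cong refl iffI)
    fix b assume "\<forall>p b'. (p, (cl (xs ! j), b')) \<in> edges xs \<longrightarrow> (fst p \<in> \<tau> \<longleftrightarrow> b = b')"
    then show "(?a \<longleftrightarrow> b = bin (xs ! j)) \<and> (?b \<longleftrightarrow> b = bout (xs ! j))" using e1 e2 by fastforce
  next
    fix b assume h: "(?a \<longleftrightarrow> b = bin (xs ! j)) \<and> (?b \<longleftrightarrow> b = bout (xs ! j))"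
    show "\<forall>p b'. (p, (cl (xs ! j), b')) \<in> edges xs \<longrightarrow> (fst p \<in> \<tau> \<longleftrightarrow> b = b')"
    proof (intro allI impI)
      fix p b' assume "(p, (cl (xs ! j), b')) \<in> edges xs"
      from cl_port_cases[OF c this j] show "fst p \<in> \<tau> \<longleftrightarrow> b = b'" using h by auto
    qed
  qed
  have b: "bin (xs ! j) < k" "bout (xs ! j) < k" "bin (xs ! j) \<noteq> bout (xs ! j)"
    using ports j ports_neq(2)[OF c j] by auto
  consider "?a" "?b" | "?a" "\<not> ?b" | "\<not> ?a" "?b" | "\<not> ?a" "\<not> ?b" by blast
  then show ?thesis
  proof cases
    case 1
    then have "{b. b < k \<and> (?a \<longleftrightarrow> b = bin (xs ! j)) \<and> (?b \<longleftrightarrow> b = bout (xs ! j))} = {}" using b by auto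
    then show ?thesis using 1 unfolding allowed_def set by simp
  next
    case 2
    then have "{b. b < k \<and> (?a \<longleftrightarrow> b = bin (xs ! j)) \<and> (?b \<longleftrightarrow> b = bout (xs ! j))} = {bin (xs ! j)}" using b by auto
    then show ?thesis using 2 unfolding allowed_def set by simp
  next
    case 3
    then have "{b. b < k \<and> (?a \<longleftrightarrow> b = bin (xs ! j)) \<and> (?b \<longleftrightarrow> b = bout (xs ! j))} = {bout (xs ! j)}" using b by auto
    then show ?thesis using 3 unfolding allowed_def set by simp
  next
    case 4
    then have e: "{b. b < k \<and> (?a \<longleftrightarrow> b = bin (xs ! j)) \<and> (?b \<longleftrightarrow> b = bout (xs ! j))} = {..<k} - {bin (xs ! j), bout (xs ! j)}" using b by auto
    have "card {bin (xs ! j), bout (xs ! j)} = 2" using b by simp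
    then have "card ({..<k} - {bin (xs ! j), bout (xs ! j)}) = k - 2" using b by (subst card_Diff_subset) auto
    then show ?thesis using 4 k_gt_2 unfolding allowed_def set e by simp
  qed
qed

text \<open>A subset \<tau> of the variables is the same as a list of truth values round the cycle,
  and the weight of \<tau> becomes a cyclic product of transfer weights.\<close>

lemma Zsum_cycle:
  assumes c: "is_cycle xs" and ports: "\<forall>s\<in>set xs. bin s < k \<and> bout s < k"
  shows "Zsum (edges xs) (vars xs) (cls xs) = 1 + delta ^ length xs"
proof -
  let ?l = "length xs"
  have term_eq: "(1 / (real k - 1)) ^ (card (vars xs) - card \<tau>) * (\<Prod>c\<in>cls xs. real (allowed (edges xs) \<tau> c))
     = (\<Prod>j<?l. transfer (vr (xs ! j) \<in> \<tau>) (vr (xs ! cyc_next xs j) \<in> \<tau>))" if \<tau>: "\<tau> \<subseteq> vars xs" for \<tau>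
  proof -
    have f\<tau>: "finite \<tau>" using \<tau> by (rule finite_subset) simp
    have "(1 / (real k - 1)) ^ (card (vars xs) - card \<tau>) = (\<Prod>v\<in>vars xs - \<tau>. 1 / (real k - 1))"
      using \<tau> f\<tau> by (simp add: card_Diff_subset)
    also have "\<dots> = (\<Prod>v\<in>vars xs. if v \<in> \<tau> then 1 else 1 / (real k - 1))"
      by (rule prod.mono_neutral_cong_left) auto
    also have "\<dots> = (\<Prod>j<?l. if vr (xs ! j) \<in> \<tau> then 1 else 1 / (real k - 1))"
      unfolding vars_nth[OF c] by (subst prod.reindex) (auto intro!: inj_onI vr_inj[OF c])
    finally have 1: "(1 / (real k - 1)) ^ (card (vars xs) - card \<tau>) = (\<Prod>j<?l. if vr (xs ! j) \<in> \<tau> then 1 else 1 / (real k - 1))" .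
    have "(\<Prod>c\<in>cls xs. real (allowed (edges xs) \<tau> c)) = (\<Prod>j<?l. real (allowed (edges xs) \<tau> (cl (xs ! j))))"
      unfolding cls_nth[OF c] by (subst prod.reindex) (auto intro!: inj_onI cl_inj[OF c])
    also have "\<dots> = (\<Prod>j<?l. if vr (xs ! j) \<in> \<tau> \<and> vr (xs ! cyc_next xs j) \<in> \<tau> then 0 else if vr (xs ! j) \<in> \<tau> \<or> vr (xs ! cyc_next xs j) \<in> \<tau> then 1 else real k - 2)"
      by (intro prod.cong refl) (simp add: allowed_cycle[OF c _ ports] Let_def)
    finally show ?thesis unfolding 1 transfer_def prod.distrib by simp
  qed
  have "Zsum (edges xs) (vars xs) (cls xs) = (\<Sum>\<tau>\<in>Pow (vars xs). \<Prod>j<?l. transfer (vr (xs ! j) \<in> \<tau>) (vr (xs ! cyc_next xs j) \<in> \<tau>))"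
    unfolding Zsum_def by (intro sum.cong refl term_eq) auto
  also have "\<dots> = (\<Sum>bs | set bs \<subseteq> UNIV \<and> length bs = ?l. \<Prod>j<?l. transfer (bs ! j) (bs ! (Suc j mod ?l)))"
  proof (rule sum.reindex_bij_witness[where j = "\<lambda>\<tau>. map (\<lambda>s. vr s \<in> \<tau>) xs" and i = "\<lambda>bs. {vr (xs ! j) |j. j < ?l \<and> bs ! j}"])
    fix \<tau> assume \<tau>: "\<tau> \<in> Pow (vars xs)"
    show "{vr (xs ! j) |j. j < ?l \<and> map (\<lambda>s. vr s \<in> \<tau>) xs ! j} = \<tau>"
    proof (intro subset_antisym subsetI)
      fix x assume x: "x \<in> \<tau>"
      then obtain j where "j < ?l" "x = vr (xs ! j)" using \<tau> by (auto simp: vars_nth[OF c])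
      then show "x \<in> {vr (xs ! j) |j. j < ?l \<and> map (\<lambda>s. vr s \<in> \<tau>) xs ! j}" using x by auto
    qed auto
    show "(\<Prod>j<?l. transfer (map (\<lambda>s. vr s \<in> \<tau>) xs ! j) (map (\<lambda>s. vr s \<in> \<tau>) xs ! (Suc j mod ?l))) = (\<Prod>j<?l. transfer (vr (xs ! j) \<in> \<tau>) (vr (xs ! cyc_next xs j) \<in> \<tau>))"
      using cyc_next_less[OF cycle_nonempty[OF c]] by (intro prod.cong refl) (auto simp: cyc_next_def)
  next
    fix bs assume "bs \<in> {bs. set bs \<subseteq> (UNIV::bool set) \<and> length bs = ?l}"
    then have bs: "length bs = ?l" by simp
    show "{vr (xs ! j) |j. j < ?l \<and> bs ! j} \<in> Pow (vars xs)" by (auto simp: vars_nth[OF c])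
    show "map (\<lambda>s. vr s \<in> {vr (xs ! j) |j. j < ?l \<and> bs ! j}) xs = bs"
      by (rule nth_equalityI) (use bs vr_inj[OF c] in auto)
  qed simp
  also have "\<dots> = 1 + delta ^ ?l" by (rule sum_cyclic_transfer[OF cycle_length_pos[OF c]])
  finally show ?thesis .
qed

section \<open>The number of cycles of a given length\<close>

definition alphabet :: "nat \<Rightarrow> step set" where
  "alphabet r = ({..<k*r} \<times> {..<d} \<times> {..<d}) \<times> ({..<d*r} \<times> {..<k} \<times> {..<k})"

definition cycles :: "nat \<Rightarrow> nat \<Rightarrow> step list set" where
  "cycles r l = {xs. set xs \<subseteq> alphabet r \<and> length xs = l \<and> canonical xs}"

text \<open>The limiting expected number of cycles of length \<open>l\<close>; planting an assignment multiplies it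
  by \<open>1 + delta ^ l\<close>.\<close>

definition lam :: "nat \<Rightarrow> real" where
  "lam l = ((real d - 1) * (real k - 1)) ^ l / (2 * real l)"

lemma finite_alphabet [simp]: "finite (alphabet r)" by (simp add: alphabet_def)

lemma finite_cycles [simp]: "finite (cycles r l)"
  by (rule finite_subset[OF _ finite_lists_length_eq[OF finite_alphabet[of r], of l]]) (auto simp: cycles_def)

lemma alphabet_iff: "s \<in> alphabet r \<longleftrightarrow> vr s < k*r \<and> aout s < d \<and> ain s < d \<and> cl s < d*r \<and> bin s < k \<and> bout s < k"
  by (cases s) (auto simp: alphabet_def vr_def aout_def ain_def cl_def bin_def bout_def)

definition ports :: "step \<Rightarrow> (nat \<times> nat) \<times> (nat \<times> nat)" where
  "ports s = ((aout s, ain s), (bin s, bout s))"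

definition mk_step :: "nat \<Rightarrow> nat \<Rightarrow> (nat \<times> nat) \<times> (nat \<times> nat) \<Rightarrow> step" where
  "mk_step v c p = ((v, fst (fst p), snd (fst p)), (c, fst (snd p), snd (snd p)))"

lemma mk_step_simps: "vr (mk_step v c p) = v" "cl (mk_step v c p) = c" "ports (mk_step v c p) = p"
   "aout (mk_step v c p) = fst (fst p)" "ain (mk_step v c p) = snd (fst p)" "bin (mk_step v c p) = fst (snd p)" "bout (mk_step v c p) = snd (snd p)"
   "mk_step (vr s) (cl s) (ports s) = s"
  by (auto simp: mk_step_def vr_def cl_def ports_def aout_def ain_def bin_def bout_def)

lemma card_cycles:
  "card (cycles r (Suc l)) = (fact l * ((k*r) choose Suc l)) * (fact (Suc l) * ((d*r) choose Suc l)) *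
     ((d * (d-1) div 2) * (k * (k-1)) * (d * (d-1) * (k * (k-1))) ^ l)"
proof -
  define VL where "VL = {vs. length vs = Suc l \<and> distinct vs \<and> set vs \<subseteq> {..<k*r} \<and> (\<forall>v\<in>set vs. hd vs \<le> v)}"
  define CL where "CL = {cs. length cs = Suc l \<and> distinct cs \<and> set cs \<subseteq> {..<d*r}}"
  define DP where "DP n = (SIGMA a:{..<n}. {..<n} - {a})" for n :: nat
  define LP where "LP n = {(a, a'). a < a' \<and> a' < n}" for n :: nat
  define PL where "PL = {ps. length ps = Suc l \<and> set ps \<subseteq> DP d \<times> DP k \<and> fst (hd ps) \<in> LP d}"
  have "bij_betw (\<lambda>xs. (map vr xs, map cl xs, map ports xs)) (cycles r (Suc l)) (VL \<times> CL \<times> PL)"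
  proof (rule bij_betw_byWitness[where f' = "\<lambda>(vs, cs, ps). map (\<lambda>j. mk_step (vs ! j) (cs ! j) (ps ! j)) [0..<Suc l]"])
    show "\<forall>xs\<in>cycles r (Suc l). (\<lambda>(vs, cs, ps). map (\<lambda>j. mk_step (vs ! j) (cs ! j) (ps ! j)) [0..<Suc l]) (map vr xs, map cl xs, map ports xs) = xs"
    proof
      fix xs assume "xs \<in> cycles r (Suc l)"
      then have len: "length xs = Suc l" by (simp add: cycles_def)
      show "(\<lambda>(vs, cs, ps). map (\<lambda>j. mk_step (vs ! j) (cs ! j) (ps ! j)) [0..<Suc l]) (map vr xs, map cl xs, map ports xs) = xs"
        unfolding prod.case by (rule nth_equalityI) (use len in \<open>simp_all add: mk_step_simps del: upt_Suc\<close>)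
    qed
    show "\<forall>t\<in>VL \<times> CL \<times> PL. (\<lambda>xs. (map vr xs, map cl xs, map ports xs)) ((\<lambda>(vs, cs, ps). map (\<lambda>j. mk_step (vs ! j) (cs ! j) (ps ! j)) [0..<Suc l]) t) = t"
    proof
      fix t assume "t \<in> VL \<times> CL \<times> PL"
      then obtain vs cs ps where t: "t = (vs, cs, ps)" and "vs \<in> VL" "cs \<in> CL" "ps \<in> PL" by (cases t) auto
      then have len: "length vs = Suc l" "length cs = Suc l" "length ps = Suc l" by (auto simp: VL_def CL_def PL_def)
      have nth: "map (\<lambda>j. ys ! j) [0..<Suc l] = ys" if "length ys = Suc l" for ys :: "'z list"
        using map_nth[of ys] that by simp
      show "(\<lambda>xs. (map vr xs, map cl xs, map ports xs)) ((\<lambda>(vs, cs, ps). map (\<lambda>j. mk_step (vs ! j) (cs ! j) (ps ! j)) [0..<Suc l]) t) = t"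
        unfolding t prod.case map_map o_def mk_step_simps nth[OF len(1)] nth[OF len(2)] nth[OF len(3)] by (rule refl)
    qed
    show "(\<lambda>xs. (map vr xs, map cl xs, map ports xs)) ` cycles r (Suc l) \<subseteq> VL \<times> CL \<times> PL"
    proof (rule image_subsetI)
      fix xs assume "xs \<in> cycles r (Suc l)"
      then have xs: "length xs = Suc l" "\<And>s. s \<in> set xs \<Longrightarrow> s \<in> alphabet r" "is_cycle xs" "\<forall>s\<in>set xs. vr (hd xs) \<le> vr s" "aout (hd xs) < ain (hd xs)"
        by (auto simp: cycles_def canonical_def)
      have ne: "xs \<noteq> []" using xs(1) by auto
      have hd: "hd (map f xs) = f (hd xs)" for f :: "step \<Rightarrow> 'z" using ne by (simp add: hd_map)
      have "map vr xs \<in> VL" unfolding VL_def hd using xs by (auto simp: is_cycle_def alphabet_iff hd)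
      moreover have "map cl xs \<in> CL" unfolding CL_def using xs by (auto simp: is_cycle_def alphabet_iff)
      moreover have "map ports xs \<in> PL" unfolding PL_def mem_Collect_eq hd
        using xs hd_in_set[OF ne] by (auto simp: is_cycle_def alphabet_iff ports_def DP_def LP_def)
      ultimately show "(map vr xs, map cl xs, map ports xs) \<in> VL \<times> CL \<times> PL" by blast
    qed
    show "(\<lambda>(vs, cs, ps). map (\<lambda>j. mk_step (vs ! j) (cs ! j) (ps ! j)) [0..<Suc l]) ` (VL \<times> CL \<times> PL) \<subseteq> cycles r (Suc l)"
    proof (rule image_subsetI)
      fix t assume "t \<in> VL \<times> CL \<times> PL"
      then obtain vs cs ps where t: "t = (vs, cs, ps)" and a: "vs \<in> VL" "cs \<in> CL" "ps \<in> PL" by (cases t) auto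
      then have len: "length vs = Suc l" "length cs = Suc l" "length ps = Suc l" by (auto simp: VL_def CL_def PL_def)
      define xs where "xs = map (\<lambda>j. mk_step (vs ! j) (cs ! j) (ps ! j)) [0..<Suc l]"
      have nth: "map (\<lambda>j. ys ! j) [0..<Suc l] = ys" if "length ys = Suc l" for ys :: "'z list"
        using map_nth[of ys] that by simp
      have m: "map vr xs = vs" "map cl xs = cs" "map ports xs = ps"
        unfolding xs_def map_map o_def mk_step_simps nth[OF len(1)] nth[OF len(2)] nth[OF len(3)] by (rule refl)+
      have lx: "length xs = Suc l" by (simp add: xs_def)
      have ne: "xs \<noteq> []" using lx by auto
      have hd: "hd vs = vr (hd xs)" "hd ps = ports (hd xs)" using m ne by (auto simp: hd_map[symmetric])
      have s: "vr s \<in> set vs" "cl s \<in> set cs" "ports s \<in> set ps" if "s \<in> set xs" for s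
        unfolding m[symmetric] using that by simp_all
      have pd: "ports s \<in> DP d \<times> DP k" if "s \<in> set xs" for s using s(3)[OF that] a by (auto simp: PL_def)
      have "set xs \<subseteq> alphabet r"
      proof
        fix s assume "s \<in> set xs"
        with s[OF this] pd[OF this] a show "s \<in> alphabet r"
          unfolding alphabet_iff by (auto simp: VL_def CL_def DP_def ports_def)
      qed
      moreover have "aout s \<noteq> ain s \<and> bin s \<noteq> bout s" if "s \<in> set xs" for s
        using pd[OF that] by (auto simp: DP_def ports_def)
      then have "is_cycle xs" unfolding is_cycle_def m using ne a by (auto simp: VL_def CL_def)
      moreover have "\<forall>s\<in>set xs. vr (hd xs) \<le> vr s" using a s(1) unfolding VL_def hd(1)[symmetric] by blast
      moreover have "aout (hd xs) < ain (hd xs)" using a hd by (auto simp: PL_def LP_def ports_def)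
      ultimately have "xs \<in> cycles r (Suc l)" using lx by (simp add: cycles_def canonical_def)
      then show "(\<lambda>(vs, cs, ps). map (\<lambda>j. mk_step (vs ! j) (cs ! j) (ps ! j)) [0..<Suc l]) t \<in> cycles r (Suc l)"
        unfolding t prod.case xs_def .
    qed
  qed
  then have "card (cycles r (Suc l)) = card VL * (card CL * card PL)"
    by (simp add: bij_betw_same_card card_cartesian_product)
  moreover have "card VL = fact l * ((k*r) choose Suc l)"
    unfolding VL_def by (rule card_distinct_lists_min_first)
  moreover have "card CL = fact (Suc l) * ((d*r) choose Suc l)"
    unfolding CL_def by (subst card_distinct_lists) auto
  moreover have "card PL = (d * (d-1) div 2) * (k * (k-1)) * (d * (d-1) * (k * (k-1))) ^ l"
  proof -
    have cDP: "card (DP n) = n * (n - 1)" for n unfolding DP_def by (subst card_SigmaI) (auto simp: card_Diff_subset)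
    have fDP: "finite (DP n)" for n by (auto simp: DP_def)
    have cLP: "card (LP n) = n * (n - 1) div 2" for n
    proof -
      have "LP n = prod.swap ` (SIGMA a':{..<n}. {..<a'})" by (auto simp: LP_def image_iff)
      then have "card (LP n) = card (SIGMA a':{..<n}. {..<a'})" by (simp add: card_image)
      also have "\<dots> = \<Sum>{..<n}" by (subst card_SigmaI) auto
      also have "\<dots> = n * (n - 1) div 2" by (simp add: lessThan_atLeast0 Sum_Ico_nat)
      finally show ?thesis .
    qed
    have LD: "LP n \<subseteq> DP n" for n by (auto simp: LP_def DP_def)
    have "PL = (\<lambda>(p, ps). p # ps) ` ((LP d \<times> DP k) \<times> {ps. set ps \<subseteq> DP d \<times> DP k \<and> length ps = l})"
      using LD by (fastforce simp: PL_def length_Suc_conv image_iff)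
    then have "card PL = card ((LP d \<times> DP k) \<times> {ps. set ps \<subseteq> DP d \<times> DP k \<and> length ps = l})"
      by (simp add: card_image inj_on_def)
    also have "\<dots> = (d * (d-1) div 2) * (k * (k-1)) * (d * (d-1) * (k * (k-1))) ^ l"
      using fDP by (simp add: card_cartesian_product card_lists_length_eq cLP cDP)
    finally show ?thesis .
  qed
  ultimately show ?thesis by (simp add: mult.assoc)
qed

lemma fact_choose_asymp:
  assumes "c > 0"
  shows "(\<lambda>r. fact j * real ((c*r) choose j) / real (c*r) ^ j) \<longlonglongrightarrow> 1"
proof -
  have "filterlim (\<lambda>r. c * r) at_top sequentially"
    using assms by (intro filterlim_subseq) (auto simp: strict_mono_def)
  from filterlim_compose[OF falling_factorial_asymp this]
  have "(\<lambda>r. fact (c*r) / (fact (c*r - j) * real (c*r) ^ j)) \<longlonglongrightarrow> (1::real)" .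
  moreover have "\<forall>\<^sub>F r in sequentially. fact (c*r) / (fact (c*r - j) * real (c*r) ^ j) = fact j * real ((c*r) choose j) / real (c*r) ^ j"
    using eventually_ge_at_top[of j]
  proof eventually_elim
    case (elim r)
    have "j \<le> c * r" using elim assms by (metis le_trans mult_le_mono1 nat_mult_1 One_nat_def Suc_leI)
    from binomial_fact[OF this, where ?'a=real] show ?case by simp
  qed
  ultimately show ?thesis by (rule Lim_transform_eventually)
qed

text \<open>Rooting at the least variable accounts for 1 / l and the orientation for 1 / 2. Of the d
  (d - 1) k (k - 1) ports per step, a factor d k is absorbed by \<open>N r\<close>, as the square of
  \<open>N r\<close> is the product of \<open>k * r\<close>, \<open>d * r\<close> and
  \<open>d * k\<close>.\<close>

lemma card_cycles_asymp:
  assumes "l > 0"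
  shows "(\<lambda>r. real (card (cycles r l)) / real (N r) ^ (2*l)) \<longlonglongrightarrow> lam l"
proof -
  obtain l' where l: "l = Suc l'" using assms gr0_implies_Suc by blast
  define q where "q = (real d * (real d - 1) / 2) * (real k * (real k - 1)) * (real d * (real d - 1) * (real k * (real k - 1))) ^ l'"
  have d1: "real (d - 1) = real d - 1" "real (k - 1) = real k - 1" using d_pos k_gt_2 by auto
  have half: "real (d * (d-1) div 2) = real d * (real d - 1) / 2"
  proof -
    have "2 dvd d * (d-1)" by (cases d) auto
    then have "real (d * (d-1) div 2) = real (d * (d-1)) / 2" using real_of_nat_div[of 2 "d*(d-1)"] by simp
    then show ?thesis by (simp only: of_nat_mult d1)
  qed
  have cc: "real (card (cycles r l)) = (fact l * real ((k*r) choose l)) / real l * (fact l * real ((d*r) choose l)) * q" for r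
  proof -
    have "(fact l :: real) / real l = fact l'" unfolding l by (simp del: of_nat_Suc)
    then have "real (card (cycles r l)) = ((fact l / real l) * real ((k*r) choose l)) * (fact l * real ((d*r) choose l)) * q"
      unfolding l card_cycles q_def by (simp only: of_nat_mult of_nat_power of_nat_fact half d1 mult.assoc)
    then show ?thesis by (simp only: times_divide_eq_left)
  qed
  have k0: "k > 0" using k_gt_2 by simp
  have "(\<lambda>r. (fact l * real ((k*r) choose l) / real (k*r) ^ l) * (fact l * real ((d*r) choose l) / real (d*r) ^ l) * (q / (real l * (real d * real k) ^ l))) \<longlonglongrightarrow> 1 * 1 * (q / (real l * (real d * real k) ^ l))"
    by (intro tendsto_mult fact_choose_asymp tendsto_const k0 d_pos)
  moreover have "\<forall>\<^sub>F r in sequentially. (fact l * real ((k*r) choose l) / real (k*r) ^ l) * (fact l * real ((d*r) choose l) / real (d*r) ^ l) * (q / (real l * (real d * real k) ^ l)) = real (card (cycles r l)) / real (N r) ^ (2*l)"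
    using eventually_gt_at_top[of 0]
  proof eventually_elim
    case (elim r)
    have "real (N r) ^ (2*l) = (real (k*r) * real (d*r) * (real d * real k)) ^ l"
    proof -
      have "real (N r) ^ (2*l) = ((real (N r))\<^sup>2) ^ l" by (simp only: power_mult)
      also have "(real (N r))\<^sup>2 = real (k*r) * real (d*r) * (real d * real k)"
        by (simp add: N_def power2_eq_square)
      finally show ?thesis .
    qed
    then show ?case unfolding cc by (simp add: power_mult_distrib)
  qed
  ultimately have "(\<lambda>r. real (card (cycles r l)) / real (N r) ^ (2*l)) \<longlonglongrightarrow> 1 * 1 * (q / (real l * (real d * real k) ^ l))"
    by (rule Lim_transform_eventually)
  moreover have "1 * 1 * (q / (real l * (real d * real k) ^ l)) = lam l"
  proof -
    have "q = (real d * (real d - 1) * (real k * (real k - 1))) ^ l / 2" by (simp add: q_def l)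
    also have "real d * (real d - 1) * (real k * (real k - 1)) = (real d * real k) * ((real d - 1) * (real k - 1))"
      by (simp add: mult_ac)
    finally have q: "q = (real d * real k) ^ l * ((real d - 1) * (real k - 1)) ^ l / 2" by (simp only: power_mult_distrib)
    have nz: "(real d * real k) ^ l \<noteq> 0" using d_pos k_gt_2 by simp
    have "A * B / 2 / (c * A) = B / (2 * c)" if "A \<noteq> 0" for A B c :: real using that by simp
    from this[OF nz] show ?thesis unfolding lam_def q by simp
  qed
  ultimately show ?thesis by simp
qed

end

section \<open>Tuples of cycles\<close>

text \<open>The vertices in H weigh 1 each but are at most h in number; the others number at most x
  and weigh \<open>1 / x\<close> each.\<close>

lemma sum_new_vertex_le:
  fixes n :: nat and H :: "'a set" and g :: "nat \<Rightarrow> 'a"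
  assumes "finite H" "inj g" "real n \<le> x" "x > 0" "card H \<le> h"
  shows "(\<Sum>v<n. (1/x) ^ (if g v \<in> H then 0 else 1)) \<le> real h + 1"
proof -
  have "(\<Sum>v<n. (1/x) ^ (if g v \<in> H then 0 else 1)) \<le> (\<Sum>v<n. of_bool (g v \<in> H) + 1/x)"
    using assms by (intro sum_mono) auto
  also have "\<dots> = real (card {v\<in>{..<n}. g v \<in> H}) + real n / x"
    by (simp add: sum.distrib of_bool_def sum.If_cases Int_def)
  also have "card {v\<in>{..<n}. g v \<in> H} \<le> card H"
    using assms by (intro card_inj_on_le[of g]) (auto intro: inj_on_subset)
  also have "real n / x \<le> 1" using assms by simp
  finally show ?thesis using assms by simp
qed

lemma sum_distinct_lists_prod:
  fixes g :: "'a \<Rightarrow> real"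
  assumes A: "finite A"
  shows "(\<Sum>xs | set xs \<subseteq> A \<and> length xs = s \<and> distinct xs. prod_list (map g xs)) = fact s * (\<Sum>S | S \<subseteq> A \<and> card S = s. prod g S)"
proof -
  let ?X = "{xs. set xs \<subseteq> A \<and> length xs = s \<and> distinct xs}"
  have fin: "finite ?X" by (rule finite_subset[OF _ finite_lists_length_eq[OF A, of s]]) auto
  have "(\<Sum>xs\<in>?X. prod_list (map g xs)) = (\<Sum>S | S \<subseteq> A \<and> card S = s. \<Sum>xs\<in>{xs\<in>?X. set xs = S}. prod_list (map g xs))"
    using fin A by (intro sum.group[symmetric]) (auto simp: distinct_card)
  also have "\<dots> = (\<Sum>S | S \<subseteq> A \<and> card S = s. fact s * prod g S)"
  proof (intro sum.cong refl)
    fix S assume "S \<in> {S. S \<subseteq> A \<and> card S = s}"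
    then have S: "S \<subseteq> A" "card S = s" by auto
    have fS: "finite S" using S A by (auto intro: finite_subset)
    have "{xs\<in>?X. set xs = S} = {xs. length xs = s \<and> distinct xs \<and> set xs \<subseteq> S}"
    proof (intro subset_antisym subsetI)
      fix xs assume "xs \<in> {xs. length xs = s \<and> distinct xs \<and> set xs \<subseteq> S}"
      then have xs: "length xs = s" "distinct xs" "set xs \<subseteq> S" by auto
      then have "set xs = S" using S fS by (intro card_subset_eq) (auto simp: distinct_card)
      then show "xs \<in> {xs\<in>?X. set xs = S}" using xs S by auto
    qed auto
    then have "card {xs\<in>?X. set xs = S} = fact s"
      using card_distinct_lists[OF fS, of s] S by simp
    moreover have "(\<Sum>xs\<in>{xs\<in>?X. set xs = S}. prod_list (map g xs)) = (\<Sum>xs\<in>{xs\<in>?X. set xs = S}. prod g S)"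
      by (intro sum.cong refl) (auto simp: prod.distinct_set_conv_list)
    ultimately show "(\<Sum>xs\<in>{xs\<in>?X. set xs = S}. prod_list (map g xs)) = fact s * prod g S" by simp
  qed
  finally show ?thesis by (simp add: sum_distrib_left)
qed

lemma sum_lists_prod_power:
  fixes g :: "'a \<Rightarrow> real"
  assumes "finite A"
  shows "(\<Sum>xs | set xs \<subseteq> A \<and> length xs = s. prod_list (map g xs)) = (\<Sum>x\<in>A. g x) ^ s"
proof (induction s)
  case 0
  have "{xs. set xs \<subseteq> A \<and> length xs = 0} = {[]}" by auto
  then show ?case by simp
next
  case (Suc s)
  show ?case
    by (subst sum_lists_Suc[OF assms]) (simp add: Suc.IH sum_distrib_right flip: sum_distrib_left)
qed

definition uverts :: "step list list \<Rightarrow> (nat + nat) set" where "uverts \<gamma>s = \<Union>(verts ` set \<gamma>s)"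
definition uedges :: "step list list \<Rightarrow> edge set" where "uedges \<gamma>s = \<Union>(edges ` set \<gamma>s)"
definition tlen :: "step list list \<Rightarrow> nat" where "tlen \<gamma>s = sum_list (map length \<gamma>s)"
definition vdisjoint :: "step list list \<Rightarrow> bool" where
  "vdisjoint \<gamma>s \<longleftrightarrow> sorted_wrt (\<lambda>x y. verts x \<inter> verts y = {}) \<gamma>s"
text \<open>A mere repetition of a cycle is not bad. A tuple of distinct cycles is thus either bad
  or \<open>vdisjoint\<close>, and concatenating bad tuples gives a bad tuple even if cycles
  repeat.\<close>

definition bad :: "step list list \<Rightarrow> bool" where
  "bad \<gamma>s \<longleftrightarrow> (\<exists>x\<in>set \<gamma>s. \<exists>y\<in>set \<gamma>s. x \<noteq> y \<and> verts x \<inter> verts y \<noteq> {})"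

lemma uverts_simps [simp]: "uverts [] = {}" "uverts (x # xs) = verts x \<union> uverts xs"
  and uedges_simps [simp]: "uedges [] = {}" "uedges (x # xs) = edges x \<union> uedges xs"
  and tlen_simps [simp]: "tlen [] = 0" "tlen (x # xs) = length x + tlen xs"
  by (auto simp: uverts_def uedges_def tlen_def)

lemma finite_uverts [simp]: "finite (uverts \<gamma>s)" and finite_uedges [simp]: "finite (uedges \<gamma>s)"
  by (auto simp: uverts_def uedges_def)

lemma vdisjoint_Cons: "vdisjoint (x # xs) \<longleftrightarrow> verts x \<inter> uverts xs = {} \<and> vdisjoint xs"
  by (auto simp: vdisjoint_def uverts_def)

lemma card_uverts:
  assumes "\<And>x. x \<in> set \<gamma>s \<Longrightarrow> is_cycle x"
  shows "card (uverts \<gamma>s) \<le> 2 * tlen \<gamma>s" "\<not> vdisjoint \<gamma>s \<Longrightarrow> card (uverts \<gamma>s) < 2 * tlen \<gamma>s"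
proof -
  have "card (uverts \<gamma>s) \<le> 2 * tlen \<gamma>s \<and> (\<not> vdisjoint \<gamma>s \<longrightarrow> card (uverts \<gamma>s) < 2 * tlen \<gamma>s)"
    using assms
  proof (induction \<gamma>s)
    case Nil
    then show ?case by (simp add: vdisjoint_def)
  next
    case (Cons x xs)
    have IH: "card (uverts xs) \<le> 2 * tlen xs" "\<not> vdisjoint xs \<Longrightarrow> card (uverts xs) < 2 * tlen xs" using Cons by auto
    have cx: "card (verts x) = 2 * length x" using card_verts Cons.prems by simp
    have ui: "card (verts x) + card (uverts xs) = card (verts x \<union> uverts xs) + card (verts x \<inter> uverts xs)"
      by (rule card_Un_Int) auto
    show ?case
    proof (cases "verts x \<inter> uverts xs = {}")
      case True
      then show ?thesis using IH cx ui by (auto simp: vdisjoint_Cons)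
    next
      case False
      then have "card (verts x \<inter> uverts xs) > 0" by (simp add: card_gt_0_iff)
      then have "card (uverts (x # xs)) < 2 * tlen (x # xs)" unfolding uverts_simps tlen_simps
      proof -
        have arith: "0 < c \<Longrightarrow> u \<le> 2 * t \<Longrightarrow> v = 2 * l \<Longrightarrow> v + u = w + c \<Longrightarrow> w < 2 * (l + t)" for c u t v l w :: nat
          by presburger
        show "0 < card (verts x \<inter> uverts xs) \<Longrightarrow> card (verts x \<union> uverts xs) < 2 * (length x + tlen xs)"
          by (rule arith[OF _ IH(1) cx ui])
      qed
      then show ?thesis by simp
    qed
  qed
  then show "card (uverts \<gamma>s) \<le> 2 * tlen \<gamma>s" "\<not> vdisjoint \<gamma>s \<Longrightarrow> card (uverts \<gamma>s) < 2 * tlen \<gamma>s" by auto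
qed

lemma verts_nonempty: "is_cycle x \<Longrightarrow> verts x \<noteq> {}"
  using card_verts cycle_length_pos by fastforce

lemma distinct_not_vdisjoint_bad:
  assumes "distinct \<gamma>s" "\<not> vdisjoint \<gamma>s" shows "bad \<gamma>s"
  using assms
proof (induction \<gamma>s)
  case (Cons x xs)
  show ?case
  proof (cases "vdisjoint xs")
    case True
    then obtain y where "y \<in> set xs" "verts x \<inter> verts y \<noteq> {}" using Cons.prems by (auto simp: vdisjoint_Cons uverts_def)
    moreover have "x \<noteq> y" using Cons.prems calculation by auto
    ultimately show ?thesis unfolding bad_def by (metis list.set_intros)
  next
    case False
    then have "bad xs" using Cons by simp
    then show ?thesis unfolding bad_def by (meson list.set_intros(2))
  qed
qed (simp add: vdisjoint_def)

lemma vdisjoint_distinct: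
  assumes "vdisjoint \<gamma>s" "\<And>x. x \<in> set \<gamma>s \<Longrightarrow> is_cycle x" shows "distinct \<gamma>s"
  using assms
proof (induction \<gamma>s)
  case (Cons x xs)
  have "verts x \<noteq> {}" using verts_nonempty Cons.prems by simp
  then have "x \<notin> set xs" using Cons.prems by (auto simp: vdisjoint_Cons uverts_def)
  then show ?case using Cons by (simp add: vdisjoint_Cons)
qed simp

lemma vdisjoint_not_bad:
  assumes "vdisjoint \<gamma>s" shows "\<not> bad \<gamma>s"
  using assms
proof (induction \<gamma>s)
  case (Cons x xs)
  then have "\<not> bad xs" "\<And>y. y \<in> set xs \<Longrightarrow> verts x \<inter> verts y = {}" by (auto simp: vdisjoint_Cons uverts_def)
  then show ?case unfolding bad_def by (metis Int_commute set_ConsD)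
qed (simp add: bad_def)

lemma card_uverts_le_uedges:
  assumes "\<And>x. x \<in> set \<gamma>s \<Longrightarrow> canonical x" "bad \<gamma>s"
  shows "card (uverts \<gamma>s) < card (uedges \<gamma>s)"
proof -
  obtain x y where "x \<in> set \<gamma>s" "y \<in> set \<gamma>s" "x \<noteq> y" "verts x \<inter> verts y \<noteq> {}" using assms by (auto simp: bad_def)
  then show ?thesis unfolding uverts_def uedges_def
    using card_Union_edges_ge(2)[of "set \<gamma>s" x y] assms by (auto simp: canonical_def)
qed

lemma card_uedges_le:
  assumes "\<And>x. x \<in> set \<gamma>s \<Longrightarrow> is_cycle x"
  shows "card (uedges \<gamma>s) \<le> 2 * tlen \<gamma>s"
  using assms
proof (induction \<gamma>s)
  case (Cons x xs)
  have "card (uedges (x # xs)) \<le> card (edges x) + card (uedges xs)" by (simp add: card_Un_le)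
  then show ?case using Cons card_edges[of x] by auto
qed simp

section \<open>Sums over tuples of short cycles\<close>

context exact_cover
begin

definition short :: "nat \<Rightarrow> nat \<Rightarrow> step list set" where "short L r = (\<Union>l\<in>{1..L}. cycles r l)"
definition tuples :: "nat \<Rightarrow> nat \<Rightarrow> nat \<Rightarrow> step list list set" where
  "tuples L s r = {\<gamma>s. set \<gamma>s \<subseteq> short L r \<and> length \<gamma>s = s}"

lemma finite_short [simp]: "finite (short L r)" by (simp add: short_def)

lemma finite_tuples [simp]: "finite (tuples L s r)"
  unfolding tuples_def by (rule finite_lists_length_eq) simp

lemma short_D:
  assumes "x \<in> short L r"
  shows "canonical x" "is_cycle x" "length x \<le> L" "length x \<ge> 1" "set x \<subseteq> alphabet r" "x \<in> cycles r (length x)"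
  using assms by (auto simp: short_def cycles_def canonical_def)

lemma tlen_le: "\<gamma>s \<in> tuples L s r \<Longrightarrow> tlen \<gamma>s \<le> s * L"
proof (induction \<gamma>s arbitrary: s)
  case (Cons x xs)
  then obtain s' where s: "s = Suc s'" "xs \<in> tuples L s' r" "x \<in> short L r" by (auto simp: tuples_def)
  then show ?case using Cons.IH[OF s(2)] short_D(3)[OF s(3)] by simp
qed (simp add: tuples_def)

lemma N_pos: "r > 0 \<Longrightarrow> N r > 0" using d_pos k_gt_2 by (simp add: N_def)

lemma N_bounds: "real (k*r) \<le> real (N r)" "real (d*r) \<le> real (N r)"
  using d_pos k_gt_2 unfolding of_nat_le_iff by (auto simp: N_def)

lemma sum_alphabet_le:
  assumes "finite H" "card H \<le> h" "r > 0"
  shows "(\<Sum>s\<in>alphabet r. (1 / real (N r)) ^ card ({Inl (vr s), Inr (cl s)} - H)) \<le> (real d * real k)\<^sup>2 * (real h + 1)\<^sup>2"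
proof -
  let ?x = "1 / real (N r)"
  define g where "g v = ?x ^ (if Inl v \<in> H then 0 else 1)" for v
  define g' where "g' c = ?x ^ (if Inr c \<in> H then 0 else 1)" for c
  have "(\<Sum>s\<in>alphabet r. ?x ^ card ({Inl (vr s), Inr (cl s)} - H)) = (\<Sum>s\<in>alphabet r. g (vr s) * g' (cl s))"
  proof (intro sum.cong refl)
    fix s
    have "{Inl (vr s), Inr (cl s)} - H = (if Inl (vr s) \<in> H then {} else {Inl (vr s)}) \<union> (if Inr (cl s) \<in> H then {} else {Inr (cl s)})" by auto
    then have "card ({Inl (vr s), Inr (cl s)} - H) = (if Inl (vr s) \<in> H then 0 else 1) + (if Inr (cl s) \<in> H then 0 else 1)"
      by simp
    then show "?x ^ card ({Inl (vr s), Inr (cl s)} - H) = g (vr s) * g' (cl s)"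
      by (simp only: g_def g'_def power_add)
  qed
  also have "\<dots> = (\<Sum>(a, b)\<in>({..<k*r} \<times> {..<d} \<times> {..<d}) \<times> ({..<d*r} \<times> {..<k} \<times> {..<k}). g (fst a) * g' (fst b))"
    by (simp add: alphabet_def vr_def cl_def case_prod_beta)
  also have "\<dots> = (\<Sum>a\<in>{..<k*r} \<times> {..<d} \<times> {..<d}. g (fst a)) * (\<Sum>b\<in>{..<d*r} \<times> {..<k} \<times> {..<k}. g' (fst b))"
    by (simp only: sum_product sum.cartesian_product)
  also have "(\<Sum>a\<in>{..<k*r} \<times> {..<d} \<times> {..<d}. g (fst a)) = (real d)\<^sup>2 * (\<Sum>v<k*r. g v)"
    using sum.cartesian_product[of "\<lambda>v _. g v" "{..<d} \<times> {..<d}" "{..<k*r}"]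
    by (simp add: case_prod_beta sum_distrib_left power2_eq_square)
  also have "(\<Sum>b\<in>{..<d*r} \<times> {..<k} \<times> {..<k}. g' (fst b)) = (real k)\<^sup>2 * (\<Sum>c<d*r. g' c)"
    using sum.cartesian_product[of "\<lambda>c _. g' c" "{..<k} \<times> {..<k}" "{..<d*r}"]
    by (simp add: case_prod_beta sum_distrib_left power2_eq_square)
  also have "(real d)\<^sup>2 * (\<Sum>v<k*r. g v) * ((real k)\<^sup>2 * (\<Sum>c<d*r. g' c)) \<le> (real d)\<^sup>2 * (real h + 1) * ((real k)\<^sup>2 * (real h + 1))"
    unfolding g_def g'_def using N_bounds N_pos[OF assms(3)] assms
    by (intro mult_mono mult_left_mono sum_new_vertex_le) (auto intro!: sum_nonneg mult_nonneg_nonneg)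
  finally show ?thesis by (simp add: power2_eq_square mult_ac)
qed

lemma verts_Cons: "verts (s # xs) = {Inl (vr s), Inr (cl s)} \<union> verts xs"
  by (auto simp: verts_def vars_def cls_def)

lemma card_Un_Diff: "finite A \<Longrightarrow> finite B \<Longrightarrow> card (A \<union> B - H) = card (A - H) + card (B - (H \<union> A))"
  by (subst card_Un_disjoint[symmetric]) (auto intro!: arg_cong[where f = card])

text \<open>The set H of vertices already seen is arbitrary up to its size, so that the induction
  can add the two vertices of the first step to it. Seen vertices have weight 1 but boundedly many
  candidates, new ones at most \<open>N r\<close> candidates of weight
  \<open>1 / N r\<close>.\<close>

lemma sum_words_bounded:
  "\<exists>K\<ge>0. \<forall>r>0. \<forall>H. finite H \<longrightarrow> card H \<le> h \<longrightarrow>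
     (\<Sum>xs | set xs \<subseteq> alphabet r \<and> length xs = p. (1 / real (N r)) ^ card (verts xs - H)) \<le> K"
proof (induction p arbitrary: h)
  case 0
  have "{xs. set xs \<subseteq> alphabet r \<and> length xs = 0} = {[]}" for r by auto
  then show ?case by (intro exI[of _ 1]) (simp add: verts_def vars_def cls_def Plus_def)
next
  case (Suc p)
  obtain K where K: "K \<ge> 0" "\<And>r H. r > 0 \<Longrightarrow> finite H \<Longrightarrow> card H \<le> h + 2 \<Longrightarrow>
     (\<Sum>xs | set xs \<subseteq> alphabet r \<and> length xs = p. (1 / real (N r)) ^ card (verts xs - H)) \<le> K"
    using Suc[of "h + 2"] by blast
  show ?case
  proof (intro exI[of _ "(real d * real k)\<^sup>2 * (real h + 1)\<^sup>2 * K"] conjI allI impI)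
    fix r H assume r: "r > (0::nat)" and H: "finite (H :: (nat + nat) set)" "card H \<le> h"
    let ?x = "1 / real (N r)"
    have "(\<Sum>xs | set xs \<subseteq> alphabet r \<and> length xs = Suc p. ?x ^ card (verts xs - H))
      = (\<Sum>s\<in>alphabet r. ?x ^ card ({Inl (vr s), Inr (cl s)} - H) * (\<Sum>xs | set xs \<subseteq> alphabet r \<and> length xs = p. ?x ^ card (verts xs - (H \<union> {Inl (vr s), Inr (cl s)}))))"
      unfolding sum_distrib_left
      by (subst sum_lists_Suc, simp, intro sum.cong refl) (simp only: verts_Cons card_Un_Diff finite_verts finite.emptyI finite.insertI power_add)
    also have "\<dots> \<le> (\<Sum>s\<in>alphabet r. ?x ^ card ({Inl (vr s), Inr (cl s)} - H) * K)"
    proof (intro sum_mono mult_left_mono K(2) r)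
      fix s
      have "card (H \<union> {Inl (vr s), Inr (cl s)}) \<le> card H + card {Inl (vr s), Inr (cl s) :: nat + nat}" by (rule card_Un_le)
      then show "card (H \<union> {Inl (vr s), Inr (cl s)}) \<le> h + 2" using H by simp
    qed (use H in auto)
    also have "\<dots> \<le> (real d * real k)\<^sup>2 * (real h + 1)\<^sup>2 * K"
      unfolding sum_distrib_right[symmetric] by (intro mult_right_mono sum_alphabet_le H r K)
    finally show "(\<Sum>xs | set xs \<subseteq> alphabet r \<and> length xs = Suc p. ?x ^ card (verts xs - H)) \<le> (real d * real k)\<^sup>2 * (real h + 1)\<^sup>2 * K" .
  qed (use K in simp)
qed

lemma sum_short_bounded:
  "\<exists>K\<ge>0. \<forall>r>0. \<forall>H. finite H \<longrightarrow> card H \<le> h \<longrightarrow> (\<Sum>x\<in>short L r. (1 / real (N r)) ^ card (verts x - H)) \<le> K"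
proof -
  define bnd where "bnd p K \<longleftrightarrow> K \<ge> 0 \<and> (\<forall>r>0. \<forall>H. finite H \<longrightarrow> card H \<le> h \<longrightarrow>
     (\<Sum>xs | set xs \<subseteq> alphabet r \<and> length xs = p. (1 / real (N r)) ^ card (verts xs - H)) \<le> K)" for p K
  have "\<forall>p. \<exists>K. bnd p K" unfolding bnd_def using sum_words_bounded by blast
  then obtain K where "\<And>p. bnd p (K p)" by metis
  then have K: "\<And>p. K p \<ge> 0" "\<And>p r H. r > 0 \<Longrightarrow> finite H \<Longrightarrow> card H \<le> h \<Longrightarrow>
     (\<Sum>xs | set xs \<subseteq> alphabet r \<and> length xs = p. (1 / real (N r)) ^ card (verts xs - H)) \<le> K p"
    by (simp_all add: bnd_def)
  show ?thesis
  proof (intro exI[of _ "\<Sum>l\<in>{1..L}. K l"] conjI allI impI)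
    fix r H assume r: "r > (0::nat)" and H: "finite (H :: (nat + nat) set)" "card H \<le> h"
    have "(\<Sum>x\<in>short L r. (1 / real (N r)) ^ card (verts x - H)) = (\<Sum>l\<in>{1..L}. \<Sum>x\<in>cycles r l. (1 / real (N r)) ^ card (verts x - H))"
      unfolding short_def by (rule sum.UNION_disjoint) (simp_all, auto simp: cycles_def)
    also have "\<dots> \<le> (\<Sum>l\<in>{1..L}. \<Sum>xs | set xs \<subseteq> alphabet r \<and> length xs = l. (1 / real (N r)) ^ card (verts xs - H))"
      by (intro sum_mono sum_mono2 finite_lists_length_eq) (auto simp: cycles_def)
    also have "\<dots> \<le> (\<Sum>l\<in>{1..L}. K l)" by (intro sum_mono K r H)
    finally show "(\<Sum>x\<in>short L r. (1 / real (N r)) ^ card (verts x - H)) \<le> (\<Sum>l\<in>{1..L}. K l)" .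
  qed (use K in \<open>auto intro: sum_nonneg\<close>)
qed

lemma sum_tuples_Suc:
  fixes f :: "step list list \<Rightarrow> real"
  shows "(\<Sum>\<gamma>s\<in>tuples L (Suc s) r. f \<gamma>s) = (\<Sum>x\<in>short L r. \<Sum>\<gamma>s\<in>tuples L s r. f (x # \<gamma>s))"
  unfolding tuples_def by (rule sum_lists_Suc) simp

text \<open>The induction for words again, with cycles in place of steps; a cycle adds at most
  \<open>2 * L\<close> vertices to H. In effect, O(N^v) tuples have v vertices in total.\<close>

lemma sum_tuples_bounded':
  "\<exists>K\<ge>0. \<forall>r>0. \<forall>H. finite H \<longrightarrow> card H \<le> h \<longrightarrow> (\<Sum>\<gamma>s\<in>tuples L s r. (1 / real (N r)) ^ card (uverts \<gamma>s - H)) \<le> K"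
proof (induction s arbitrary: h)
  case 0
  have "tuples L 0 r = {[]}" for r by (auto simp: tuples_def)
  then show ?case by (intro exI[of _ 1]) simp
next
  case (Suc s)
  obtain K where K: "K \<ge> 0" "\<And>r H. r > 0 \<Longrightarrow> finite H \<Longrightarrow> card H \<le> h + 2*L \<Longrightarrow> (\<Sum>\<gamma>s\<in>tuples L s r. (1 / real (N r)) ^ card (uverts \<gamma>s - H)) \<le> K"
    using Suc[of "h + 2*L"] by blast
  obtain K' where K': "K' \<ge> 0" "\<And>r H. r > 0 \<Longrightarrow> finite H \<Longrightarrow> card H \<le> h \<Longrightarrow> (\<Sum>x\<in>short L r. (1 / real (N r)) ^ card (verts x - H)) \<le> K'"
    using sum_short_bounded[of h L] by blast
  show ?case
  proof (intro exI[of _ "K' * K"] conjI allI impI)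
    fix r H assume r: "r > (0::nat)" and H: "finite (H :: (nat + nat) set)" "card H \<le> h"
    let ?x = "1 / real (N r)"
    have "(\<Sum>\<gamma>s\<in>tuples L (Suc s) r. ?x ^ card (uverts \<gamma>s - H)) = (\<Sum>x\<in>short L r. ?x ^ card (verts x - H) * (\<Sum>\<gamma>s\<in>tuples L s r. ?x ^ card (uverts \<gamma>s - (H \<union> verts x))))"
      unfolding sum_distrib_left sum_tuples_Suc
      by (intro sum.cong refl) (simp only: uverts_simps card_Un_Diff finite_verts finite_uverts power_add)
    also have "\<dots> \<le> (\<Sum>x\<in>short L r. ?x ^ card (verts x - H) * K)"
    proof (intro sum_mono mult_left_mono K(2) r)
      fix x assume x: "x \<in> short L r"
      have "card (H \<union> verts x) \<le> card H + card (verts x)" by (rule card_Un_le)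
      then show "card (H \<union> verts x) \<le> h + 2*L" using H card_verts[OF short_D(2)[OF x]] short_D(3)[OF x] by simp
    qed (use H in auto)
    also have "\<dots> \<le> K' * K" unfolding sum_distrib_right[symmetric] by (intro mult_right_mono K' H r K)
    finally show "(\<Sum>\<gamma>s\<in>tuples L (Suc s) r. ?x ^ card (uverts \<gamma>s - H)) \<le> K' * K" .
  qed (use K K' in simp)
qed

lemma sum_tuples_bounded:
  obtains K where "K \<ge> 0" "\<And>r. r > 0 \<Longrightarrow> (\<Sum>\<gamma>s\<in>tuples L s r. (1 / real (N r)) ^ card (uverts \<gamma>s)) \<le> K"
proof -
  obtain K where K: "K \<ge> 0" "\<And>r H. r > 0 \<Longrightarrow> finite H \<Longrightarrow> card H \<le> 0 \<Longrightarrow> (\<Sum>\<gamma>s\<in>tuples L s r. (1 / real (N r)) ^ card (uverts \<gamma>s - H)) \<le> K"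
    using sum_tuples_bounded'[of 0 L s] by blast
  show ?thesis by (rule that[OF K(1)]) (use K(2)[of _ "{}"] in simp)
qed

lemma filterlim_N: "filterlim N at_top sequentially"
  unfolding N_def[abs_def] using d_pos k_gt_2 by (intro filterlim_subseq) (auto simp: strict_mono_def)

lemma inverse_N_tendsto: "(\<lambda>r. c / real (N r)) \<longlonglongrightarrow> 0"
  by (rule real_tendsto_divide_at_top[OF tendsto_const]) (rule filterlim_compose[OF filterlim_real_sequentially filterlim_N])

text \<open>The probability that e given compatible edges are present, relative to
  \<open>1 / N r ^ e\<close>.\<close>

definition fall_ratio :: "nat \<Rightarrow> nat \<Rightarrow> real" where
  "fall_ratio r e = fact (N r - e) * real (N r) ^ e / fact (N r)"

lemma fall_ratio_tendsto: "(\<lambda>r. fall_ratio r e) \<longlonglongrightarrow> 1"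
proof -
  have "(\<lambda>r. inverse (fact (N r) / (fact (N r - e) * real (N r) ^ e))) \<longlonglongrightarrow> inverse (1::real)"
    by (intro tendsto_inverse filterlim_compose[OF falling_factorial_asymp filterlim_N]) simp
  then show ?thesis by (simp add: fall_ratio_def field_simps)
qed

lemma fall_ratio_le_2: "\<forall>\<^sub>F r in sequentially. \<forall>e\<le>M. fall_ratio r e \<le> 2"
proof -
  have "\<forall>\<^sub>F r in sequentially. \<forall>e\<in>{..M}. fall_ratio r e < 2"
    by (intro eventually_ball_finite ballI order_tendstoD(2)[OF fall_ratio_tendsto]) auto
  then show ?thesis by eventually_elim (auto simp: less_imp_le)
qed

definition P :: "nat \<Rightarrow> edge set \<Rightarrow> real" where "P r S = E r (\<lambda>f. of_bool (extends S f))"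

lemma P_nonneg: "P r S \<ge> 0" by (simp add: P_def E_def sum_nonneg)

lemma P_partial: "partial_matching r S \<Longrightarrow> r > 0 \<Longrightarrow> P r S = fall_ratio r (card S) / real (N r) ^ card S"
  using N_pos[of r] by (simp add: P_def E_extends fall_ratio_def)

lemma edges_subset:
  assumes "is_cycle x" "set x \<subseteq> alphabet r" shows "edges x \<subseteq> VC r \<times> CC r"
proof -
  have nth: "x ! j \<in> alphabet r" if "j < length x" for j using assms that nth_mem by blast
  show ?thesis
  proof
    fix e assume "e \<in> edges x"
    with assms(1) show "e \<in> VC r \<times> CC r"
    proof (cases rule: edge_cases)
      case (1 j)
      then show ?thesis using nth[of j] by (simp add: edge_out_def VC_def CC_def alphabet_iff)
    next
      case (2 j)
      then show ?thesis using nth[of j] nth[OF cyc_next_less[OF cycle_nonempty[OF assms(1)]], of j] by (simp add: edge_in_def VC_def CC_def alphabet_iff)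
    qed
  qed
qed

lemma tuples_D:
  assumes "\<gamma>s \<in> tuples L s r" "x \<in> set \<gamma>s" shows "x \<in> short L r" "is_cycle x" "canonical x" "set x \<subseteq> alphabet r" "length x \<le> L"
  using assms short_D[of x L r] by (auto simp: tuples_def)

lemma uedges_subset: "\<gamma>s \<in> tuples L s r \<Longrightarrow> uedges \<gamma>s \<subseteq> VC r \<times> CC r"
  using edges_subset tuples_D(2,4) by (fastforce simp: uedges_def)

text \<open>Edges that are not a partial matching have probability 0; for the others the factor 2
  absorbs \<open>fall_ratio\<close>.\<close>

lemma P_le:
  assumes "\<gamma>s \<in> tuples L s r" "r > 0" "\<forall>e\<le>2*(s*L). fall_ratio r e \<le> 2"
  shows "P r (uedges \<gamma>s) \<le> 2 * (1 / real (N r)) ^ card (uedges \<gamma>s)"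
proof (cases "partial_matching r (uedges \<gamma>s)")
  case True
  have "card (uedges \<gamma>s) \<le> 2 * (s * L)"
    using card_uedges_le[of \<gamma>s] tuples_D[OF assms(1)] tlen_le[OF assms(1)] by force
  then have "fall_ratio r (card (uedges \<gamma>s)) \<le> 2" using assms(3) by blast
  then show ?thesis using P_partial[OF True assms(2)] by (simp add: divide_right_mono power_one_over)
next
  case False
  have "uedges \<gamma>s \<subseteq> VC r \<times> UNIV" using uedges_subset[OF assms(1)] by blast
  then have "P r (uedges \<gamma>s) = 0"
    using not_extends[OF False] by (simp add: P_def E_def)
  then show ?thesis by simp
qed

lemma power_one_over_mono: "r > 0 \<Longrightarrow> a \<le> b \<Longrightarrow> (1 / real (N r)) ^ b \<le> (1 / real (N r)) ^ a"
  using N_pos[of r] by (intro power_decreasing) auto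

text \<open>A bad tuple with v vertices has at least v + 1 edges and so probability at most
  \<open>2 / N r ^ (v + 1)\<close>. Since the sum of \<open>1 / N r ^ v\<close> over all tuples
  stays bounded, the total is O(1 / N).\<close>

lemma bad_sum_tendsto: "(\<lambda>r. \<Sum>\<gamma>s | \<gamma>s \<in> tuples L s r \<and> bad \<gamma>s. P r (uedges \<gamma>s)) \<longlonglongrightarrow> 0"
proof -
  obtain K where K: "K \<ge> 0" "\<And>r. r > 0 \<Longrightarrow> (\<Sum>\<gamma>s\<in>tuples L s r. (1 / real (N r)) ^ card (uverts \<gamma>s)) \<le> K"
    using sum_tuples_bounded by blast
  have "\<forall>\<^sub>F r in sequentially. (\<Sum>\<gamma>s | \<gamma>s \<in> tuples L s r \<and> bad \<gamma>s. P r (uedges \<gamma>s)) \<le> (2 * K) / real (N r)"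
    using fall_ratio_le_2[of "2*(s*L)"] eventually_gt_at_top[of 0]
  proof eventually_elim
    case (elim r)
    have "(\<Sum>\<gamma>s | \<gamma>s \<in> tuples L s r \<and> bad \<gamma>s. P r (uedges \<gamma>s)) \<le> (\<Sum>\<gamma>s | \<gamma>s \<in> tuples L s r \<and> bad \<gamma>s. 2 / real (N r) * (1 / real (N r)) ^ card (uverts \<gamma>s))"
    proof (rule sum_mono)
      fix \<gamma>s assume "\<gamma>s \<in> {\<gamma>s. \<gamma>s \<in> tuples L s r \<and> bad \<gamma>s}"
      then have g: "\<gamma>s \<in> tuples L s r" "bad \<gamma>s" by auto
      have "P r (uedges \<gamma>s) \<le> 2 * (1 / real (N r)) ^ card (uedges \<gamma>s)" by (rule P_le[OF g(1)]) (use elim in auto)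
      also have "\<dots> \<le> 2 * (1 / real (N r)) ^ Suc (card (uverts \<gamma>s))"
        using card_uverts_le_uedges[OF tuples_D(3)[OF g(1)] g(2)] elim
        by (intro mult_left_mono power_one_over_mono) auto
      finally show "P r (uedges \<gamma>s) \<le> 2 / real (N r) * (1 / real (N r)) ^ card (uverts \<gamma>s)" by simp
    qed
    also have "\<dots> \<le> (\<Sum>\<gamma>s\<in>tuples L s r. 2 / real (N r) * (1 / real (N r)) ^ card (uverts \<gamma>s))"
      by (rule sum_mono2) auto
    also have "\<dots> \<le> 2 / real (N r) * K"
      unfolding sum_distrib_left[symmetric] using K elim by (intro mult_left_mono) auto
    finally show ?case by simp
  qed
  moreover have "\<forall>\<^sub>F r in sequentially. 0 \<le> (\<Sum>\<gamma>s | \<gamma>s \<in> tuples L s r \<and> bad \<gamma>s. P r (uedges \<gamma>s))"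
    by (intro always_eventually allI sum_nonneg P_nonneg)
  ultimately show ?thesis by (intro tendsto_sandwich[OF _ _ tendsto_const inverse_N_tendsto[of "2*K"]])
qed

text \<open>A tuple that is not \<open>vdisjoint\<close> has fewer than \<open>2 * tlen\<close>
  vertices, so here one power of \<open>1 / N r\<close> is gained over a bounded sum.\<close>

lemma crossing_sum_tendsto: "(\<lambda>r. \<Sum>\<gamma>s | \<gamma>s \<in> tuples L s r \<and> \<not> vdisjoint \<gamma>s. (1 / real (N r)) ^ (2 * tlen \<gamma>s)) \<longlonglongrightarrow> 0"
proof -
  obtain K where K: "K \<ge> 0" "\<And>r. r > 0 \<Longrightarrow> (\<Sum>\<gamma>s\<in>tuples L s r. (1 / real (N r)) ^ card (uverts \<gamma>s)) \<le> K"
    using sum_tuples_bounded by blast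
  have "\<forall>\<^sub>F r in sequentially. (\<Sum>\<gamma>s | \<gamma>s \<in> tuples L s r \<and> \<not> vdisjoint \<gamma>s. (1 / real (N r)) ^ (2 * tlen \<gamma>s)) \<le> K / real (N r)"
    using eventually_gt_at_top[of 0]
  proof eventually_elim
    case (elim r)
    have "(\<Sum>\<gamma>s | \<gamma>s \<in> tuples L s r \<and> \<not> vdisjoint \<gamma>s. (1 / real (N r)) ^ (2 * tlen \<gamma>s)) \<le> (\<Sum>\<gamma>s | \<gamma>s \<in> tuples L s r \<and> \<not> vdisjoint \<gamma>s. (1 / real (N r)) ^ Suc (card (uverts \<gamma>s)))"
      using elim card_uverts(2) tuples_D(2) by (intro sum_mono power_one_over_mono) (auto simp: Suc_le_eq)
    also have "\<dots> \<le> (\<Sum>\<gamma>s\<in>tuples L s r. (1 / real (N r)) ^ Suc (card (uverts \<gamma>s)))"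
      by (rule sum_mono2) auto
    also have "\<dots> = 1 / real (N r) * (\<Sum>\<gamma>s\<in>tuples L s r. (1 / real (N r)) ^ card (uverts \<gamma>s))"
      by (simp only: power_Suc sum_distrib_left)
    also have "\<dots> \<le> 1 / real (N r) * K" using K elim by (intro mult_left_mono) auto
    finally show ?case by simp
  qed
  moreover have "\<forall>\<^sub>F r in sequentially. 0 \<le> (\<Sum>\<gamma>s | \<gamma>s \<in> tuples L s r \<and> \<not> vdisjoint \<gamma>s. (1 / real (N r)) ^ (2 * tlen \<gamma>s))"
    by (intro always_eventually allI sum_nonneg) simp
  ultimately show ?thesis by (intro tendsto_sandwich[OF _ _ tendsto_const inverse_N_tendsto[of K]])
qed

definition wt :: "(nat \<Rightarrow> real) \<Rightarrow> step list list \<Rightarrow> real" where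
  "wt \<theta> \<gamma>s = prod_list (map (\<lambda>x. \<theta> (length x)) \<gamma>s)"

lemma wt_simps [simp]: "wt \<theta> [] = 1" "wt \<theta> (x # xs) = \<theta> (length x) * wt \<theta> xs"
  by (simp_all add: wt_def)

lemma wt_mult: "wt (\<lambda>l. \<theta> l * \<rho> l) \<gamma>s = wt \<theta> \<gamma>s * wt \<rho> \<gamma>s"
  by (induction \<gamma>s) auto

lemma wt_bounded:
  obtains C where "C \<ge> 0" "\<And>r \<gamma>s. \<gamma>s \<in> tuples L s r \<Longrightarrow> \<bar>wt \<theta> \<gamma>s\<bar> \<le> C"
proof -
  define B where "B = (\<Sum>l\<le>L. \<bar>\<theta> l\<bar>)"
  have B: "\<bar>\<theta> l\<bar> \<le> B" if "l \<le> L" for l unfolding B_def using that by (intro member_le_sum) auto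
  have B0: "B \<ge> 0" by (simp add: B_def sum_nonneg)
  have "\<bar>wt \<theta> \<gamma>s\<bar> \<le> B ^ s" if "\<gamma>s \<in> tuples L s r" for \<gamma>s r
    using that
  proof (induction \<gamma>s arbitrary: s)
    case (Cons x xs)
    then obtain s' where s: "s = Suc s'" "xs \<in> tuples L s' r" "x \<in> short L r" by (auto simp: tuples_def)
    then show ?case using Cons.IH[OF s(2)] B[OF short_D(3)[OF s(3)]] B0 by (simp add: abs_mult mult_mono)
  qed (simp add: tuples_def)
  then show ?thesis using that[of "B ^ s"] B0 by simp
qed

text \<open>Over all tuples without restriction the sum factors into the s-th power of a sum over
  single cycles.\<close>

lemma sum_all_tuples_tendsto:
  "(\<lambda>r. \<Sum>\<gamma>s\<in>tuples L s r. wt \<theta> \<gamma>s * (1 / real (N r)) ^ (2 * tlen \<gamma>s)) \<longlonglongrightarrow> (\<Sum>l\<in>{1..L}. lam l * \<theta> l) ^ s"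
proof -
  have "(\<Sum>\<gamma>s\<in>tuples L s r. wt \<theta> \<gamma>s * (1 / real (N r)) ^ (2 * tlen \<gamma>s)) = (\<Sum>l\<in>{1..L}. real (card (cycles r l)) / real (N r) ^ (2*l) * \<theta> l) ^ s" for r
  proof -
    have e: "wt \<theta> \<gamma>s * (1 / real (N r)) ^ (2 * tlen \<gamma>s) = prod_list (map (\<lambda>x. \<theta> (length x) * (1 / real (N r)) ^ (2 * length x)) \<gamma>s)" for \<gamma>s
      by (induction \<gamma>s) (auto simp: power_add distrib_left)
    have "(\<Sum>\<gamma>s\<in>tuples L s r. wt \<theta> \<gamma>s * (1 / real (N r)) ^ (2 * tlen \<gamma>s)) = (\<Sum>x\<in>short L r. \<theta> (length x) * (1 / real (N r)) ^ (2 * length x)) ^ s"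
      unfolding e tuples_def by (rule sum_lists_prod_power) simp
    also have "(\<Sum>x\<in>short L r. \<theta> (length x) * (1 / real (N r)) ^ (2 * length x)) = (\<Sum>l\<in>{1..L}. \<Sum>x\<in>cycles r l. \<theta> (length x) * (1 / real (N r)) ^ (2 * length x))"
      unfolding short_def by (rule sum.UNION_disjoint) (simp_all, auto simp: cycles_def)
    also have "\<dots> = (\<Sum>l\<in>{1..L}. \<Sum>x\<in>cycles r l. \<theta> l * (1 / real (N r)) ^ (2 * l))"
      by (intro sum.cong refl) (auto simp: cycles_def)
    also have "\<dots> = (\<Sum>l\<in>{1..L}. real (card (cycles r l)) / real (N r) ^ (2*l) * \<theta> l)"
      by (intro sum.cong refl) (simp add: power_one_over)
    finally show ?thesis .
  qed
  moreover have "(\<lambda>r. (\<Sum>l\<in>{1..L}. real (card (cycles r l)) / real (N r) ^ (2*l) * \<theta> l) ^ s) \<longlonglongrightarrow> (\<Sum>l\<in>{1..L}. lam l * \<theta> l) ^ s"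
    by (intro tendsto_power tendsto_sum tendsto_mult tendsto_const card_cycles_asymp) auto
  ultimately show ?thesis by simp
qed

text \<open>Only the tuples of pairwise disjoint cycles matter in the limit, and their number is
  asymptotically that of all tuples.\<close>

theorem distinct_tuples_tendsto:
  fixes w :: "nat \<Rightarrow> step list list \<Rightarrow> real"
  assumes main: "\<And>r \<gamma>s. r \<ge> r0 \<Longrightarrow> \<gamma>s \<in> tuples L s r \<Longrightarrow> vdisjoint \<gamma>s \<Longrightarrow> \<bar>w r \<gamma>s * real (N r) ^ (2 * tlen \<gamma>s) - wt \<rho> \<gamma>s\<bar> \<le> err r"
    and err: "err \<longlonglongrightarrow> 0"
    and bad: "(\<lambda>r. \<Sum>\<gamma>s | \<gamma>s \<in> tuples L s r \<and> bad \<gamma>s. \<bar>w r \<gamma>s\<bar>) \<longlonglongrightarrow> 0"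
  shows "(\<lambda>r. \<Sum>\<gamma>s | \<gamma>s \<in> tuples L s r \<and> distinct \<gamma>s. wt \<theta> \<gamma>s * w r \<gamma>s) \<longlonglongrightarrow> (\<Sum>l\<in>{1..L}. lam l * (\<theta> l * \<rho> l)) ^ s"
proof -
  let ?D = "\<lambda>r. {\<gamma>s. \<gamma>s \<in> tuples L s r \<and> vdisjoint \<gamma>s}"
  let ?x = "\<lambda>r \<gamma>s. (1 / real (N r)) ^ (2 * tlen \<gamma>s)"
  obtain C where C: "C \<ge> 0" "\<And>r \<gamma>s. \<gamma>s \<in> tuples L s r \<Longrightarrow> \<bar>wt \<theta> \<gamma>s\<bar> \<le> C" using wt_bounded by metis
  obtain C' where C': "C' \<ge> 0" "\<And>r \<gamma>s. \<gamma>s \<in> tuples L s r \<Longrightarrow> \<bar>wt (\<lambda>l. \<theta> l * \<rho> l) \<gamma>s\<bar> \<le> C'" using wt_bounded by metis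
  obtain K where K: "K \<ge> 0" "\<And>r. r > 0 \<Longrightarrow> (\<Sum>\<gamma>s\<in>tuples L s r. (1 / real (N r)) ^ card (uverts \<gamma>s)) \<le> K"
    using sum_tuples_bounded by blast
  \<comment> \<open>\<open>A1\<close> is the contribution of the bad tuples and \<open>A2\<close>
    the error of replacing w by its limiting weight on the disjoint ones. \<open>A4 - A3\<close> is
    the limiting weight summed over the disjoint tuples, written as all tuples minus those that are
    not disjoint.\<close>
  define A1 where "A1 r = (\<Sum>\<gamma>s | \<gamma>s \<in> tuples L s r \<and> distinct \<gamma>s \<and> bad \<gamma>s. wt \<theta> \<gamma>s * w r \<gamma>s)" for r
  define A2 where "A2 r = (\<Sum>\<gamma>s\<in>?D r. wt \<theta> \<gamma>s * (w r \<gamma>s * real (N r) ^ (2 * tlen \<gamma>s) - wt \<rho> \<gamma>s) * ?x r \<gamma>s)" for r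
  define A3 where "A3 r = (\<Sum>\<gamma>s | \<gamma>s \<in> tuples L s r \<and> \<not> vdisjoint \<gamma>s. wt (\<lambda>l. \<theta> l * \<rho> l) \<gamma>s * ?x r \<gamma>s)" for r
  define A4 where "A4 r = (\<Sum>\<gamma>s\<in>tuples L s r. wt (\<lambda>l. \<theta> l * \<rho> l) \<gamma>s * ?x r \<gamma>s)" for r
  have A1: "A1 \<longlonglongrightarrow> 0"
  proof (rule Lim_null_comparison)
    show "\<forall>\<^sub>F r in sequentially. norm (A1 r) \<le> C * (\<Sum>\<gamma>s | \<gamma>s \<in> tuples L s r \<and> bad \<gamma>s. \<bar>w r \<gamma>s\<bar>)"
    proof (intro always_eventually allI)
      fix r
      have "norm (A1 r) \<le> (\<Sum>\<gamma>s | \<gamma>s \<in> tuples L s r \<and> distinct \<gamma>s \<and> bad \<gamma>s. C * \<bar>w r \<gamma>s\<bar>)"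
        unfolding A1_def by (rule sum_norm_le) (auto simp: abs_mult intro!: mult_right_mono C)
      also have "\<dots> \<le> (\<Sum>\<gamma>s | \<gamma>s \<in> tuples L s r \<and> bad \<gamma>s. C * \<bar>w r \<gamma>s\<bar>)"
        using C by (intro sum_mono2) auto
      finally show "norm (A1 r) \<le> C * (\<Sum>\<gamma>s | \<gamma>s \<in> tuples L s r \<and> bad \<gamma>s. \<bar>w r \<gamma>s\<bar>)" by (simp add: sum_distrib_left)
    qed
    show "(\<lambda>r. C * (\<Sum>\<gamma>s | \<gamma>s \<in> tuples L s r \<and> bad \<gamma>s. \<bar>w r \<gamma>s\<bar>)) \<longlonglongrightarrow> 0"
      using tendsto_mult_left[OF bad, of C] by simp
  qed
  have A2: "A2 \<longlonglongrightarrow> 0"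
  proof (rule Lim_null_comparison)
    show "\<forall>\<^sub>F r in sequentially. norm (A2 r) \<le> C * \<bar>err r\<bar> * K"
      using eventually_ge_at_top[of r0] eventually_gt_at_top[of 0]
    proof eventually_elim
      case (elim r)
      have "norm (A2 r) \<le> (\<Sum>\<gamma>s\<in>?D r. C * \<bar>err r\<bar> * (1 / real (N r)) ^ card (uverts \<gamma>s))"
        unfolding A2_def
      proof (rule sum_norm_le)
        fix \<gamma>s assume "\<gamma>s \<in> ?D r"
        then have g: "\<gamma>s \<in> tuples L s r" "vdisjoint \<gamma>s" by auto
        have "?x r \<gamma>s \<le> (1 / real (N r)) ^ card (uverts \<gamma>s)"
          using card_uverts(1)[of \<gamma>s] tuples_D(2)[OF g(1)] elim by (intro power_one_over_mono) auto
        then show "norm (wt \<theta> \<gamma>s * (w r \<gamma>s * real (N r) ^ (2 * tlen \<gamma>s) - wt \<rho> \<gamma>s) * ?x r \<gamma>s) \<le> C * \<bar>err r\<bar> * (1 / real (N r)) ^ card (uverts \<gamma>s)"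
          unfolding real_norm_def abs_mult using C(2)[OF g(1)] main[OF elim(1) g] C(1) by (intro mult_mono) auto
      qed
      also have "\<dots> \<le> (\<Sum>\<gamma>s\<in>tuples L s r. C * \<bar>err r\<bar> * (1 / real (N r)) ^ card (uverts \<gamma>s))"
        using C by (intro sum_mono2) auto
      also have "\<dots> \<le> C * \<bar>err r\<bar> * K"
        unfolding sum_distrib_left[symmetric] using C K elim by (intro mult_left_mono) auto
      finally show ?case .
    qed
    show "(\<lambda>r. C * \<bar>err r\<bar> * K) \<longlonglongrightarrow> 0"
      using tendsto_mult_right[OF tendsto_mult_left[OF tendsto_rabs[OF err], of C], of K] by simp
  qed
  have A3: "A3 \<longlonglongrightarrow> 0"
  proof (rule Lim_null_comparison)
    show "\<forall>\<^sub>F r in sequentially. norm (A3 r) \<le> C' * (\<Sum>\<gamma>s | \<gamma>s \<in> tuples L s r \<and> \<not> vdisjoint \<gamma>s. ?x r \<gamma>s)"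
      unfolding sum_distrib_left A3_def
      by (intro always_eventually allI sum_norm_le) (auto simp: abs_mult intro!: mult_right_mono C' divide_right_mono)
    show "(\<lambda>r. C' * (\<Sum>\<gamma>s | \<gamma>s \<in> tuples L s r \<and> \<not> vdisjoint \<gamma>s. ?x r \<gamma>s)) \<longlonglongrightarrow> 0"
      using tendsto_mult_left[OF crossing_sum_tendsto, of C'] by simp
  qed
  have A4: "A4 \<longlonglongrightarrow> (\<Sum>l\<in>{1..L}. lam l * (\<theta> l * \<rho> l)) ^ s"
    unfolding A4_def by (rule sum_all_tuples_tendsto)
  have "\<forall>\<^sub>F r in sequentially. A1 r + A2 r + (A4 r - A3 r) = (\<Sum>\<gamma>s | \<gamma>s \<in> tuples L s r \<and> distinct \<gamma>s. wt \<theta> \<gamma>s * w r \<gamma>s)"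
    using eventually_gt_at_top[of 0]
  proof eventually_elim
    case (elim r)
    have Nz: "real (N r) \<noteq> 0" using N_pos[OF elim] by simp
    have "A4 r - A3 r = (\<Sum>\<gamma>s\<in>?D r. wt (\<lambda>l. \<theta> l * \<rho> l) \<gamma>s * ?x r \<gamma>s)"
    proof -
      have "tuples L s r - {\<gamma>s. \<gamma>s \<in> tuples L s r \<and> \<not> vdisjoint \<gamma>s} = ?D r" by auto
      then show ?thesis unfolding A4_def A3_def using sum_diff[of "tuples L s r" "{\<gamma>s. \<gamma>s \<in> tuples L s r \<and> \<not> vdisjoint \<gamma>s}" "\<lambda>\<gamma>s. wt (\<lambda>l. \<theta> l * \<rho> l) \<gamma>s * ?x r \<gamma>s"] by simp
    qed
    then have "A2 r + (A4 r - A3 r) = (\<Sum>\<gamma>s\<in>?D r. wt \<theta> \<gamma>s * w r \<gamma>s)"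
      unfolding A2_def using Nz by (simp add: sum.distrib[symmetric] wt_mult algebra_simps power_one_over)
    moreover have "{\<gamma>s. \<gamma>s \<in> tuples L s r \<and> distinct \<gamma>s} = {\<gamma>s. \<gamma>s \<in> tuples L s r \<and> distinct \<gamma>s \<and> bad \<gamma>s} \<union> ?D r"
      using distinct_not_vdisjoint_bad vdisjoint_distinct tuples_D(2) by blast
    moreover have "{\<gamma>s. \<gamma>s \<in> tuples L s r \<and> distinct \<gamma>s \<and> bad \<gamma>s} \<inter> ?D r = {}" using vdisjoint_not_bad by blast
    ultimately show ?case unfolding A1_def by (simp add: sum.union_disjoint)
  qed
  moreover have "(\<lambda>r. A1 r + A2 r + (A4 r - A3 r)) \<longlonglongrightarrow> 0 + 0 + ((\<Sum>l\<in>{1..L}. lam l * (\<theta> l * \<rho> l)) ^ s - 0)"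
    by (intro tendsto_add tendsto_diff A1 A2 A3 A4)
  ultimately have "(\<lambda>r. \<Sum>\<gamma>s | \<gamma>s \<in> tuples L s r \<and> distinct \<gamma>s. wt \<theta> \<gamma>s * w r \<gamma>s) \<longlonglongrightarrow> 0 + 0 + ((\<Sum>l\<in>{1..L}. lam l * (\<theta> l * \<rho> l)) ^ s - 0)"
    by (rule Lim_transform_eventually[rotated])
  then show ?thesis by simp
qed

end

section \<open>Cycles in the uniform and in the planted model\<close>

definition uvars :: "step list list \<Rightarrow> nat set" where "uvars \<gamma>s = \<Union>(vars ` set \<gamma>s)"
definition ucls :: "step list list \<Rightarrow> nat set" where "ucls \<gamma>s = \<Union>(cls ` set \<gamma>s)"

lemma uvars_simps [simp]: "uvars [] = {}" "uvars (x # xs) = vars x \<union> uvars xs"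
  and ucls_simps [simp]: "ucls [] = {}" "ucls (x # xs) = cls x \<union> ucls xs"
  by (auto simp: uvars_def ucls_def)

lemma finite_uvars [simp]: "finite (uvars \<gamma>s)" and finite_ucls [simp]: "finite (ucls \<gamma>s)"
  by (auto simp: uvars_def ucls_def)

lemma uverts_eq: "uverts \<gamma>s = uvars \<gamma>s <+> ucls \<gamma>s"
  by (auto simp: uverts_def uvars_def ucls_def verts_def)

lemma Plus_disjoint_iff: "(A <+> B) \<inter> (C <+> D) = {} \<longleftrightarrow> A \<inter> C = {} \<and> B \<inter> D = {}"
  by auto

lemma uvars_eq: "(\<And>x. x \<in> set \<gamma>s \<Longrightarrow> is_cycle x) \<Longrightarrow> uvars \<gamma>s = (fst \<circ> fst) ` uedges \<gamma>s"
  unfolding uvars_def uedges_def image_UN using vars_eq_edges by auto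

lemma ucls_eq: "(\<And>x. x \<in> set \<gamma>s \<Longrightarrow> is_cycle x) \<Longrightarrow> ucls \<gamma>s = (fst \<circ> snd) ` uedges \<gamma>s"
  unfolding ucls_def uedges_def image_UN using cls_eq_edges by auto

lemma uedges_append: "uedges (xs @ ys) = uedges xs \<union> uedges ys"
  by (auto simp: uedges_def)

context exact_cover
begin

lemma extends_Un: "extends (S \<union> S') f \<longleftrightarrow> extends S f \<and> extends S' f"
  by (simp add: extends_def ball_Un)

text \<open>Induction on the tuple: vertex disjoint cycles have disjoint edges, so cardinalities
  add, degrees stay two and, by \<open>Zsum_Un\<close>, the weights multiply.\<close>

lemma vdisjoint_structure:
  assumes "\<gamma>s \<in> tuples L s r" "vdisjoint \<gamma>s"
  shows "inj_on fst (uedges \<gamma>s)" "inj_on snd (uedges \<gamma>s)" "card (uedges \<gamma>s) = 2 * tlen \<gamma>s"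
    "card (uvars \<gamma>s) = tlen \<gamma>s" "card (ucls \<gamma>s) = tlen \<gamma>s"
    "\<And>v. v \<in> uvars \<gamma>s \<Longrightarrow> card {e\<in>uedges \<gamma>s. fst (fst e) = v} = 2"
    "Zsum (uedges \<gamma>s) (uvars \<gamma>s) (ucls \<gamma>s) = wt (\<lambda>l. 1 + delta ^ l) \<gamma>s"
proof -
  have "inj_on fst (uedges \<gamma>s) \<and> inj_on snd (uedges \<gamma>s) \<and> card (uedges \<gamma>s) = 2 * tlen \<gamma>s \<and>
    card (uvars \<gamma>s) = tlen \<gamma>s \<and> card (ucls \<gamma>s) = tlen \<gamma>s \<and>
    (\<forall>v\<in>uvars \<gamma>s. card {e\<in>uedges \<gamma>s. fst (fst e) = v} = 2) \<and>
    Zsum (uedges \<gamma>s) (uvars \<gamma>s) (ucls \<gamma>s) = wt (\<lambda>l. 1 + delta ^ l) \<gamma>s"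
    using assms
  proof (induction \<gamma>s arbitrary: s)
    case Nil
    show ?case by (simp add: Zsum_def)
  next
    case (Cons x xs)
    obtain s' where xs: "xs \<in> tuples L s' r" and x: "x \<in> short L r" using Cons.prems by (auto simp: tuples_def)
    have vd: "verts x \<inter> uverts xs = {}" "vdisjoint xs" using Cons.prems by (auto simp: vdisjoint_Cons)
    then have dj: "vars x \<inter> uvars xs = {}" "cls x \<inter> ucls xs = {}" by (auto simp: uverts_eq verts_def Plus_disjoint_iff)
    have c: "is_cycle x" using short_D(2)[OF x] .
    have ux: "uvars xs = (fst \<circ> fst) ` uedges xs" "ucls xs = (fst \<circ> snd) ` uedges xs"
      using uvars_eq ucls_eq tuples_D(2)[OF xs] by auto
    note IH = Cons.IH[OF xs vd(2)]
    have e1: "fst (fst e) \<in> vars x \<and> fst (snd e) \<in> cls x" if "e \<in> edges x" for e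
      using that unfolding vars_eq_edges[OF c] cls_eq_edges[OF c] by auto
    have e2: "fst (fst e) \<in> uvars xs \<and> fst (snd e) \<in> ucls xs" if "e \<in> uedges xs" for e
      using that unfolding ux by auto
    have ed: "edges x \<inter> uedges xs = {}" using e1 e2 dj by blast
    have 1: "inj_on fst (edges x \<union> uedges xs)"
      unfolding inj_on_Un
    proof (intro conjI)
      show "fst ` (edges x - uedges xs) \<inter> fst ` (uedges xs - edges x) = {}"
      proof (rule ccontr)
        assume "fst ` (edges x - uedges xs) \<inter> fst ` (uedges xs - edges x) \<noteq> {}"
        then obtain e e' where "e \<in> edges x" "e' \<in> uedges xs" "fst e = fst e'" by blast
        then show False using e1[of e] e2[of e'] dj by auto
      qed
    qed (use inj_fst_edges[OF c] IH in auto)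
    have 2: "inj_on snd (edges x \<union> uedges xs)"
      unfolding inj_on_Un
    proof (intro conjI)
      show "snd ` (edges x - uedges xs) \<inter> snd ` (uedges xs - edges x) = {}"
      proof (rule ccontr)
        assume "snd ` (edges x - uedges xs) \<inter> snd ` (uedges xs - edges x) \<noteq> {}"
        then obtain e e' where "e \<in> edges x" "e' \<in> uedges xs" "snd e = snd e'" by blast
        then show False using e1[of e] e2[of e'] dj by auto
      qed
    qed (use inj_snd_edges[OF c] IH in auto)
    have 3: "card (edges x \<union> uedges xs) = 2 * (length x + tlen xs)"
      using ed IH card_edges[OF c] by (simp add: card_Un_disjoint)
    have 4: "card (vars x \<union> uvars xs) = length x + tlen xs" "card (cls x \<union> ucls xs) = length x + tlen xs"
      using dj IH card_vars[OF c] card_cls[OF c] by (simp_all add: card_Un_disjoint)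
    have 5: "card {e\<in>edges x \<union> uedges xs. fst (fst e) = v} = 2" if v: "v \<in> vars x \<union> uvars xs" for v
    proof (cases "v \<in> vars x")
      case True
      then have "{e\<in>edges x \<union> uedges xs. fst (fst e) = v} = {e\<in>edges x. fst (fst e) = v}" using e2 dj by blast
      then show ?thesis using degree_two[OF c True] by simp
    next
      case False
      then have "{e\<in>edges x \<union> uedges xs. fst (fst e) = v} = {e\<in>uedges xs. fst (fst e) = v}" using e1 by blast
      then show ?thesis using IH v False by auto
    qed
    have "\<forall>s\<in>set x. bin s < k \<and> bout s < k" using short_D(5)[OF x] alphabet_iff by blast
    then have 6: "Zsum (edges x \<union> uedges xs) (vars x \<union> uvars xs) (cls x \<union> ucls xs) = (1 + delta ^ length x) * wt (\<lambda>l. 1 + delta ^ l) xs"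
      using Zsum_Un[OF _ _ _ _ dj e1 e2] Zsum_cycle[OF c] IH by simp
    show ?case using 1 2 3 4 5 6 by simp
  qed
  then show "inj_on fst (uedges \<gamma>s)" "inj_on snd (uedges \<gamma>s)" "card (uedges \<gamma>s) = 2 * tlen \<gamma>s"
    "card (uvars \<gamma>s) = tlen \<gamma>s" "card (ucls \<gamma>s) = tlen \<gamma>s"
    "\<And>v. v \<in> uvars \<gamma>s \<Longrightarrow> card {e\<in>uedges \<gamma>s. fst (fst e) = v} = 2"
    "Zsum (uedges \<gamma>s) (uvars \<gamma>s) (ucls \<gamma>s) = wt (\<lambda>l. 1 + delta ^ l) \<gamma>s" by auto
qed

lemma vdisjoint_partial_matching:
  "\<gamma>s \<in> tuples L s r \<Longrightarrow> vdisjoint \<gamma>s \<Longrightarrow> partial_matching r (uedges \<gamma>s)"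
  using vdisjoint_structure(1,2) uedges_subset by (simp add: partial_matching_def)

text \<open>For disjoint tuples the scaled probability is a value of \<open>fall_ratio\<close>, so
  each cycle has limiting weight 1. The limit is the one that independent Poisson counts with means
  \<open>lam l\<close> would give.\<close>

theorem uniform_tuples_tendsto:
  "(\<lambda>r. \<Sum>\<gamma>s | \<gamma>s \<in> tuples L s r \<and> distinct \<gamma>s. wt \<theta> \<gamma>s * P r (uedges \<gamma>s)) \<longlonglongrightarrow> (\<Sum>l\<in>{1..L}. lam l * \<theta> l) ^ s"
proof -
  have "(\<lambda>r. \<Sum>\<gamma>s | \<gamma>s \<in> tuples L s r \<and> distinct \<gamma>s. wt \<theta> \<gamma>s * P r (uedges \<gamma>s)) \<longlonglongrightarrow> (\<Sum>l\<in>{1..L}. lam l * (\<theta> l * (\<lambda>_. 1) l)) ^ s"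
  proof (rule distinct_tuples_tendsto[where err = "\<lambda>r. \<Sum>e\<le>2*(s*L). \<bar>fall_ratio r e - 1\<bar>" and ?r0.0 = 1])
    fix r \<gamma>s assume r: "1 \<le> r" and g: "\<gamma>s \<in> tuples L s r" "vdisjoint \<gamma>s"
    have Np: "real (N r) > 0" using N_pos[of r] r by simp
    have "P r (uedges \<gamma>s) * real (N r) ^ (2 * tlen \<gamma>s) = fall_ratio r (2 * tlen \<gamma>s)"
      using P_partial[OF vdisjoint_partial_matching[OF g]] r Np vdisjoint_structure(3)[OF g] by simp
    moreover have "wt (\<lambda>_. 1) \<gamma>s = 1" by (induction \<gamma>s) auto
    moreover have "\<bar>fall_ratio r (2 * tlen \<gamma>s) - 1\<bar> \<le> (\<Sum>e\<le>2*(s*L). \<bar>fall_ratio r e - 1\<bar>)"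
      using tlen_le[OF g(1)] by (intro member_le_sum) auto
    ultimately show "\<bar>P r (uedges \<gamma>s) * real (N r) ^ (2 * tlen \<gamma>s) - wt (\<lambda>_. 1) \<gamma>s\<bar> \<le> (\<Sum>e\<le>2*(s*L). \<bar>fall_ratio r e - 1\<bar>)"
      by simp
  next
    have "(\<lambda>r. \<Sum>e\<le>2*(s*L). \<bar>fall_ratio r e - 1\<bar>) \<longlonglongrightarrow> (\<Sum>e\<le>2*(s*L). \<bar>1 - 1\<bar>)"
      by (intro tendsto_sum tendsto_rabs tendsto_diff fall_ratio_tendsto tendsto_const)
    then show "(\<lambda>r. \<Sum>e\<le>2*(s*L). \<bar>fall_ratio r e - 1\<bar>) \<longlonglongrightarrow> 0" by simp
  next
    show "(\<lambda>r. \<Sum>\<gamma>s | \<gamma>s \<in> tuples L s r \<and> bad \<gamma>s. \<bar>P r (uedges \<gamma>s)\<bar>) \<longlonglongrightarrow> 0"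
      using bad_sum_tendsto[of L s] by (simp add: P_nonneg)
  qed
  then show ?thesis by simp
qed

section \<open>Cycles in the matching reweighted by the number of satisfying assignments\<close>

definition planted_ext :: "nat \<Rightarrow> edge set \<Rightarrow> real" where
  "planted_ext r S = E r (\<lambda>f. X r f * of_bool (extends S f)) / E r (X r)"

definition falling_ratio :: "nat \<Rightarrow> nat \<Rightarrow> nat \<Rightarrow> real" where
  "falling_ratio c e r = fact (c*r - e) * real (c*r) ^ e / fact (c*r)"

lemma falling_ratio_tendsto:
  assumes "c > 0" shows "(\<lambda>r. falling_ratio c e r) \<longlonglongrightarrow> 1"
proof -
  have "filterlim (\<lambda>r. c * r) at_top sequentially"
    using assms by (intro filterlim_subseq) (auto simp: strict_mono_def)
  then have "(\<lambda>r. inverse (fact (c*r) / (fact (c*r - e) * real (c*r) ^ e))) \<longlonglongrightarrow> inverse (1::real)"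
    by (intro tendsto_inverse filterlim_compose[OF falling_factorial_asymp]) simp_all
  then show ?thesis by (simp add: falling_ratio_def field_simps)
qed

lemma fact_minus_FR:
  assumes "c > 0" "r > 0"
  shows "fact (c*r - e) = falling_ratio c e r * fact (c*r) / real (c*r) ^ e"
  using assms by (simp add: falling_ratio_def)

lemma N_diff: "N r - d*r = d*(k-1)*r"
proof -
  have "k = (k - 1) + 1" using k_gt_2 by simp
  then have "N r = d*(k-1)*r + d*r" unfolding N_def by (metis (no_types, opaque_lifting) add_mult_distrib2 mult.assoc mult.commute mult.left_commute nat_mult_1)
  then show ?thesis by simp
qed

lemma E_X: "E r (X r) = real ((k*r) choose r) * fact (d*r) * fact (d*(k-1)*r) * real k ^ (d*r) / fact (N r)"
  using first_moment[of r] by (simp only: N_diff)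

lemma E_X_pos: "E r (X r) > 0"
  using k_gt_2 unfolding E_X by (auto intro!: mult_pos_pos divide_pos_pos simp: zero_less_binomial)

text \<open>The coefficient of a set of q true variables in \<open>planted_sum\<close>, for cycles
  with j variables, j clauses and \<open>2 * j\<close> edges, divided by the first moment and scaled
  by \<open>N r ^ (2 * j)\<close>.\<close>

definition planted_coeff :: "nat \<Rightarrow> nat \<Rightarrow> nat \<Rightarrow> real" where
  "planted_coeff r j q = real ((k*r - j) choose (r - q)) * (fact (d*r - 2*q) * fact (d*(k-1)*r - (2*j - 2*q)) * real k ^ (d*r - j)) * real (N r) ^ (2*j)
     / (real ((k*r) choose r) * fact (d*r) * fact (d*(k-1)*r) * real k ^ (d*r))"

text \<open>Every falling factorial is replaced by a power with a correction tending to 1. A true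
  variable then collects 1/k for its truth value, k^2 for its two edges and 1/k for one clause,
  which makes 1; a false one collects (k - 1)/k, (k/(k - 1))^2 and 1/k, which makes 1/(k - 1). The
  clauses can be shared out because they are as many as the variables.\<close>

lemma planted_coeff_eq:
  assumes r: "r > j" "q \<le> j"
  shows "planted_coeff r j q = falling_ratio k j r * falling_ratio d (2*q) r * falling_ratio (d*(k-1)) (2*j-2*q) r / (falling_ratio 1 q r * falling_ratio (k-1) (j-q) r) * (1 / (real k - 1)) ^ (j - q)"
proof -
  have r0: "r > 0" using r by simp
  have pos: "k > 0" "k - 1 > 0" "d * (k-1) > 0" using d_pos k_gt_2 by auto
  define p where "p = j - q"
  have j: "j = q + p" using r by (simp add: p_def)
  define R where "R = real r"
  define k1 where "k1 = real (k - 1)"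
  have k1: "k1 = real k - 1" "k1 > 0" using k_gt_2 by (auto simp: k1_def)
  have R: "R > 0" using r0 by (simp add: R_def)
  have dk: "real d > 0" "real k > 0" using d_pos k_gt_2 by auto
  have kr: "k * r = (k-1)*r + r" using k_gt_2 by (metis (no_types, lifting) Suc_diff_1 add.commute mult_Suc pos(1))
  have sub: "k*r - j - (r - q) = (k-1)*r - p" using r kr by (simp add: j)
  have jr: "j \<le> d * r" using r d_pos by (metis less_imp_le_nat le_trans mult_le_mono1 nat_mult_1 One_nat_def Suc_leI)
  have "1 \<le> k - 1" using k_gt_2 by simp
  from mult_le_mono1[OF this, of r] have k1r: "r \<le> (k-1)*r" by simp
  have sub_le: "r \<le> M \<Longrightarrow> q + p < r \<Longrightarrow> r - q \<le> M + r - (q + p)" for M by presburger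
  have le: "r - q \<le> k*r - j" unfolding kr j by (rule sub_le[OF k1r]) (use r in \<open>simp add: j\<close>)
  have b1: "real ((k*r - j) choose (r - q)) = fact (k*r - j) / (fact (r - q) * fact ((k-1)*r - p))"
    using binomial_fact[OF le, where ?'a=real] sub by simp
  have b2: "real ((k*r) choose r) = fact (k*r) / (fact r * fact ((k-1)*r))"
    using binomial_fact[of r "k*r", where ?'a=real] kr by simp
  have fr: "fact (k*r - j) = falling_ratio k j r * fact (k*r) / (real k * R) ^ j"
    "fact (r - q) = falling_ratio 1 q r * fact r / R ^ q"
    "fact ((k-1)*r - p) = falling_ratio (k-1) p r * fact ((k-1)*r) / (k1 * R) ^ p"
    "fact (d*r - 2*q) = falling_ratio d (2*q) r * fact (d*r) / (real d * R) ^ (2*q)"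
    "fact (d*(k-1)*r - (2*j-2*q)) = falling_ratio (d*(k-1)) (2*j-2*q) r * fact (d*(k-1)*r) / (real d * k1 * R) ^ (2*p)"
    using fact_minus_FR[OF pos(1) r0, of j] fact_minus_FR[of 1 r q] fact_minus_FR[OF pos(2) r0, of p]
      fact_minus_FR[OF d_pos r0, of "2*q"] fact_minus_FR[OF pos(3) r0, of "2*j-2*q"] r0
    by (simp_all add: R_def k1_def j)
  have FRp: "falling_ratio c e r > 0" if "c > 0" for c e using that r0 by (simp add: falling_ratio_def)
  have kp: "real k ^ (d*r - j) = real k ^ (d*r) / real k ^ j" using jr dk by (simp add: power_diff)
  have Nr: "real (N r) = real d * real k * R" by (simp add: N_def R_def)
  have pw: "1 / (real k * R) ^ j * (R ^ q * (k1 * R) ^ p) * (1 / (real d * R) ^ (2*q) * (1 / (real d * k1 * R) ^ (2*p)) * (1 / real k ^ j)) * (real d * real k * R) ^ (2*j) = (1 / k1) ^ p"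
    using dk R k1(2) unfolding j
    by (simp add: power_add power_mult_distrib power_mult power2_eq_square field_simps)
  have gen: "(F1 * A / a) / ((F2 * B / b) * (F3 * C / c)) * ((F4 * D / dd) * (F5 * H / h) * (G / g)) * n / (A / (B * C) * D * H * G)
     = F1 * F4 * F5 / (F2 * F3) * (1 / a * (b * c) * (1 / dd * (1 / h) * (1 / g)) * n)"
    if "A \<noteq> 0" "B \<noteq> 0" "C \<noteq> 0" "D \<noteq> 0" "H \<noteq> 0" "G \<noteq> 0"
    for F1 F2 F3 F4 F5 A B C D H G a b c dd h g n :: real
    using that by (simp add: divide_simps)
  have nz: "fact (k*r) \<noteq> (0::real)" "fact r \<noteq> (0::real)" "fact ((k-1)*r) \<noteq> (0::real)" "fact (d*r) \<noteq> (0::real)" "fact (d*(k-1)*r) \<noteq> (0::real)" "real k ^ (d*r) \<noteq> 0"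
    using dk by simp_all
  show ?thesis
    unfolding planted_coeff_def b1 b2 fr kp Nr gen[OF nz] pw k1(1)[symmetric] p_def[symmetric] ..
qed

lemma planted_coeff_tendsto:
  assumes "q \<le> j"
  shows "(\<lambda>r. planted_coeff r j q) \<longlonglongrightarrow> (1 / (real k - 1)) ^ (j - q)"
proof -
  have pos: "k > 0" "k - 1 > 0" "d * (k-1) > 0" using d_pos k_gt_2 by auto
  have "(\<lambda>r. falling_ratio k j r * falling_ratio d (2*q) r * falling_ratio (d*(k-1)) (2*j-2*q) r / (falling_ratio 1 q r * falling_ratio (k-1) (j-q) r) * (1 / (real k - 1)) ^ (j - q)) \<longlonglongrightarrow> 1 * 1 * 1 / (1 * 1) * (1 / (real k - 1)) ^ (j - q)"
    by (intro tendsto_mult tendsto_divide falling_ratio_tendsto tendsto_const pos d_pos) auto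
  moreover have "\<forall>\<^sub>F r in sequentially. falling_ratio k j r * falling_ratio d (2*q) r * falling_ratio (d*(k-1)) (2*j-2*q) r / (falling_ratio 1 q r * falling_ratio (k-1) (j-q) r) * (1 / (real k - 1)) ^ (j - q) = planted_coeff r j q"
    using eventually_gt_at_top[of j] by eventually_elim (rule planted_coeff_eq[OF _ assms, symmetric])
  ultimately have "(\<lambda>r. planted_coeff r j q) \<longlonglongrightarrow> 1 * 1 * 1 / (1 * 1) * (1 / (real k - 1)) ^ (j - q)"
    by (rule Lim_transform_eventually)
  then show ?thesis by simp
qed

lemma allowed_le: "allowed S \<tau> c \<le> k"
proof -
  have "card {b. b < k \<and> (\<forall>p b'. (p, (c, b')) \<in> S \<longrightarrow> (fst p \<in> \<tau> \<longleftrightarrow> b = b'))} \<le> card {..<k}"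
    by (intro card_mono) auto
  then show ?thesis by (simp add: allowed_def)
qed

text \<open>The scaled planted probability is an exact sum over \<tau>, and replacing each
  coefficient by its limit turns it into \<open>Zsum\<close>. There are \<open>2 ^ j\<close> sets
  \<tau> and the product of the clause factors is at most \<open>k ^ j\<close>; enlarging j to
  \<open>s * L\<close> makes the error independent of the tuple.\<close>

lemma planted_ext_vdisjoint:
  assumes g: "\<gamma>s \<in> tuples L s r" "vdisjoint \<gamma>s" and r: "r > s * L"
  shows "\<bar>planted_ext r (uedges \<gamma>s) * real (N r) ^ (2 * tlen \<gamma>s) - wt (\<lambda>l. 1 + delta ^ l) \<gamma>s\<bar>
     \<le> (2 * real k) ^ (s*L) * (\<Sum>j\<le>s*L. \<Sum>q\<le>j. \<bar>planted_coeff r j q - (1 / (real k - 1)) ^ (j - q)\<bar>)"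
proof -
  define j where "j = tlen \<gamma>s"
  define D where "D = (\<Sum>j\<le>s*L. \<Sum>q\<le>j. \<bar>planted_coeff r j q - (1 / (real k - 1)) ^ (j - q)\<bar>)"
  have jL: "j \<le> s * L" using tlen_le[OF g(1)] by (simp add: j_def)
  note st = vdisjoint_structure[OF g, folded j_def]
  have J: "uvars \<gamma>s = (fst \<circ> fst) ` uedges \<gamma>s" "ucls \<gamma>s = (fst \<circ> snd) ` uedges \<gamma>s"
    using uvars_eq ucls_eq tuples_D(2)[OF g(1)] by auto
  have sum: "(\<Sum>f\<in>Om r. X r f * of_bool (extends (uedges \<gamma>s) f)) =
    (\<Sum>\<tau>\<in>Pow (uvars \<gamma>s). real ((k*r - card (uvars \<gamma>s)) choose (r - card \<tau>)) *
       (fact (d*r - 2 * card \<tau>) * fact (N r - d*r - (card (uedges \<gamma>s) - 2 * card \<tau>)) * real k ^ (d*r - card (ucls \<gamma>s)) * (\<Prod>c\<in>ucls \<gamma>s. real (allowed (uedges \<gamma>s) \<tau> c))))"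
    by (rule planted_sum[OF vdisjoint_partial_matching[OF g] J(1) _ J(2) st(6)]) (use st(4) jL r in auto)
  let ?A = "\<lambda>\<tau>. \<Prod>c\<in>ucls \<gamma>s. real (allowed (uedges \<gamma>s) \<tau> c)"
  have "planted_ext r (uedges \<gamma>s) * real (N r) ^ (2*j) = (\<Sum>\<tau>\<in>Pow (uvars \<gamma>s). planted_coeff r j (card \<tau>) * ?A \<tau>)"
  proof -
    have cancel: "(a / fact (N r)) / (b / fact (N r)) = a / b" for a b :: real by simp
    show ?thesis
      unfolding planted_ext_def E_X unfolding E_def sum st(3,4,5) N_diff planted_coeff_def cancel sum_divide_distrib sum_distrib_right
      by (intro sum.cong refl) (simp only: times_divide_eq_left times_divide_eq_right mult_ac)
  qed
  moreover have "wt (\<lambda>l. 1 + delta ^ l) \<gamma>s = (\<Sum>\<tau>\<in>Pow (uvars \<gamma>s). (1 / (real k - 1)) ^ (j - card \<tau>) * ?A \<tau>)"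
    using st(7) by (simp add: Zsum_def st(4))
  ultimately have "planted_ext r (uedges \<gamma>s) * real (N r) ^ (2*j) - wt (\<lambda>l. 1 + delta ^ l) \<gamma>s
     = (\<Sum>\<tau>\<in>Pow (uvars \<gamma>s). (planted_coeff r j (card \<tau>) - (1 / (real k - 1)) ^ (j - card \<tau>)) * ?A \<tau>)"
    by (simp add: sum_subtractf left_diff_distrib)
  also have "\<bar>\<dots>\<bar> \<le> (\<Sum>\<tau>\<in>Pow (uvars \<gamma>s). D * real k ^ j)"
  proof (rule order_trans[OF sum_abs], rule sum_mono)
    fix \<tau> assume \<tau>: "\<tau> \<in> Pow (uvars \<gamma>s)"
    have q: "card \<tau> \<le> j" using \<tau> st(4) card_mono[of "uvars \<gamma>s" \<tau>] by auto
    have "\<bar>planted_coeff r j (card \<tau>) - (1 / (real k - 1)) ^ (j - card \<tau>)\<bar> \<le> (\<Sum>q\<le>j. \<bar>planted_coeff r j q - (1 / (real k - 1)) ^ (j - q)\<bar>)"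
      using q by (intro member_le_sum) auto
    also have "\<dots> \<le> D" unfolding D_def using jL by (intro member_le_sum[of j "{..s*L}"]) (auto intro: sum_nonneg)
    finally have 1: "\<bar>planted_coeff r j (card \<tau>) - (1 / (real k - 1)) ^ (j - card \<tau>)\<bar> \<le> D" .
    have "?A \<tau> \<le> (\<Prod>c\<in>ucls \<gamma>s. real k)" by (intro prod_mono) (auto simp: allowed_le)
    then have 2: "?A \<tau> \<le> real k ^ j" using st(5) by simp
    have "0 \<le> ?A \<tau>" by (intro prod_nonneg) auto
    then show "\<bar>(planted_coeff r j (card \<tau>) - (1 / (real k - 1)) ^ (j - card \<tau>)) * ?A \<tau>\<bar> \<le> D * real k ^ j"
      using 1 2 unfolding abs_mult by (intro mult_mono) auto
  qed
  also have "\<dots> = (2 * real k) ^ j * D" by (simp add: card_Pow st(4) power_mult_distrib)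
  also have "\<dots> \<le> (2 * real k) ^ (s*L) * D"
    using jL k_gt_2 by (intro mult_right_mono power_increasing) (auto simp: D_def intro!: sum_nonneg)
  finally show ?thesis by (simp add: D_def j_def)
qed

lemma E_mono: "(\<And>f. f \<in> Om r \<Longrightarrow> g f \<le> h f) \<Longrightarrow> E r g \<le> E r h"
  unfolding E_def by (intro divide_right_mono sum_mono) auto

lemma E_sum: "E r (\<lambda>f. \<Sum>i\<in>I. g i f) = (\<Sum>i\<in>I. E r (g i))"
  unfolding E_def by (subst sum.swap) (simp add: sum_divide_distrib)

lemma E_cmult: "E r (\<lambda>f. c * g f) = c * E r g"
  unfolding E_def by (simp add: sum_distrib_left)

lemma E_add: "E r (\<lambda>f. g f + h f) = E r g + E r h"
  unfolding E_def by (simp add: sum.distrib add_divide_distrib)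

lemma E_diff: "E r (\<lambda>f. g f - h f) = E r g - E r h"
  unfolding E_def by (simp add: sum_subtractf diff_divide_distrib)

lemma E_nonneg: "(\<And>f. f \<in> Om r \<Longrightarrow> 0 \<le> g f) \<Longrightarrow> 0 \<le> E r g"
  unfolding E_def by (intro divide_nonneg_pos sum_nonneg) auto

lemma E_Cauchy_Schwarz: "(E r (\<lambda>f. g f * h f))\<^sup>2 \<le> E r (\<lambda>f. (g f)\<^sup>2) * E r (\<lambda>f. (h f)\<^sup>2)"
proof -
  have "(\<Sum>f\<in>Om r. g f * h f)\<^sup>2 / (fact (N r))\<^sup>2 \<le> (\<Sum>f\<in>Om r. (g f)\<^sup>2) * (\<Sum>f\<in>Om r. (h f)\<^sup>2) / (fact (N r))\<^sup>2"
    by (intro divide_right_mono Cauchy_Schwarz_ineq_sum) simp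
  then show ?thesis by (simp add: E_def power_divide power2_eq_square)
qed

text \<open>The square runs over pairs of bad tuples. Concatenation turns a pair into a bad tuple of
  length \<open>s + s\<close> with the same edges, and it is injective since both halves have length
  s.\<close>

lemma bad_count_second_moment:
  "E r (\<lambda>f. (\<Sum>\<gamma>s | \<gamma>s \<in> tuples L s r \<and> bad \<gamma>s. of_bool (extends (uedges \<gamma>s) f))\<^sup>2)
     \<le> (\<Sum>\<gamma>s | \<gamma>s \<in> tuples L (s + s) r \<and> bad \<gamma>s. P r (uedges \<gamma>s))"
proof -
  let ?B = "{\<gamma>s. \<gamma>s \<in> tuples L s r \<and> bad \<gamma>s}"
  have inj: "inj_on (\<lambda>(a, b). a @ b) (?B \<times> ?B)" by (auto simp: inj_on_def tuples_def)
  have "E r (\<lambda>f. (\<Sum>\<gamma>s\<in>?B. of_bool (extends (uedges \<gamma>s) f))\<^sup>2) = E r (\<lambda>f. \<Sum>a\<in>?B. \<Sum>b\<in>?B. of_bool (extends (uedges (a @ b)) f))"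
    by (simp only: power2_eq_square sum_product uedges_append extends_Un of_bool_conj)
  also have "\<dots> = (\<Sum>a\<in>?B. \<Sum>b\<in>?B. P r (uedges (a @ b)))" by (simp only: E_sum P_def)
  also have "\<dots> = (\<Sum>c\<in>(\<lambda>(a, b). a @ b) ` (?B \<times> ?B). P r (uedges c))"
    by (subst sum.reindex[OF inj]) (simp add: sum.cartesian_product case_prod_beta)
  also have "\<dots> \<le> (\<Sum>\<gamma>s | \<gamma>s \<in> tuples L (s + s) r \<and> bad \<gamma>s. P r (uedges \<gamma>s))"
  proof (rule sum_mono2)
    show "(\<lambda>(a, b). a @ b) ` (?B \<times> ?B) \<subseteq> {\<gamma>s. \<gamma>s \<in> tuples L (s + s) r \<and> bad \<gamma>s}"
    proof (rule image_subsetI)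
      fix p assume "p \<in> ?B \<times> ?B"
      then obtain a b where p: "p = (a, b)" "a \<in> ?B" "b \<in> ?B" by blast
      have "bad (a @ b)" using p(2) unfolding bad_def set_append by blast
      then show "(case p of (a, b) \<Rightarrow> a @ b) \<in> {\<gamma>s. \<gamma>s \<in> tuples L (s + s) r \<and> bad \<gamma>s}"
        using p by (auto simp: tuples_def)
    qed
  qed (auto simp: P_nonneg)
  finally show ?thesis .
qed

lemma second_moment_ratio_bounded:
  assumes "real d < d_star k" "\<epsilon> > 0"
  shows "\<forall>\<^sub>F r in sequentially. E r (\<lambda>f. (X r f)\<^sup>2) \<le> (sqrt ((real k - 1) / (real k - real d)) + \<epsilon>) * (E r (X r))\<^sup>2"
proof -
  have "\<forall>\<^sub>F r in sequentially. (\<Sum>t\<le>r. overlap_term d k r t) \<le> sqrt ((real k - 1) / (real k - real d)) + \<epsilon>"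
    by (rule overlap_sum_limsup[OF d_pos k_gt_2 assms(1)]) (use assms(2) in simp)
  then show ?thesis using eventually_gt_at_top[of 0]
  proof eventually_elim
    case (elim r)
    then show ?case unfolding second_moment[OF elim(2)] by (subst mult.commute) (intro mult_right_mono, auto)
  qed
qed

text \<open>On disjoint tuples the limiting weight \<open>1 + delta ^ l\<close> per cycle is
  supplied by \<open>Zsum_cycle\<close>. Bad tuples need another route, because cycles that meet may
  put more than two edges at a variable and \<open>planted_sum\<close> does not apply to them in
  general.\<close>

theorem planted_tuples_tendsto:
  assumes dstar: "real d < d_star k"
  shows "(\<lambda>r. \<Sum>\<gamma>s | \<gamma>s \<in> tuples L s r \<and> distinct \<gamma>s. wt \<theta> \<gamma>s * planted_ext r (uedges \<gamma>s)) \<longlonglongrightarrow> (\<Sum>l\<in>{1..L}. lam l * (\<theta> l * (1 + delta ^ l))) ^ s"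
proof (rule distinct_tuples_tendsto[where ?r0.0 = "Suc (s * L)"])
  show "\<bar>planted_ext r (uedges \<gamma>s) * real (N r) ^ (2 * tlen \<gamma>s) - wt (\<lambda>l. 1 + delta ^ l) \<gamma>s\<bar>
     \<le> (2 * real k) ^ (s*L) * (\<Sum>j\<le>s*L. \<Sum>q\<le>j. \<bar>planted_coeff r j q - (1 / (real k - 1)) ^ (j - q)\<bar>)"
    if "r \<ge> Suc (s * L)" "\<gamma>s \<in> tuples L s r" "vdisjoint \<gamma>s" for r \<gamma>s
    by (rule planted_ext_vdisjoint) (use that in auto)
  have "(\<lambda>r. (2 * real k) ^ (s*L) * (\<Sum>j\<le>s*L. \<Sum>q\<le>j. \<bar>planted_coeff r j q - (1 / (real k - 1)) ^ (j - q)\<bar>)) \<longlonglongrightarrow> 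
    (2 * real k) ^ (s*L) * (\<Sum>j\<le>s*L. \<Sum>q\<le>j. \<bar>(1 / (real k - 1)) ^ (j - q) - (1 / (real k - 1)) ^ (j - q)\<bar>)"
    by (intro tendsto_mult tendsto_sum tendsto_rabs tendsto_diff planted_coeff_tendsto tendsto_const) auto
  then show "(\<lambda>r. (2 * real k) ^ (s*L) * (\<Sum>j\<le>s*L. \<Sum>q\<le>j. \<bar>planted_coeff r j q - (1 / (real k - 1)) ^ (j - q)\<bar>)) \<longlonglongrightarrow> 0"
    by simp
  \<comment> \<open>Cauchy--Schwarz reduces the bad tuples of the planted model to those of the uniform model.\<close>
  define b where "b = sqrt ((real k - 1) / (real k - real d)) + 1"
  let ?bad = "\<lambda>s r. \<Sum>\<gamma>s | \<gamma>s \<in> tuples L s r \<and> bad \<gamma>s. P r (uedges \<gamma>s)"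
  have PX0: "planted_ext r S \<ge> 0" for r S
    unfolding planted_ext_def using E_X_pos[of r] by (intro divide_nonneg_pos E_nonneg) (auto simp: X_def)
  show "(\<lambda>r. \<Sum>\<gamma>s | \<gamma>s \<in> tuples L s r \<and> bad \<gamma>s. \<bar>planted_ext r (uedges \<gamma>s)\<bar>) \<longlonglongrightarrow> 0"
  proof (rule Lim_null_comparison)
    show "(\<lambda>r. sqrt (b * ?bad (s + s) r)) \<longlonglongrightarrow> 0"
      using tendsto_real_sqrt[OF tendsto_mult_left[OF bad_sum_tendsto[of L "s + s"], of b]] by simp
    show "\<forall>\<^sub>F r in sequentially. norm (\<Sum>\<gamma>s | \<gamma>s \<in> tuples L s r \<and> bad \<gamma>s. \<bar>planted_ext r (uedges \<gamma>s)\<bar>) \<le> sqrt (b * ?bad (s + s) r)"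
      using second_moment_ratio_bounded[OF dstar zero_less_one]
    proof eventually_elim
      case (elim r)
      define B where "B f = (\<Sum>\<gamma>s | \<gamma>s \<in> tuples L s r \<and> bad \<gamma>s. of_bool (extends (uedges \<gamma>s) f) :: real)" for f
      have eq: "(\<Sum>\<gamma>s | \<gamma>s \<in> tuples L s r \<and> bad \<gamma>s. \<bar>planted_ext r (uedges \<gamma>s)\<bar>) = E r (\<lambda>f. X r f * B f) / E r (X r)"
        using PX0 by (simp only: B_def sum_distrib_left E_sum planted_ext_def sum_divide_distrib abs_of_nonneg)
      have sq: "(E r (\<lambda>f. X r f * B f) / E r (X r))\<^sup>2 \<le> b * ?bad (s + s) r"
      proof -
        have "(E r (\<lambda>f. X r f * B f))\<^sup>2 \<le> E r (\<lambda>f. (X r f)\<^sup>2) * E r (\<lambda>f. (B f)\<^sup>2)" by (rule E_Cauchy_Schwarz)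
        also have "\<dots> \<le> (b * (E r (X r))\<^sup>2) * ?bad (s + s) r"
          using elim bad_count_second_moment[of r L s] unfolding B_def b_def
          by (intro mult_mono) (auto intro!: E_nonneg mult_nonneg_nonneg order_trans[OF E_nonneg elim])
        finally have "(E r (\<lambda>f. X r f * B f))\<^sup>2 \<le> (b * ?bad (s + s) r) * (E r (X r))\<^sup>2" by (simp only: mult_ac)
        then show ?thesis unfolding power_divide using E_X_pos[of r] by (subst pos_divide_le_eq) auto
      qed
      have "0 \<le> (\<Sum>\<gamma>s | \<gamma>s \<in> tuples L s r \<and> bad \<gamma>s. \<bar>planted_ext r (uedges \<gamma>s)\<bar>)" by (intro sum_nonneg) simp
      moreover have "(\<Sum>\<gamma>s | \<gamma>s \<in> tuples L s r \<and> bad \<gamma>s. \<bar>planted_ext r (uedges \<gamma>s)\<bar>) \<le> sqrt (b * ?bad (s + s) r)"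
        unfolding eq by (rule real_le_rsqrt[OF sq])
      ultimately show ?case unfolding real_norm_def by (simp only: abs_of_nonneg)
    qed
  qed
qed

section \<open>Elementary symmetric polynomials of the short cycles\<close>

definition Cyc :: "nat \<Rightarrow> nat \<Rightarrow> (nat \<times> nat \<Rightarrow> nat \<times> nat) \<Rightarrow> step list set" where
  "Cyc L r f = {x\<in>short L r. extends (edges x) f}"

text \<open>The s-th elementary symmetric polynomial in the weights of the cycles in A. It is
  multilinear in the cycle indicators, and its means take the role of factorial moments.\<close>

definition esym :: "nat \<Rightarrow> (nat \<Rightarrow> real) \<Rightarrow> step list set \<Rightarrow> real" where
  "esym s \<theta> A = (\<Sum>S | S \<subseteq> A \<and> card S = s. \<Prod>x\<in>S. \<theta> (length x))"

lemma finite_Cyc [simp]: "finite (Cyc L r f)" by (simp add: Cyc_def)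

lemma esym_Cyc: "esym s \<theta> (Cyc L r f) = (\<Sum>\<gamma>s | \<gamma>s \<in> tuples L s r \<and> distinct \<gamma>s. wt \<theta> \<gamma>s * of_bool (extends (uedges \<gamma>s) f)) / fact s"
proof -
  have "(\<Sum>\<gamma>s | \<gamma>s \<in> tuples L s r \<and> distinct \<gamma>s. wt \<theta> \<gamma>s * of_bool (extends (uedges \<gamma>s) f))
    = (\<Sum>xs | set xs \<subseteq> Cyc L r f \<and> length xs = s \<and> distinct xs. prod_list (map (\<lambda>x. \<theta> (length x)) xs))"
  proof (rule sum.mono_neutral_cong_right)
    have *: "extends (uedges \<gamma>s) f \<longleftrightarrow> (\<forall>x\<in>set \<gamma>s. extends (edges x) f)" for \<gamma>s
      by (auto simp: extends_def uedges_def)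
    show "{xs. set xs \<subseteq> Cyc L r f \<and> length xs = s \<and> distinct xs} \<subseteq> {\<gamma>s. \<gamma>s \<in> tuples L s r \<and> distinct \<gamma>s}"
      by (auto simp: Cyc_def tuples_def)
    show "\<forall>\<gamma>s\<in>{\<gamma>s. \<gamma>s \<in> tuples L s r \<and> distinct \<gamma>s} - {xs. set xs \<subseteq> Cyc L r f \<and> length xs = s \<and> distinct xs}. wt \<theta> \<gamma>s * of_bool (extends (uedges \<gamma>s) f) = 0"
      using * by (auto simp: Cyc_def tuples_def)
    show "wt \<theta> \<gamma>s * of_bool (extends (uedges \<gamma>s) f) = prod_list (map (\<lambda>x. \<theta> (length x)) \<gamma>s)"
      if "\<gamma>s \<in> {xs. set xs \<subseteq> Cyc L r f \<and> length xs = s \<and> distinct xs}" for \<gamma>s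
      using that * by (auto simp: wt_def Cyc_def)
  qed simp
  then show ?thesis using sum_distinct_lists_prod[OF finite_Cyc, of "\<lambda>x. \<theta> (length x)"] by (simp add: esym_def)
qed

text \<open>Each set of s cycles is listed by \<open>fact s\<close> distinct tuples. The limits are
  the coefficients of an exponential series, so their sums over s are exponentials.\<close>

lemma E_esym_tendsto: "(\<lambda>r. E r (\<lambda>f. esym s \<theta> (Cyc L r f))) \<longlonglongrightarrow> (\<Sum>l\<in>{1..L}. lam l * \<theta> l) ^ s / fact s"
proof -
  have "E r (\<lambda>f. esym s \<theta> (Cyc L r f)) = (\<Sum>\<gamma>s | \<gamma>s \<in> tuples L s r \<and> distinct \<gamma>s. wt \<theta> \<gamma>s * P r (uedges \<gamma>s)) / fact s" for r
    unfolding esym_Cyc divide_inverse by (subst mult.commute) (simp only: E_cmult E_sum P_def mult.commute)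
  then show ?thesis using tendsto_divide[OF uniform_tuples_tendsto[where L = L and s = s and \<theta> = \<theta>] tendsto_const[of "fact s"]] by simp
qed

lemma E_X_esym_tendsto:
  assumes "real d < d_star k"
  shows "(\<lambda>r. E r (\<lambda>f. X r f * esym s \<theta> (Cyc L r f)) / E r (X r)) \<longlonglongrightarrow> (\<Sum>l\<in>{1..L}. lam l * (\<theta> l * (1 + delta ^ l))) ^ s / fact s"
proof -
  have "E r (\<lambda>f. X r f * esym s \<theta> (Cyc L r f)) / E r (X r) = (\<Sum>\<gamma>s | \<gamma>s \<in> tuples L s r \<and> distinct \<gamma>s. wt \<theta> \<gamma>s * planted_ext r (uedges \<gamma>s)) / fact s" for r
  proof -
    have "X r f * esym s \<theta> (Cyc L r f) = inverse (fact s) * (\<Sum>\<gamma>s | \<gamma>s \<in> tuples L s r \<and> distinct \<gamma>s. wt \<theta> \<gamma>s * (X r f * of_bool (extends (uedges \<gamma>s) f)))" for f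
      unfolding esym_Cyc by (simp only: divide_inverse sum_distrib_left sum_distrib_right mult_ac)
    then have "E r (\<lambda>f. X r f * esym s \<theta> (Cyc L r f)) = inverse (fact s) * (\<Sum>\<gamma>s | \<gamma>s \<in> tuples L s r \<and> distinct \<gamma>s. wt \<theta> \<gamma>s * E r (\<lambda>f. X r f * of_bool (extends (uedges \<gamma>s) f)))"
      by (simp only: E_cmult E_sum)
    then show ?thesis by (simp add: planted_ext_def sum_divide_distrib divide_inverse mult_ac sum_distrib_left)
  qed
  then show ?thesis using tendsto_divide[OF planted_tuples_tendsto[OF assms, where L = L and s = s and \<theta> = \<theta>] tendsto_const[of "fact s"]] by simp
qed

end

section \<open>Small subgraph conditioning\<close>

text \<open>Each element x of U lies in S only, in S' only or in both, and contributes
  \<open>t x\<close>, \<open>t x\<close> or its square.\<close>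

lemma sum_pairs_Un:
  fixes t :: "'a \<Rightarrow> real"
  assumes U: "finite U"
  shows "(\<Sum>(S, S')\<in>{(S, S'). S \<union> S' = U}. prod t S * prod t S') = (\<Prod>x\<in>U. 2 * t x + (t x)\<^sup>2)"
proof -
  have fin: "finite S" if "S \<in> Pow U" for S using that U by (auto intro: finite_subset)
  have inner: "(\<Sum>S'\<in>{S'. S \<union> S' = U}. prod t S * prod t S') = (\<Prod>x\<in>S. t x * (t x + 1)) * (\<Prod>x\<in>U - S. t x)" if S: "S \<in> Pow U" for S
  proof -
    have "(\<Sum>S'\<in>{S'. S \<union> S' = U}. prod t S * prod t S') = (\<Sum>R\<in>Pow S. prod t S * prod t ((U - S) \<union> R))"
      by (rule sum.reindex_bij_witness[where i = "\<lambda>R. (U - S) \<union> R" and j = "\<lambda>S'. S' \<inter> S"])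
         (use S in \<open>auto intro!: arg_cong2[where f = "(*)"] arg_cong[where f = "prod t"]\<close>)
    also have "\<dots> = (\<Sum>R\<in>Pow S. prod t S * prod t (U - S) * prod t R)"
    proof (intro sum.cong refl)
      fix R assume R: "R \<in> Pow S"
      have "finite R" using R fin[OF S] by (auto intro: finite_subset)
      moreover have "(U - S) \<inter> R = {}" using R by auto
      ultimately have "prod t ((U - S) \<union> R) = prod t (U - S) * prod t R" using U by (intro prod.union_disjoint) auto
      then show "prod t S * prod t ((U - S) \<union> R) = prod t S * prod t (U - S) * prod t R" by simp
    qed
    also have "\<dots> = prod t S * prod t (U - S) * (\<Prod>x\<in>S. t x + 1)"
      using prod_add[OF fin[OF S], of t "\<lambda>_. 1"] by (simp add: sum_distrib_left)
    finally show ?thesis by (simp add: prod.distrib mult_ac)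
  qed
  have set: "{(S, S'). S \<union> S' = U} = (SIGMA S:Pow U. {S'. S \<union> S' = U})" by auto
  have f1: "finite (Pow U)" and f2: "\<forall>S\<in>Pow U. finite {S'. S \<union> S' = U}"
    using U by (auto intro: finite_subset[of _ "Pow U"])
  have "(\<Sum>(S, S')\<in>{(S, S'). S \<union> S' = U}. prod t S * prod t S') = (\<Sum>S\<in>Pow U. \<Sum>S'\<in>{S'. S \<union> S' = U}. prod t S * prod t S')"
    unfolding set by (rule sum.Sigma[OF f1 f2, symmetric])
  also have "\<dots> = (\<Sum>S\<in>Pow U. (\<Prod>x\<in>S. t x * (t x + 1)) * (\<Prod>x\<in>U - S. t x))"
    by (intro sum.cong refl inner)
  also have "\<dots> = (\<Prod>x\<in>U. t x * (t x + 1) + t x)" using prod_add[OF U, of "\<lambda>x. t x * (t x + 1)" t] by simp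
  finally show ?thesis by (simp add: power2_eq_square algebra_simps)
qed

lemma sum_Pow_card_le:
  fixes g :: "'a set \<Rightarrow> real"
  assumes "finite A"
  shows "(\<Sum>s\<le>M. \<Sum>S | S \<subseteq> A \<and> card S = s. g S) = (\<Sum>S | S \<subseteq> A \<and> card S \<le> M. g S)"
proof -
  have "(\<Sum>S | S \<subseteq> A \<and> card S \<le> M. g S) = (\<Sum>s\<in>{..M}. \<Sum>S\<in>{S\<in>{S. S \<subseteq> A \<and> card S \<le> M}. card S = s}. g S)"
    using assms by (intro sum.group[symmetric]) auto
  also have "\<dots> = (\<Sum>s\<le>M. \<Sum>S | S \<subseteq> A \<and> card S = s. g S)"
    by (intro sum.cong refl) auto
  finally show ?thesis by simp
qed

text \<open>The pairs in the square are grouped by their union U. If \<open>card U \<le> M\<close>,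
  all pairs with this union occur and \<open>sum_pairs_Un\<close> is exact. If U is larger, only
  some of them occur, and absolute values allow the sum to be extended to all; these U form a tail
  that vanishes as M grows.\<close>

lemma square_truncated_le:
  fixes t :: "'a \<Rightarrow> real"
  assumes A: "finite A"
  shows "(\<Sum>S | S \<subseteq> A \<and> card S \<le> M. prod t S)\<^sup>2 \<le>
    (\<Sum>U | U \<subseteq> A \<and> card U \<le> M. \<Prod>x\<in>U. 2 * t x + (t x)\<^sup>2) +
    (\<Sum>U | U \<subseteq> A \<and> M < card U \<and> card U \<le> 2*M. \<Prod>x\<in>U. 2 * \<bar>t x\<bar> + (t x)\<^sup>2)"
proof -
  let ?Q = "{S. S \<subseteq> A \<and> card S \<le> M}"
  let ?p = "\<lambda>(S, S'). prod t S * prod t S'"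
  define V where "V = {U. U \<subseteq> A \<and> card U \<le> 2*M}"
  have finQ: "finite (?Q \<times> ?Q)" "finite V" using A by (auto simp: V_def)
  have fA: "finite U" if "U \<subseteq> A" for U using that A finite_subset by auto
  have inV: "(\<lambda>(S, S'). S \<union> S') ` (?Q \<times> ?Q) \<subseteq> V"
  proof (rule image_subsetI)
    fix p assume "p \<in> ?Q \<times> ?Q"
    then obtain S S' where p: "p = (S, S')" "S \<subseteq> A" "S' \<subseteq> A" "card S \<le> M" "card S' \<le> M" by blast
    have "card (S \<union> S') \<le> card S + card S'" by (rule card_Un_le)
    then show "(case p of (S, S') \<Rightarrow> S \<union> S') \<in> V" using p by (auto simp: V_def)
  qed
  have "(\<Sum>S\<in>?Q. prod t S)\<^sup>2 = (\<Sum>p\<in>?Q \<times> ?Q. ?p p)"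
    by (simp only: power2_eq_square sum_product sum.cartesian_product)
  also have "\<dots> = (\<Sum>U\<in>V. \<Sum>p\<in>{p\<in>?Q \<times> ?Q. (\<lambda>(S, S'). S \<union> S') p = U}. ?p p)"
    by (rule sum.group[OF finQ inV, symmetric])
  also have "\<dots> \<le> (\<Sum>U\<in>V. if card U \<le> M then \<Prod>x\<in>U. 2 * t x + (t x)\<^sup>2 else \<Prod>x\<in>U. 2 * \<bar>t x\<bar> + (t x)\<^sup>2)"
  proof (rule sum_mono)
    fix U assume "U \<in> V"
    then have U: "U \<subseteq> A" "finite U" using fA by (auto simp: V_def)
    let ?F = "{p\<in>?Q \<times> ?Q. (\<lambda>(S, S'). S \<union> S') p = U}"
    have finU: "finite {(S, S'). S \<union> S' = U}"
      by (rule finite_subset[of _ "Pow U \<times> Pow U"]) (use U in auto)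
    show "(\<Sum>p\<in>?F. ?p p) \<le> (if card U \<le> M then \<Prod>x\<in>U. 2 * t x + (t x)\<^sup>2 else \<Prod>x\<in>U. 2 * \<bar>t x\<bar> + (t x)\<^sup>2)"
    proof (cases "card U \<le> M")
      case True
      have "S \<subseteq> A \<and> card S \<le> M" if "S \<subseteq> U" for S
        using that U True card_mono[OF U(2) that] by auto
      then have "?F = {(S, S'). S \<union> S' = U}" by auto
      then show ?thesis using True sum_pairs_Un[OF U(2), of t] by simp
    next
      case False
      have "(\<Sum>p\<in>?F. ?p p) \<le> (\<Sum>p\<in>?F. \<bar>?p p\<bar>)" by (intro sum_mono abs_ge_self)
      also have "\<dots> \<le> (\<Sum>p\<in>{(S, S'). S \<union> S' = U}. \<bar>?p p\<bar>)"
        by (rule sum_mono2[OF finU]) auto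
      also have "\<dots> = (\<Sum>(S, S')\<in>{(S, S'). S \<union> S' = U}. prod (\<lambda>x. \<bar>t x\<bar>) S * prod (\<lambda>x. \<bar>t x\<bar>) S')"
        by (intro sum.cong refl) (auto simp: abs_mult abs_prod)
      also have "\<dots> = (\<Prod>x\<in>U. 2 * \<bar>t x\<bar> + (t x)\<^sup>2)" using sum_pairs_Un[OF U(2), of "\<lambda>x. \<bar>t x\<bar>"] by simp
      finally show ?thesis using False by simp
    qed
  qed
  also have "\<dots> = (\<Sum>U\<in>{U\<in>V. card U \<le> M}. \<Prod>x\<in>U. 2 * t x + (t x)\<^sup>2) + (\<Sum>U\<in>{U\<in>V. \<not> card U \<le> M}. \<Prod>x\<in>U. 2 * \<bar>t x\<bar> + (t x)\<^sup>2)"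
    using finQ(2) by (simp add: sum.If_cases Int_def)
  also have "{U\<in>V. card U \<le> M} = {U. U \<subseteq> A \<and> card U \<le> M}" by (auto simp: V_def)
  also have "{U\<in>V. \<not> card U \<le> M} = {U. U \<subseteq> A \<and> M < card U \<and> card U \<le> 2*M}" by (auto simp: V_def)
  finally show ?thesis .
qed

lemma square_sum_eq:
  fixes g :: "'a \<Rightarrow> real"
  assumes "finite A"
  shows "(\<Sum>x\<in>A. g x)\<^sup>2 = (\<Sum>x\<in>A. (g x)\<^sup>2) + 2 * (\<Sum>S | S \<subseteq> A \<and> card S = 2. prod g S)"
  using assms
proof (induction A rule: finite_induct)
  case empty
  have "{S. S \<subseteq> {} \<and> card S = 2} = {}" by auto
  then show ?case by simp
next
  case (insert x A)
  have "{S. S \<subseteq> insert x A \<and> card S = 2} = {S. S \<subseteq> A \<and> card S = 2} \<union> (\<lambda>y. {x, y}) ` A"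
  proof (intro subset_antisym subsetI)
    fix S assume "S \<in> {S. S \<subseteq> insert x A \<and> card S = 2}"
    then have S: "S \<subseteq> insert x A" "card S = 2" by auto
    then obtain a b where ab: "S = {a, b}" "a \<noteq> b" by (auto simp: card_2_iff)
    show "S \<in> {S. S \<subseteq> A \<and> card S = 2} \<union> (\<lambda>y. {x, y}) ` A"
    proof (cases "x \<in> S")
      case True
      then obtain y where "S = {x, y}" "y \<noteq> x" using ab by blast
      then show ?thesis using S by auto
    qed (use S in auto)
  qed (use insert.hyps in \<open>auto simp: card_insert_if\<close>)
  moreover have "{S. S \<subseteq> A \<and> card S = 2} \<inter> (\<lambda>y. {x, y}) ` A = {}" using insert.hyps by auto
  moreover have "(\<Sum>S\<in>(\<lambda>y. {x, y}) ` A. prod g S) = (\<Sum>y\<in>A. g x * g y)"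
  proof (subst sum.reindex)
    show "inj_on (\<lambda>y. {x, y}) A" using insert.hyps by (auto simp: inj_on_def doubleton_eq_iff)
    show "sum (prod g \<circ> (\<lambda>y. {x, y})) A = (\<Sum>y\<in>A. g x * g y)"
    proof (intro sum.cong refl)
      fix y assume "y \<in> A"
      then have "x \<noteq> y" using insert.hyps by blast
      then show "(prod g \<circ> (\<lambda>y. {x, y})) y = g x * g y" by simp
    qed
  qed
  ultimately have "(\<Sum>S | S \<subseteq> insert x A \<and> card S = 2. prod g S) = (\<Sum>S | S \<subseteq> A \<and> card S = 2. prod g S) + g x * (\<Sum>y\<in>A. g y)"
    using insert.hyps by (simp add: sum.union_disjoint sum_distrib_left)
  then show ?case using insert.hyps insert.IH by (simp add: power2_eq_square algebra_simps)
qed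

lemma exp_partial_sums: "(\<lambda>M. \<Sum>s\<le>M. x ^ s / fact s) \<longlonglongrightarrow> exp (x::real)"
  using exp_converges[of x] by (simp add: sums_def_le divide_inverse mult.commute)

lemma exp_partial_sums_tail: "(\<lambda>M. \<Sum>s\<in>{M<..2*M}. x ^ s / fact s) \<longlonglongrightarrow> (0::real)"
proof -
  have "(\<Sum>s\<in>{M<..2*M}. x ^ s / fact s) = (\<Sum>s\<le>2*M. x ^ s / fact s) - (\<Sum>s\<le>M. x ^ s / fact s)" for M
  proof -
    have "{..2*M} = {..M} \<union> {M<..2*M}" by auto
    then show ?thesis by (simp add: sum.union_disjoint ivl_disj_int)
  qed
  moreover have lim: "(\<lambda>M. \<Sum>s\<le>2*M. x ^ s / fact s) \<longlonglongrightarrow> exp x"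
    by (rule filterlim_compose[OF exp_partial_sums]) (auto intro!: filterlim_subseq simp: strict_mono_def)
  ultimately show ?thesis using tendsto_diff[OF lim exp_partial_sums[of x]] by simp
qed

section \<open>Comparing X with the truncated cycle product\<close>

context exact_cover
begin

definition tr :: "nat \<Rightarrow> real" where "tr l = delta ^ l"

lemma delta_bounds: "\<bar>delta\<bar> \<le> 1/2"
  using k_real by (simp add: delta_def field_simps)

lemma tr_bounds: "l \<ge> 1 \<Longrightarrow> \<bar>tr l\<bar> \<le> 1/2"
proof -
  assume l: "l \<ge> 1"
  have "\<bar>delta\<bar> ^ l \<le> \<bar>delta\<bar> ^ 1" using l delta_bounds by (intro power_decreasing) auto
  then show ?thesis using delta_bounds by (simp add: tr_def power_abs)
qed

lemma lam_nonneg: "lam l \<ge> 0"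
  using d_pos k_real by (simp add: lam_def)

text \<open>The growth (d - 1)(k - 1) of the cycle counts is damped by the square of
  \<open>delta\<close>, which leaves the ratio (d - 1)/(k - 1).\<close>

lemma lam_tr_sq: "lam l * (tr l)\<^sup>2 = ((real d - 1) / (real k - 1)) ^ l / (2 * real l)"
proof -
  have "(real k - 1) ^ l * (delta ^ l)\<^sup>2 = (1 / (real k - 1)) ^ l"
  proof -
    have "(real k - 1) ^ l * (delta ^ l)\<^sup>2 = ((real k - 1) * delta\<^sup>2) ^ l"
      by (simp add: power_mult_distrib power2_eq_square mult.assoc)
    also have "(real k - 1) * delta\<^sup>2 = 1 / (real k - 1)" using k_real by (simp add: delta_def power2_eq_square)
    finally show ?thesis .
  qed
  moreover have "lam l * (tr l)\<^sup>2 = (real d - 1) ^ l * ((real k - 1) ^ l * (delta ^ l)\<^sup>2) / (2 * real l)"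
    by (simp add: lam_def tr_def power_mult_distrib)
  ultimately have "lam l * (tr l)\<^sup>2 = (real d - 1) ^ l * (1 / (real k - 1)) ^ l / (2 * real l)" by simp
  then show ?thesis by (simp add: power_divide)
qed

definition Lam :: "nat \<Rightarrow> real" where "Lam L = (\<Sum>l\<in>{1..L}. lam l * (tr l)\<^sup>2)"
definition Lam_inf :: real where "Lam_inf = ln (sqrt ((real k - 1) / (real k - real d)))"

text \<open>With x = (d - 1)/(k - 1) the sum is the logarithmic series for - ln (1 - x) / 2, and 1 -
  x = (k - d)/(k - 1). This is the identity between the variance due to cycles and the constant of
  the second moment.\<close>

lemma Lam_tendsto:
  assumes "d < k" shows "Lam \<longlonglongrightarrow> Lam_inf" "Lam L \<le> Lam_inf" "exp Lam_inf = sqrt ((real k - 1) / (real k - real d))"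
proof -
  define x where "x = (real d - 1) / (real k - 1)"
  have x: "0 \<le> x" "x < 1" using assms d_pos k_real by (auto simp: x_def)
  have kd: "real k - real d > 0" using assms by simp
  have "(\<lambda>n. (x ^ n / real n) / 2) sums (- ln (1 - x) / 2)"
    using sums_divide[OF sums_minus[OF ln_series'[of "-x"]], of 2] x by simp
  moreover have "(x ^ n / real n) / 2 = lam n * (tr n)\<^sup>2" for n by (simp add: lam_tr_sq x_def)
  ultimately have s: "(\<lambda>n. lam n * (tr n)\<^sup>2) sums (- ln (1 - x) / 2)" by simp
  have Lam_eq: "Lam L = (\<Sum>l\<le>L. lam l * (tr l)\<^sup>2)" for L
    unfolding Lam_def by (rule sum.mono_neutral_left) (auto simp: lam_def not_less_eq_eq Suc_le_eq)
  have "1 - x = (real k - real d) / (real k - 1)" using k_real by (simp add: x_def field_simps)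
  then have "- ln (1 - x) / 2 = ln ((real k - 1) / (real k - real d)) / 2" using k_real kd by (simp add: ln_div)
  also have "\<dots> = Lam_inf" using k_real kd by (simp add: Lam_inf_def ln_sqrt)
  finally have L: "- ln (1 - x) / 2 = Lam_inf" .
  show lim: "Lam \<longlonglongrightarrow> Lam_inf" using s unfolding L sums_def_le Lam_eq[abs_def] .
  have "incseq Lam" unfolding Lam_eq[abs_def] by (intro incseq_SucI) (simp add: lam_nonneg)
  then show "Lam L \<le> Lam_inf" using lim by (rule incseq_le)
  show "exp Lam_inf = sqrt ((real k - 1) / (real k - real d))" using k_real kd by (simp add: Lam_inf_def)
qed

text \<open>If there are at most \<open>M\<close> short cycles, this polynomial in the cycle indicators is the product
  of the factors \<open>1 + delta ^ l\<close> over the short cycles, to which \<open>X\<close> is asymptotically proportional.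
  Its first two moments only involve bounded sets of cycles.\<close>

definition trunc :: "nat \<Rightarrow> nat \<Rightarrow> nat \<Rightarrow> (nat \<times> nat \<Rightarrow> nat \<times> nat) \<Rightarrow> real" where
  "trunc L M r f = (\<Sum>s\<le>M. esym s tr (Cyc L r f))"

definition log_weight :: "nat \<Rightarrow> nat \<Rightarrow> (nat \<times> nat \<Rightarrow> nat \<times> nat) \<Rightarrow> real" where
  "log_weight L r f = (\<Sum>x\<in>Cyc L r f. ln (1 + tr (length x)))"

lemma Cyc_length: "x \<in> Cyc L r f \<Longrightarrow> length x \<ge> 1" "x \<in> Cyc L r f \<Longrightarrow> length x \<le> L"
  using short_D(3,4) by (auto simp: Cyc_def)

lemma esym_1: "finite A \<Longrightarrow> esym (Suc 0) \<theta> A = (\<Sum>x\<in>A. \<theta> (length x))"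
proof -
  assume A: "finite A"
  have "{S. S \<subseteq> A \<and> card S = Suc 0} = (\<lambda>x. {x}) ` A" by (auto simp: card_1_singleton_iff)
  then show ?thesis unfolding esym_def by (simp add: sum.reindex)
qed

lemma trunc_eq: "trunc L M r f = (\<Sum>S | S \<subseteq> Cyc L r f \<and> card S \<le> M. \<Prod>x\<in>S. tr (length x))"
  unfolding trunc_def esym_def by (rule sum_Pow_card_le) simp

lemma trunc_eq_exp:
  assumes "card (Cyc L r f) \<le> M" shows "trunc L M r f = exp (log_weight L r f)"
proof -
  have "{S. S \<subseteq> Cyc L r f \<and> card S \<le> M} = Pow (Cyc L r f)"
    using order_trans[OF card_mono[OF finite_Cyc[of L r f]] assms] by blast
  then have "trunc L M r f = (\<Prod>x\<in>Cyc L r f. tr (length x) + 1)"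
    unfolding trunc_eq using prod_add[OF finite_Cyc[of L r f], of "\<lambda>x. tr (length x)" "\<lambda>_. 1"] by simp
  also have "\<dots> = (\<Prod>x\<in>Cyc L r f. exp (ln (1 + tr (length x))))"
  proof (intro prod.cong refl)
    fix x assume "x \<in> Cyc L r f"
    then have "\<bar>tr (length x)\<bar> \<le> 1/2" using Cyc_length tr_bounds by blast
    then show "tr (length x) + 1 = exp (ln (1 + tr (length x)))" by (simp add: abs_le_iff)
  qed
  also have "\<dots> = exp (log_weight L r f)" by (simp add: log_weight_def exp_sum)
  finally show ?thesis .
qed

lemma trunc_square_le:
  "(trunc L M r f)\<^sup>2 \<le> (\<Sum>s\<le>M. esym s (\<lambda>l. 2 * tr l + (tr l)\<^sup>2) (Cyc L r f)) + (\<Sum>s\<in>{M<..2*M}. esym s (\<lambda>l. 2 * \<bar>tr l\<bar> + (tr l)\<^sup>2) (Cyc L r f))"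
proof -
  let ?A = "Cyc L r f" and ?g = "\<lambda>S :: step list set. \<Prod>x\<in>S. 2 * \<bar>tr (length x)\<bar> + (tr (length x))\<^sup>2"
  have "(\<Sum>s\<in>{M<..2*M}. \<Sum>S | S \<subseteq> ?A \<and> card S = s. ?g S) = (\<Sum>s\<in>{M<..2*M}. \<Sum>S\<in>{S\<in>{S. S \<subseteq> ?A \<and> M < card S \<and> card S \<le> 2*M}. card S = s}. ?g S)"
    by (intro sum.cong refl) auto
  also have "\<dots> = (\<Sum>S | S \<subseteq> ?A \<and> M < card S \<and> card S \<le> 2*M. ?g S)"
    by (rule sum.group) auto
  finally show ?thesis
    using square_truncated_le[OF finite_Cyc[of L r f], of "\<lambda>x. tr (length x)" M]
    unfolding trunc_eq esym_def sum_Pow_card_le[OF finite_Cyc] by simp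
qed

lemma E_card_Cyc: "(\<lambda>r. E r (\<lambda>f. real (card (Cyc L r f)))) \<longlonglongrightarrow> (\<Sum>l\<in>{1..L}. lam l)"
proof -
  have "real (card (Cyc L r f)) = esym 1 (\<lambda>_. 1) (Cyc L r f)" for r f by (simp add: esym_1)
  then show ?thesis using E_esym_tendsto[where s = 1 and \<theta> = "\<lambda>_. 1" and L = L] by simp
qed

text \<open>The square expands into the first two elementary symmetric polynomials. In the limit the
  mean cancels and the variance of a weighted sum of independent Poisson variables remains.\<close>

lemma log_weight_variance:
  fixes L
  defines "a \<equiv> \<lambda>l. ln (1 + tr l)" and "\<mu> \<equiv> (\<Sum>l\<in>{1..L}. lam l * ln (1 + tr l))"
  shows "(\<lambda>r. E r (\<lambda>f. (log_weight L r f - \<mu>)\<^sup>2)) \<longlonglongrightarrow> (\<Sum>l\<in>{1..L}. lam l * (a l)\<^sup>2)"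
proof -
  have E1: "E r (\<lambda>f. 1) = 1" for r by (simp add: E_def card_Om)
  have sq: "(log_weight L r f - \<mu>)\<^sup>2 = (esym 1 (\<lambda>l. (a l)\<^sup>2) (Cyc L r f) + 2 * esym 2 a (Cyc L r f)) - 2 * \<mu> * esym 1 a (Cyc L r f) + \<mu>\<^sup>2 * 1" for r f
  proof -
    have "(log_weight L r f)\<^sup>2 = esym 1 (\<lambda>l. (a l)\<^sup>2) (Cyc L r f) + 2 * esym 2 a (Cyc L r f)"
      using square_sum_eq[OF finite_Cyc[of L r f], of "\<lambda>x. a (length x)"] unfolding log_weight_def a_def One_nat_def esym_1[OF finite_Cyc] by (simp only: esym_def)
    moreover have "log_weight L r f = esym 1 a (Cyc L r f)" unfolding One_nat_def esym_1[OF finite_Cyc] log_weight_def a_def ..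
    ultimately show ?thesis by (simp add: power2_diff)
  qed
  have "(\<lambda>r. E r (\<lambda>f. esym 1 (\<lambda>l. (a l)\<^sup>2) (Cyc L r f)) + 2 * E r (\<lambda>f. esym 2 a (Cyc L r f)) - 2 * \<mu> * E r (\<lambda>f. esym 1 a (Cyc L r f)) + \<mu>\<^sup>2 * 1)
     \<longlonglongrightarrow> (\<Sum>l\<in>{1..L}. lam l * (a l)\<^sup>2) ^ 1 / fact 1 + 2 * (\<mu> ^ 2 / fact 2) - 2 * \<mu> * (\<mu> ^ 1 / fact 1) + \<mu>\<^sup>2 * 1"
    unfolding \<mu>_def a_def by (intro tendsto_add tendsto_diff tendsto_mult tendsto_const E_esym_tendsto)
  moreover have "E r (\<lambda>f. (log_weight L r f - \<mu>)\<^sup>2) = E r (\<lambda>f. esym 1 (\<lambda>l. (a l)\<^sup>2) (Cyc L r f)) + 2 * E r (\<lambda>f. esym 2 a (Cyc L r f)) - 2 * \<mu> * E r (\<lambda>f. esym 1 a (Cyc L r f)) + \<mu>\<^sup>2 * 1" for r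
    unfolding sq E_add E_diff E_cmult E1 ..
  ultimately show ?thesis by (simp add: power2_eq_square)
qed

text \<open>Since \<open>delta\<close> is at most 1/2 in absolute value, \<open>1 + tr l\<close>
  stays away from 0 and ln is controlled to second order. Both bounds are multiples of
  \<open>(tr l)^2\<close>, whose weighted sums are bounded in L.\<close>

lemma ln_tr_bounds:
  assumes "l \<ge> 1"
  shows "(ln (1 + tr l))\<^sup>2 \<le> 4 * (tr l)\<^sup>2" "ln (1 + tr l) \<ge> tr l - 2 * (tr l)\<^sup>2"
proof -
  have t: "\<bar>tr l\<bar> \<le> 1/2" by (rule tr_bounds[OF assms])
  have b: "\<bar>ln (1 + tr l) - tr l\<bar> \<le> 2 * (tr l)\<^sup>2" using t by (rule abs_ln_one_plus_x_minus_x_bound)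
  then show "ln (1 + tr l) \<ge> tr l - 2 * (tr l)\<^sup>2" by linarith
  have "2 * (tr l)\<^sup>2 = 2 * \<bar>tr l\<bar> * \<bar>tr l\<bar>" by (simp add: power2_eq_square)
  also have "\<dots> \<le> 1 * \<bar>tr l\<bar>" using t by (intro mult_right_mono) auto
  finally have "\<bar>ln (1 + tr l)\<bar> \<le> \<bar>2 * tr l\<bar>" using b by linarith
  then have "(ln (1 + tr l))\<^sup>2 \<le> (2 * tr l)\<^sup>2" by (simp only: abs_le_square_iff)
  then show "(ln (1 + tr l))\<^sup>2 \<le> 4 * (tr l)\<^sup>2" by (simp add: power_mult_distrib)
qed

text \<open>If X vanishes, there are three possibilities. There may be more than M short cycles,
  which is paid for by Markov's inequality. The log weight may lie below \<open>Z - c\<close>, hence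
  at least K below \<mu>, which is paid for by Chebyshev's inequality. Otherwise
  \<open>trunc\<close> is the full product, at least \<open>exp (Z - c)\<close>, and the distance
  \<open>D\<close> is at least \<open>exp (- c)\<close> in absolute value, which is paid for by the
  second moment of \<open>D\<close>. In each case one of the three nonnegative summands is at least
  1.\<close>

lemma prob_unsat_le:
  fixes L M r :: nat and K c :: real
  defines "Z \<equiv> (\<Sum>l\<in>{1..L}. lam l * tr l)" and "\<mu> \<equiv> (\<Sum>l\<in>{1..L}. lam l * ln (1 + tr l))"
  assumes M: "M > 0" and K: "K > 0" and \<mu>: "Z - c + K \<le> \<mu>"
  shows "E r (\<lambda>f. of_bool (X r f = 0)) \<le> E r (\<lambda>f. real (card (Cyc L r f))) / real M + E r (\<lambda>f. (log_weight L r f - \<mu>)\<^sup>2) / K\<^sup>2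
     + (E r (\<lambda>f. (X r f)\<^sup>2) / (E r (X r))\<^sup>2 - 2 * exp (- Z) * (\<Sum>s\<le>M. E r (\<lambda>f. X r f * esym s tr (Cyc L r f)) / E r (X r))
        + (exp (- Z))\<^sup>2 * ((\<Sum>s\<le>M. E r (\<lambda>f. esym s (\<lambda>l. 2 * tr l + (tr l)\<^sup>2) (Cyc L r f))) + (\<Sum>s\<in>{M<..2*M}. E r (\<lambda>f. esym s (\<lambda>l. 2 * \<bar>tr l\<bar> + (tr l)\<^sup>2) (Cyc L r f))))) / (exp (- c))\<^sup>2"
proof -
  define D where "D f = X r f / E r (X r) - exp (- Z) * trunc L M r f" for f
  define G where "G f = (\<Sum>s\<le>M. esym s (\<lambda>l. 2 * tr l + (tr l)\<^sup>2) (Cyc L r f)) + (\<Sum>s\<in>{M<..2*M}. esym s (\<lambda>l. 2 * \<bar>tr l\<bar> + (tr l)\<^sup>2) (Cyc L r f))" for f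
  have pt: "of_bool (X r f = 0) \<le> inverse (real M) * real (card (Cyc L r f)) + inverse (K\<^sup>2) * (log_weight L r f - \<mu>)\<^sup>2 + inverse ((exp (- c))\<^sup>2) * (D f)\<^sup>2" (is "_ \<le> ?a + ?b + ?c") for f
  proof (cases "X r f = 0")
    case True
    have nn: "?a \<ge> 0" "?b \<ge> 0" "?c \<ge> 0" and le1: "of_bool (X r f = 0) \<le> (1 :: real)" by auto
    consider "card (Cyc L r f) > M" | "log_weight L r f < Z - c" | "card (Cyc L r f) \<le> M" "log_weight L r f \<ge> Z - c" by linarith
    then show ?thesis
    proof cases
      case 1
      then have "?a \<ge> 1" using M by (simp add: field_simps)
      then show ?thesis using nn le1 by linarith
    next
      case 2
      then have "\<bar>log_weight L r f - \<mu>\<bar> \<ge> \<bar>K\<bar>" using \<mu> K by linarith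
      then have "(log_weight L r f - \<mu>)\<^sup>2 \<ge> K\<^sup>2" by (simp only: abs_le_square_iff)
      then have "?b \<ge> 1" using K by (simp add: field_simps)
      then show ?thesis using nn le1 by linarith
    next
      case 3
      have "exp (- c) \<le> exp (- Z) * exp (log_weight L r f)" using 3 by (simp flip: exp_add)
      then have "(exp (- c))\<^sup>2 \<le> (exp (- Z) * exp (log_weight L r f))\<^sup>2" by (rule power_mono) simp
      also have "\<dots> = (D f)\<^sup>2" using True trunc_eq_exp[OF 3(1)] by (simp add: D_def)
      finally have "?c \<ge> 1" by (simp add: field_simps)
      then show ?thesis using nn le1 by linarith
    qed
  qed auto
  have ED: "E r (\<lambda>f. (D f)\<^sup>2) \<le> E r (\<lambda>f. (X r f)\<^sup>2) / (E r (X r))\<^sup>2 - 2 * exp (- Z) * (\<Sum>s\<le>M. E r (\<lambda>f. X r f * esym s tr (Cyc L r f)) / E r (X r)) + (exp (- Z))\<^sup>2 * E r G"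
  proof -
    have "E r (\<lambda>f. (D f)\<^sup>2) \<le> E r (\<lambda>f. inverse ((E r (X r))\<^sup>2) * (X r f)\<^sup>2 - (2 * exp (- Z) / E r (X r)) * (\<Sum>s\<le>M. X r f * esym s tr (Cyc L r f)) + (exp (- Z))\<^sup>2 * G f)"
    proof (rule E_mono)
      fix f
      have "(D f)\<^sup>2 = inverse ((E r (X r))\<^sup>2) * (X r f)\<^sup>2 - (2 * exp (- Z) / E r (X r)) * (X r f * trunc L M r f) + (exp (- Z))\<^sup>2 * (trunc L M r f)\<^sup>2"
        by (simp add: D_def power2_diff power_divide power_mult_distrib divide_inverse power_inverse mult_ac)
      also have "\<dots> \<le> inverse ((E r (X r))\<^sup>2) * (X r f)\<^sup>2 - (2 * exp (- Z) / E r (X r)) * (X r f * trunc L M r f) + (exp (- Z))\<^sup>2 * G f"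
        unfolding G_def by (intro add_left_mono mult_left_mono trunc_square_le) simp
      finally show "(D f)\<^sup>2 \<le> inverse ((E r (X r))\<^sup>2) * (X r f)\<^sup>2 - (2 * exp (- Z) / E r (X r)) * (\<Sum>s\<le>M. X r f * esym s tr (Cyc L r f)) + (exp (- Z))\<^sup>2 * G f"
        by (simp add: trunc_def sum_distrib_left)
    qed
    also have "\<dots> = inverse ((E r (X r))\<^sup>2) * E r (\<lambda>f. (X r f)\<^sup>2) - (2 * exp (- Z) / E r (X r)) * (\<Sum>s\<le>M. E r (\<lambda>f. X r f * esym s tr (Cyc L r f))) + (exp (- Z))\<^sup>2 * E r G"
      by (simp only: E_add E_diff E_cmult E_sum)
    finally show ?thesis by (simp add: divide_inverse sum_distrib_left mult_ac)
  qed
  have EG: "E r G = (\<Sum>s\<le>M. E r (\<lambda>f. esym s (\<lambda>l. 2 * tr l + (tr l)\<^sup>2) (Cyc L r f))) + (\<Sum>s\<in>{M<..2*M}. E r (\<lambda>f. esym s (\<lambda>l. 2 * \<bar>tr l\<bar> + (tr l)\<^sup>2) (Cyc L r f)))"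
    unfolding G_def[abs_def] by (simp only: E_add E_sum)
  have "E r (\<lambda>f. of_bool (X r f = 0)) \<le> E r (\<lambda>f. inverse (real M) * real (card (Cyc L r f)) + inverse (K\<^sup>2) * (log_weight L r f - \<mu>)\<^sup>2 + inverse ((exp (- c))\<^sup>2) * (D f)\<^sup>2)"
    by (rule E_mono) (rule pt)
  also have "\<dots> = E r (\<lambda>f. real (card (Cyc L r f))) / real M + E r (\<lambda>f. (log_weight L r f - \<mu>)\<^sup>2) / K\<^sup>2 + E r (\<lambda>f. (D f)\<^sup>2) / (exp (- c))\<^sup>2"
    unfolding E_add E_cmult divide_inverse by (simp only: mult.commute)
  also have "\<dots> \<le> E r (\<lambda>f. real (card (Cyc L r f))) / real M + E r (\<lambda>f. (log_weight L r f - \<mu>)\<^sup>2) / K\<^sup>2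
     + (E r (\<lambda>f. (X r f)\<^sup>2) / (E r (X r))\<^sup>2 - 2 * exp (- Z) * (\<Sum>s\<le>M. E r (\<lambda>f. X r f * esym s tr (Cyc L r f)) / E r (X r)) + (exp (- Z))\<^sup>2 * E r G) / (exp (- c))\<^sup>2"
    by (intro add_left_mono divide_right_mono ED) simp
  finally show ?thesis unfolding EG .
qed

text \<open>The order of the choices is essential: K and c depend on \<eta> only, so the loss
  \<open>exp (- c)\<close> is fixed before L is taken large enough to make
  \<open>exp (Lam L)\<close> nearly \<open>exp Lam_inf\<close>; M is chosen after L, and r grows
  last.\<close>

lemma prob_unsat_tendsto:
  assumes dstar: "real d < d_star k"
  shows "(\<lambda>r. E r (\<lambda>f. of_bool (X r f = 0))) \<longlonglongrightarrow> 0"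
proof (rule tendstoI)
  fix \<eta> :: real assume \<eta>: "\<eta> > 0"
  have dk: "d < k" using d_less_k[OF d_pos k_gt_2 dstar] .
  note Lt = Lam_tendsto[OF dk]
  have Li: "Lam_inf \<ge> 0" using Lt(2)[of 0] by (simp add: Lam_def)
  \<comment> \<open>The variance is at most \<open>4 * Lam_inf\<close> for every L, so this K makes
    Chebyshev's bound at most a quarter of \<eta>; the summand 1 keeps K positive when
    \<open>Lam_inf\<close> is 0.\<close>
  define K where "K = sqrt (16 * (Lam_inf + 1) / \<eta>)"
  have K: "K > 0" "K\<^sup>2 = 16 * (Lam_inf + 1) / \<eta>" using \<eta> Li by (auto simp: K_def)
  \<comment> \<open>\<open>ln (1 + t)\<close> is at least \<open>t - 2 * t^2\<close>, so \<mu> falls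
    short of Z by at most \<open>2 * Lam_inf\<close>; K is the room for the fluctuation.\<close>
  define c where "c = 2 * Lam_inf + K"
  \<comment> \<open>Spent twice, on the slack in the second moment and on the gap between
    \<open>exp (Lam L)\<close> and its limit; after division by \<open>(exp (- c))^2\<close> the two
    shares make up half of \<eta>.\<close>
  define \<epsilon> where "\<epsilon> = \<eta> * (exp (- c))\<^sup>2 / 4"
  have \<epsilon>: "\<epsilon> > 0" using \<eta> by (simp add: \<epsilon>_def)
  have "(\<lambda>L. exp (Lam L)) \<longlonglongrightarrow> exp Lam_inf" by (intro tendsto_exp Lt)
  then have "\<forall>\<^sub>F L in sequentially. exp Lam_inf - \<epsilon> < exp (Lam L)"
    by (rule order_tendstoD) (use \<epsilon> in simp)
  then obtain L where L: "exp Lam_inf - \<epsilon> < exp (Lam L)" by (auto simp: eventually_sequentially)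
  define Z where "Z = (\<Sum>l\<in>{1..L}. lam l * tr l)"
  define \<mu> where "\<mu> = (\<Sum>l\<in>{1..L}. lam l * ln (1 + tr l))"
  define v where "v = (\<Sum>l\<in>{1..L}. lam l * (ln (1 + tr l))\<^sup>2)"
  define W where "W = (\<Sum>l\<in>{1..L}. lam l * (2 * \<bar>tr l\<bar> + (tr l)\<^sup>2))"
  have s1: "(\<Sum>l\<in>{1..L}. lam l * (tr l * (1 + delta ^ l))) = Z + Lam L"
    by (simp add: Z_def Lam_def tr_def sum.distrib power2_eq_square algebra_simps)
  have s2: "(\<Sum>l\<in>{1..L}. lam l * (2 * tr l + (tr l)\<^sup>2)) = 2 * Z + Lam L"
    by (simp add: Z_def Lam_def sum.distrib sum_distrib_left algebra_simps)
  have \<mu>: "Z - c + K \<le> \<mu>"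
  proof -
    have "Z - 2 * Lam L = (\<Sum>l\<in>{1..L}. lam l * (tr l - 2 * (tr l)\<^sup>2))"
      by (simp add: Z_def Lam_def sum_subtractf sum_distrib_left algebra_simps)
    also have "\<dots> \<le> \<mu>" unfolding \<mu>_def by (intro sum_mono mult_left_mono ln_tr_bounds lam_nonneg) auto
    finally show ?thesis using Lt(2)[of L] by (simp add: c_def)
  qed
  have v: "v / K\<^sup>2 \<le> \<eta> / 4"
  proof -
    have "v \<le> (\<Sum>l\<in>{1..L}. lam l * (4 * (tr l)\<^sup>2))"
      unfolding v_def by (intro sum_mono mult_left_mono ln_tr_bounds lam_nonneg) auto
    also have "\<dots> = 4 * Lam L" by (simp add: Lam_def sum_distrib_left mult_ac)
    finally have "v \<le> 4 * (Lam_inf + 1)" using Lt(2)[of L] by simp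
    then have "v / K\<^sup>2 \<le> 4 * (Lam_inf + 1) / K\<^sup>2" by (rule divide_right_mono) simp
    also have "\<dots> = \<eta> / 4" unfolding K(2) using Li \<eta> by (simp add: field_simps)
    finally show ?thesis .
  qed
  \<comment> \<open>\<open>h M\<close> is the limit in r of the bound from
    \<open>prob_unsat_le\<close> for fixed M, with the second moment ratio replaced by its
    asymptotic bound.\<close>
  define h where "h M = (\<Sum>l\<in>{1..L}. lam l) / real M + v / K\<^sup>2 + (exp Lam_inf + \<epsilon> - 2 * exp (- Z) * (\<Sum>s\<le>M. (Z + Lam L) ^ s / fact s)
        + (exp (- Z))\<^sup>2 * ((\<Sum>s\<le>M. (2 * Z + Lam L) ^ s / fact s) + (\<Sum>s\<in>{M<..2*M}. W ^ s / fact s))) / (exp (- c))\<^sup>2" for M :: nat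
  have "h \<longlonglongrightarrow> 0 + v / K\<^sup>2 + (exp Lam_inf + \<epsilon> - 2 * exp (- Z) * exp (Z + Lam L) + (exp (- Z))\<^sup>2 * (exp (2 * Z + Lam L) + 0)) / (exp (- c))\<^sup>2"
    unfolding h_def
    by (intro tendsto_add tendsto_divide tendsto_diff tendsto_mult tendsto_const exp_partial_sums exp_partial_sums_tail
          real_tendsto_divide_at_top[OF tendsto_const filterlim_real_sequentially]) auto
  \<comment> \<open>For large M the cross term becomes twice \<open>exp (Lam L)\<close> and the
    square of the polynomial once \<open>exp (Lam L)\<close>, so the mean square distance is left
    with \<open>exp Lam_inf + \<epsilon> - exp (Lam L)\<close>.\<close>
  moreover have "2 * exp (- Z) * exp (Z + Lam L) = 2 * exp (Lam L)" by (simp flip: exp_add)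
  moreover have "(exp (- Z))\<^sup>2 * (exp (2 * Z + Lam L) + 0) = exp (Lam L)"
    by (simp add: power2_eq_square flip: exp_add)
  ultimately have hlim: "h \<longlonglongrightarrow> v / K\<^sup>2 + (exp Lam_inf + \<epsilon> - exp (Lam L)) / (exp (- c))\<^sup>2" by simp
  have "(exp Lam_inf + \<epsilon> - exp (Lam L)) / (exp (- c))\<^sup>2 < (2 * \<epsilon>) / (exp (- c))\<^sup>2"
    using L by (intro divide_strict_right_mono) auto
  also have "\<dots> = \<eta> / 2" by (simp add: \<epsilon>_def)
  finally have "v / K\<^sup>2 + (exp Lam_inf + \<epsilon> - exp (Lam L)) / (exp (- c))\<^sup>2 < \<eta>" using v \<eta> by linarith
  from order_tendstoD(2)[OF hlim this] have "\<forall>\<^sub>F M in sequentially. h M < \<eta> \<and> M > 0"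
    using eventually_gt_at_top[of 0] by eventually_elim simp
  then obtain M where M: "h M < \<eta>" "M > 0" by (auto simp: eventually_sequentially)
  define H where "H r = E r (\<lambda>f. real (card (Cyc L r f))) / real M + E r (\<lambda>f. (log_weight L r f - \<mu>)\<^sup>2) / K\<^sup>2
     + (exp Lam_inf + \<epsilon> - 2 * exp (- Z) * (\<Sum>s\<le>M. E r (\<lambda>f. X r f * esym s tr (Cyc L r f)) / E r (X r))
        + (exp (- Z))\<^sup>2 * ((\<Sum>s\<le>M. E r (\<lambda>f. esym s (\<lambda>l. 2 * tr l + (tr l)\<^sup>2) (Cyc L r f))) + (\<Sum>s\<in>{M<..2*M}. E r (\<lambda>f. esym s (\<lambda>l. 2 * \<bar>tr l\<bar> + (tr l)\<^sup>2) (Cyc L r f))))) / (exp (- c))\<^sup>2" for r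
  have "H \<longlonglongrightarrow> h M"
    unfolding H_def h_def s1[symmetric] s2[symmetric] W_def v_def \<mu>_def
    using M(2) K(1)
    by (intro tendsto_add tendsto_divide tendsto_diff tendsto_mult tendsto_sum tendsto_const E_card_Cyc log_weight_variance E_X_esym_tendsto[OF dstar] E_esym_tendsto) auto
  then have ev: "\<forall>\<^sub>F r in sequentially. H r < \<eta>" using M(1) by (rule order_tendstoD)
  have "\<forall>\<^sub>F r in sequentially. E r (\<lambda>f. (X r f)\<^sup>2) \<le> (exp Lam_inf + \<epsilon>) * (E r (X r))\<^sup>2"
    using second_moment_ratio_bounded[OF dstar \<epsilon>] unfolding Lt(3) .
  with ev show "\<forall>\<^sub>F r in sequentially. dist (E r (\<lambda>f. of_bool (X r f = 0))) 0 < \<eta>"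
  proof eventually_elim
    case (elim r)
    have "E r (\<lambda>f. (X r f)\<^sup>2) / (E r (X r))\<^sup>2 \<le> exp Lam_inf + \<epsilon>"
      using elim(2) E_X_pos[of r] by (subst pos_divide_le_eq) auto
    then have "E r (\<lambda>f. of_bool (X r f = 0)) \<le> H r"
      unfolding H_def
      by (intro order_trans[OF prob_unsat_le[OF M(2) K(1) \<mu>[unfolded Z_def \<mu>_def]], folded Z_def \<mu>_def] add_mono divide_right_mono diff_mono order_refl) simp_all
    moreover have "0 \<le> E r (\<lambda>f. of_bool (X r f = 0))" by (rule E_nonneg) simp
    ultimately show ?case using elim(1) by simp
  qed
qed

lemma prob_satisfiable:
  "measure_pmf.prob (random_formula (k*r) d k) {f. satisfiable (k*r) d k f} = 1 - E r (\<lambda>f. of_bool (X r f = 0))"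
proof -
  have ne: "Om r \<noteq> {}" using card_Om[of r] by (metis card.empty fact_nonzero)
  have iff: "satisfiable (k*r) d k f \<longleftrightarrow> X r f \<noteq> 0" for f
  proof -
    have "finite {T. satisfying_assignment (k*r) d k f T}"
      by (rule finite_subset[of _ "Pow {..<k*r}"]) (auto simp: satisfying_assignment_def)
    then show ?thesis by (auto simp: X_def satisfiable_def)
  qed
  have "measure_pmf.prob (random_formula (k*r) d k) {f. satisfiable (k*r) d k f} = real (card (Om r \<inter> {f. satisfiable (k*r) d k f})) / real (card (Om r))"
    unfolding random_formula_def matchings_eq by (rule measure_pmf_of_set[OF ne finite_Om])
  also have "Om r \<inter> {f. satisfiable (k*r) d k f} = Om r - {f\<in>Om r. X r f = 0}" by (auto simp: iff)
  also have "real (card (Om r - {f\<in>Om r. X r f = 0})) = real (card (Om r)) - real (card {f\<in>Om r. X r f = 0})"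
    by (subst card_Diff_subset) (auto intro!: of_nat_diff card_mono)
  also have "(real (card (Om r)) - real (card {f\<in>Om r. X r f = 0})) / real (card (Om r)) = 1 - E r (\<lambda>f. of_bool (X r f = 0))"
    unfolding E_def sum_of_bool_card[OF finite_Om] by (simp add: card_Om diff_divide_distrib)
  finally show ?thesis .
qed

end

theorem theorem3:
  fixes d k :: nat
  assumes "d > 0" and "k > 2" and "real d < d_star k"
  shows "((\<lambda>n. measure_pmf.prob (random_formula n d k) {f. satisfiable n d k f}) \<longlongrightarrow> 1)
           (inf sequentially (principal {n. k dvd n}))"
proof -
  interpret exact_cover d k using assms by unfold_locales
  have lim: "(\<lambda>r. measure_pmf.prob (random_formula (k*r) d k) {f. satisfiable (k*r) d k f}) \<longlonglongrightarrow> 1"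
    unfolding prob_satisfiable using tendsto_diff[OF tendsto_const prob_unsat_tendsto[OF assms(3)], of 1] by simp
  show ?thesis
  proof (rule topological_tendstoI)
    fix S :: "real set" assume S: "open S" "1 \<in> S"
    from topological_tendstoD[OF lim S] obtain R where
      R: "\<And>r. r \<ge> R \<Longrightarrow> measure_pmf.prob (random_formula (k*r) d k) {f. satisfiable (k*r) d k f} \<in> S"
      by (auto simp: eventually_sequentially)
    have "measure_pmf.prob (random_formula n d k) {f. satisfiable n d k f} \<in> S" if n: "n \<ge> k * R" "k dvd n" for n
    proof -
      obtain r where "n = k * r" using n(2) by blast
      then show ?thesis using R[of r] n(1) assms(2) by simp
    qed
    then show "\<forall>\<^sub>F n in inf sequentially (principal {n. k dvd n}). measure_pmf.prob (random_formula n d k) {f. satisfiable n d k f} \<in> S"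
      unfolding eventually_inf_principal eventually_sequentially by blast
  qed
qed

end
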